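(* Let $G$ be a minimum counterexample to the 2-Decomposition Conjecture; that is, $G \in \mathcal{S}_{2,3}$ cannot be decomposed into a spanning tree and a matching, and $\varphi(G)$ is minimum among all graphs in $\mathcal{S}_{2,3}$ that cannot be decomposed into a spanning tree and a matching. Then $G$ satisfies the following properties: (1) $G$ is simple and $2$-edge-connected; (2) the girth of $G$ is at least $5$; (3) the distance between (distinct) vertices in $V_2(G)$ is at least $3$; (4) $G - V_2(G)$ is connected; (5) there is a cycle $C \subseteq G$ for which $V(C) \subseteq V_3(G)$.
   Context: All graphs are finite and have no loops, but may contain parallel edges. A cycle is a connected $2$-regular graph; cycles with two edges (formed by two parallel edges) are allowed. For $F \subseteq E(G)$, $G \setminus F$ denotes the graph $(V(G), E(G)\setminus F)$ (no vertices are deleted). A cycle $C$ in a connected graph $G$ is separating if $G \setminus E(C)$ is disconnected. $\mathcal{S}_{2,3}$ is the class of connected graphs with minimum degree at least $2$ and maximum degree at most $3$ in which every cycle is separating. For a graph $G$, $\varphi(G) = |V(G)| + |E(G)|$. $V_k(G)$ denotes the set of vertices of $G$ of degree $k$, and $G - S$ denotes the graph obtained from $G$ by deleting the vertices in $S$ and all edges incident to them. $G$ is decomposed into a spanning tree and a matching if $E(G)$ can be partitioned into the edge set of a spanning tree of $G$ and a (possibly empty) matching. The 2-Decomposition Conjecture asserts that every graph in $\mathcal{S}_{2,3}$ can be decomposed into a spanning tree and a matching. *)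

theory Defs
  imports Main "HOL-Library.Extended_Nat"
begin

text \<open>
  Loopless multigraphs: an edge is an abstract object mapped to its two-element set of
  end vertices, so distinct edges may be parallel. The values of \<open>ends\<close> outside \<open>edges\<close>
  carry no meaning.
\<close>

record ('v, 'e) mgraph =
  verts :: "'v set"
  edges :: "'e set"
  ends :: "'e \<Rightarrow> 'v set"

definition graph :: "('v, 'e) mgraph \<Rightarrow> bool" where
  "graph G \<longleftrightarrow> finite (verts G) \<and> finite (edges G) \<and>
     (\<forall>e \<in> edges G. ends G e \<subseteq> verts G \<and> card (ends G e) = 2)"

definition subgraph :: "('v, 'e) mgraph \<Rightarrow> ('v, 'e) mgraph \<Rightarrow> bool" where
  "subgraph H G \<longleftrightarrow> graph H \<and> verts H \<subseteq> verts G \<and> edges H \<subseteq> edges G \<and>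
     (\<forall>e \<in> edges H. ends H e = ends G e)"

definition del_edges :: "('v, 'e) mgraph \<Rightarrow> 'e set \<Rightarrow> ('v, 'e) mgraph" where
  "del_edges G F = \<lparr>verts = verts G, edges = edges G - F, ends = ends G\<rparr>"

definition del_verts :: "('v, 'e) mgraph \<Rightarrow> 'v set \<Rightarrow> ('v, 'e) mgraph" where
  "del_verts G S =
     \<lparr>verts = verts G - S, edges = {e \<in> edges G. ends G e \<inter> S = {}}, ends = ends G\<rparr>"

definition adjacent :: "('v, 'e) mgraph \<Rightarrow> 'v \<Rightarrow> 'v \<Rightarrow> bool" where
  "adjacent G u v \<longleftrightarrow> (\<exists>e \<in> edges G. ends G e = {u, v})"

text \<open>
  A path is given by its sequence of vertices; which of several parallel edges it uses
  is irrelevant to its ends and its length \<open>length p - 1\<close>.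
\<close>

definition path_between :: "('v, 'e) mgraph \<Rightarrow> 'v \<Rightarrow> 'v list \<Rightarrow> 'v \<Rightarrow> bool" where
  "path_between G u p v \<longleftrightarrow> p \<noteq> [] \<and> hd p = u \<and> last p = v \<and>
     set p \<subseteq> verts G \<and> distinct p \<and> successively (adjacent G) p"

text \<open>The graph without vertices does not count as connected.\<close>

definition connected_graph :: "('v, 'e) mgraph \<Rightarrow> bool" where
  "connected_graph G \<longleftrightarrow> graph G \<and> verts G \<noteq> {} \<and>
     (\<forall>u \<in> verts G. \<forall>v \<in> verts G. \<exists>p. path_between G u p v)"

text \<open>The infimum of the empty set is \<open>\<infinity>\<close>, both here and in \<open>girth\<close> below.\<close>

definition distance :: "('v, 'e) mgraph \<Rightarrow> 'v \<Rightarrow> 'v \<Rightarrow> enat" where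
  "distance G u v = (INF p \<in> {p. path_between G u p v}. enat (length p - 1))"

definition degree :: "('v, 'e) mgraph \<Rightarrow> 'v \<Rightarrow> nat" where
  "degree G v = card {e \<in> edges G. v \<in> ends G e}"

definition min_degree :: "('v, 'e) mgraph \<Rightarrow> nat" where
  "min_degree G = Min (degree G ` verts G)"

definition max_degree :: "('v, 'e) mgraph \<Rightarrow> nat" where
  "max_degree G = Max (degree G ` verts G)"

definition verts_of_degree :: "nat \<Rightarrow> ('v, 'e) mgraph \<Rightarrow> 'v set" where
  "verts_of_degree k G = {v \<in> verts G. degree G v = k}"

definition cycle :: "('v, 'e) mgraph \<Rightarrow> bool" where
  "cycle C \<longleftrightarrow> connected_graph C \<and> (\<forall>v \<in> verts C. degree C v = 2)"

definition cycle_in :: "('v, 'e) mgraph \<Rightarrow> ('v, 'e) mgraph \<Rightarrow> bool" where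
  "cycle_in C G \<longleftrightarrow> cycle C \<and> subgraph C G"

definition separating :: "('v, 'e) mgraph \<Rightarrow> ('v, 'e) mgraph \<Rightarrow> bool" where
  "separating G C \<longleftrightarrow> \<not> connected_graph (del_edges G (edges C))"

definition girth :: "('v, 'e) mgraph \<Rightarrow> enat" where
  "girth G = (INF C \<in> {C. cycle_in C G}. enat (card (edges C)))"

text \<open>Loops are already excluded by \<open>graph\<close>.\<close>

definition simple :: "('v, 'e) mgraph \<Rightarrow> bool" where
  "simple G \<longleftrightarrow> graph G \<and> inj_on (ends G) (edges G)"

definition edge_connected :: "nat \<Rightarrow> ('v, 'e) mgraph \<Rightarrow> bool" where
  "edge_connected k G \<longleftrightarrow> graph G \<and> card (verts G) > 1 \<and>
     (\<forall>F \<subseteq> edges G. card F < k \<longrightarrow> connected_graph (del_edges G F))"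

definition tree :: "('v, 'e) mgraph \<Rightarrow> bool" where
  "tree T \<longleftrightarrow> connected_graph T \<and> (\<nexists>C. cycle_in C T)"

definition spanning_tree :: "('v, 'e) mgraph \<Rightarrow> ('v, 'e) mgraph \<Rightarrow> bool" where
  "spanning_tree T G \<longleftrightarrow> tree T \<and> subgraph T G \<and> verts T = verts G"

definition matching :: "('v, 'e) mgraph \<Rightarrow> 'e set \<Rightarrow> bool" where
  "matching G M \<longleftrightarrow> M \<subseteq> edges G \<and>
     (\<forall>e \<in> M. \<forall>f \<in> M. e \<noteq> f \<longrightarrow> ends G e \<inter> ends G f = {})"

definition tree_matching_decomposable :: "('v, 'e) mgraph \<Rightarrow> bool" where
  "tree_matching_decomposable G \<longleftrightarrow>
     (\<exists>T M. spanning_tree T G \<and> matching G M \<and>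
        edges T \<union> M = edges G \<and> edges T \<inter> M = {})"

definition S23 :: "('v, 'e) mgraph set" where
  "S23 = {G. connected_graph G \<and> min_degree G \<ge> 2 \<and> max_degree G \<le> 3 \<and>
     (\<forall>C. cycle_in C G \<longrightarrow> separating G C)}"

definition phi :: "('v, 'e) mgraph \<Rightarrow> nat" where
  "phi G = card (verts G) + card (edges G)"

definition counterexample :: "('v, 'e) mgraph \<Rightarrow> bool" where
  "counterexample G \<longleftrightarrow> G \<in> S23 \<and> \<not> tree_matching_decomposable G"

text \<open>
  The minimum is over all finite graphs. A formula cannot quantify over types, so the
  competitors \<open>H\<close> have natural numbers as vertices and edges; every finite graph is
  isomorphic to such a graph.
\<close>

definition minimum_counterexample :: "('v, 'e) mgraph \<Rightarrow> bool" where
  "minimum_counterexample G \<longleftrightarrow> counterexample G \<and>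
     (\<forall>H :: (nat, nat) mgraph. counterexample H \<longrightarrow> phi G \<le> phi H)"

end

theory Submission
  imports Defs
begin

text \<open>
  Suppose that a property fails. Usually a graph \<open>H\<close> of the class with smaller \<open>phi\<close> is then built
  from \<open>G\<close>, and a decomposition of \<open>H\<close>, which exists by minimality, is turned into one of \<open>G\<close>. In
  the remaining cases \<open>G\<close> has a nonseparating cycle or can be decomposed directly.

  Three reformulations keep the transport between \<open>G\<close> and \<open>H\<close> short. Connectedness is tested by
  two-colourings of the vertices: a graph is connected iff a colouring that is constant on every
  edge is constant (\<open>linked\<close>). Cycles are replaced by nonempty edge sets in which every vertex has
  valency 0 or 2 (\<open>two_regular\<close>); such a set contains a cycle, and giving back edges cannot
  disconnect a graph, so all cycles are separating iff all these sets are. A rerouted cycle thus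
  need not be shown to be a single cycle. Finally, a spanning tree is a connected spanning subgraph
  with one edge less than vertices, so that a decomposition is a matching \<open>M\<close> with
  \<open>|E| + 1 = |V| + |M|\<close> whose complement is connected. The locale \<open>local_change\<close> collects what is
  common to the constructions of \<open>H\<close>.

  The first construction is the contraction of an edge at a vertex of degree 2
  (\<open>contract_degree_2\<close>). The decomposition always lifts; the new graph lies in the class if every
  cycle through the new edge is separating, for instance because it contains another vertex of
  degree 2. This excludes bridges with an end of degree 2, adjacent vertices of degree 2 and
  vertices with three neighbours of degree 2. At a bridge with two ends of degree 3 the graph is
  cut into two smaller ones. In a bridgeless graph, a component of \<open>G\<close> minus the edges of a cycle
  \<open>C\<close> cannot meet \<open>C\<close> in a single vertex of degree 3 (\<open>same_side\<close>), since the third edge of that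
  vertex would be a bridge. This excludes parallel edges and triangles without a vertex of
  degree 2, and it shows that a 4-cycle without a vertex of degree 2 is split two against two.

  Let \<open>u\<close> and \<open>v\<close> have degree 2 and a common neighbour \<open>w\<close>. Then the third edge at \<open>w\<close> is deleted
  and the path through \<open>u\<close>, \<open>w\<close>, \<open>v\<close> is contracted to a path through \<open>w\<close> alone. A triangle with a vertex of
  degree 2 is contracted to a vertex. A 4-cycle \<open>a b c d\<close> with \<open>a\<close> of degree 2 is deleted, and the
  outer neighbours of \<open>b\<close> and \<open>c\<close> are joined by an edge. A 4-cycle \<open>p q r s\<close> with all degrees 3,
  whose removal separates \<open>p\<close> from \<open>q\<close> and \<open>r\<close> from \<open>s\<close>, is deleted, and two new edges join the
  outer neighbours of \<open>p\<close> and \<open>q\<close> and those of \<open>r\<close> and \<open>s\<close>; these two edges form a cut, so no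
  nonseparating cycle uses them and the matching contains at most one of them.

  If \<open>G - V\<^sub>2(G)\<close> is disconnected, some vertex of degree 2 has its neighbours in different
  components, and every cycle through it meets a further vertex of degree 2, so that it can be
  contracted. Finally, if every cycle met \<open>V\<^sub>2(G)\<close>, then \<open>G - V\<^sub>2(G)\<close> would be a tree. Hanging each
  vertex of degree 2 on it by one of its edges gives a spanning tree, and the other edges at these
  vertices form a matching because the vertices of degree 2 have pairwise distance at least 3.
\<close>

section \<open>Connectedness by two-colourings\<close>

definition edge_constant :: "('v, 'e) mgraph \<Rightarrow> 'e set \<Rightarrow> ('v \<Rightarrow> bool) \<Rightarrow> bool" where
  "edge_constant G A P \<longleftrightarrow> (\<forall>e\<in>A. (\<forall>x\<in>ends G e. P x) \<or> (\<forall>x\<in>ends G e. \<not> P x))"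

text \<open>
  If \<open>G\<close> has a vertex, this is the connectedness of the graph with vertex set \<open>verts G\<close> and edge
  set \<open>A\<close>. Colourings are easier to move between graphs than paths: after a local change of the
  graph only the colours of the changed vertices have to be given, and no path is rerouted.
\<close>

definition linked :: "('v, 'e) mgraph \<Rightarrow> 'e set \<Rightarrow> bool" where
  "linked G A \<longleftrightarrow>
     (\<forall>P. edge_constant G A P \<longrightarrow> (\<forall>x\<in>verts G. P x) \<or> (\<forall>x\<in>verts G. \<not> P x))"

definition valency :: "('v, 'e) mgraph \<Rightarrow> 'e set \<Rightarrow> 'v \<Rightarrow> nat" where
  "valency G F v = card {e \<in> F. v \<in> ends G e}"

text \<open>
  The edge sets of disjoint unions of cycles of \<open>G\<close>, including the empty union.
\<close>

definition two_regular :: "('v, 'e) mgraph \<Rightarrow> 'e set \<Rightarrow> bool" where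
  "two_regular G F \<longleftrightarrow> F \<subseteq> edges G \<and> (\<forall>v\<in>verts G. valency G F v = 0 \<or> valency G F v = 2)"

text \<open>
  The class \<open>S23\<close> in terms of colourings and two-regular edge sets; see \<open>S23_iff_admissible\<close> below.
\<close>

definition admissible :: "('v, 'e) mgraph \<Rightarrow> bool" where
  "admissible G \<longleftrightarrow> graph G \<and> verts G \<noteq> {} \<and> linked G (edges G) \<and>
     (\<forall>v\<in>verts G. degree G v = 2 \<or> degree G v = 3) \<and>
     (\<forall>F. two_regular G F \<longrightarrow> F \<noteq> {} \<longrightarrow> \<not> linked G (edges G - F))"

text \<open>
  By the count, the connected complement of \<open>M\<close> is a spanning tree. A count adds up under a local
  change of the graph, whereas the absence of cycles would need a second argument.
\<close>

definition splits :: "('v, 'e) mgraph \<Rightarrow> bool" where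
  "splits G \<longleftrightarrow> (\<exists>M. matching G M \<and> linked G (edges G - M) \<and>
     card (edges G) + 1 = card (verts G) + card M)"

lemma edge_constantI:
  "(\<And>e x y. e \<in> A \<Longrightarrow> x \<in> ends G e \<Longrightarrow> y \<in> ends G e \<Longrightarrow> P x = P y) \<Longrightarrow> edge_constant G A P"
  unfolding edge_constant_def by blast

lemma edge_constantI_ends:
  assumes "graph G" "A \<subseteq> edges G" "\<And>e x y. e \<in> A \<Longrightarrow> ends G e = {x, y} \<Longrightarrow> P x = P y"
  shows "edge_constant G A P"
  unfolding edge_constant_def
proof
  fix e assume e: "e \<in> A"
  then have "card (ends G e) = 2" using assms(1,2) by (auto simp: graph_def)
  then obtain x y where "ends G e = {x, y}" by (auto simp: card_2_iff)
  then show "(\<forall>x\<in>ends G e. P x) \<or> (\<forall>x\<in>ends G e. \<not> P x)" using assms(3)[OF e] by auto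
qed

lemma edge_constantD:
  "edge_constant G A P \<Longrightarrow> e \<in> A \<Longrightarrow> x \<in> ends G e \<Longrightarrow> y \<in> ends G e \<Longrightarrow> P x = P y"
  unfolding edge_constant_def by blast

lemma edge_constant_subset: "edge_constant G A P \<Longrightarrow> B \<subseteq> A \<Longrightarrow> edge_constant G B P"
  by (auto simp: edge_constant_def)

lemma linkedI:
  "(\<And>P x y. edge_constant G A P \<Longrightarrow> x \<in> verts G \<Longrightarrow> y \<in> verts G \<Longrightarrow> P x = P y) \<Longrightarrow> linked G A"
  unfolding linked_def by blast

lemma linkedD:
  "linked G A \<Longrightarrow> edge_constant G A P \<Longrightarrow> x \<in> verts G \<Longrightarrow> y \<in> verts G \<Longrightarrow> P x = P y"
  unfolding linked_def by blast

lemma linked_mono: "linked G A \<Longrightarrow> A \<subseteq> B \<Longrightarrow> linked G B"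
  using edge_constant_subset[of G B _ A] unfolding linked_def by blast

lemma degree_valency: "degree G v = valency G (edges G) v"
  by (simp add: degree_def valency_def)

lemma valency_insert:
  "finite A \<Longrightarrow> e \<notin> A \<Longrightarrow>
     valency G (insert e A) v = (if v \<in> ends G e then 1 else 0) + valency G A v"
proof -
  assume *: "finite A" "e \<notin> A"
  have "{f \<in> insert e A. v \<in> ends G f} =
      (if v \<in> ends G e then insert e {f \<in> A. v \<in> ends G f} else {f \<in> A. v \<in> ends G f})" by auto
  then show ?thesis using * by (simp add: valency_def)
qed

lemma valency_eq_0: "finite A \<Longrightarrow> valency G A v = 0 \<longleftrightarrow> (\<forall>e\<in>A. v \<notin> ends G e)"
  by (auto simp: valency_def)

lemma valency_cong:
  "(\<And>e. e \<in> A \<Longrightarrow> v \<in> ends G e \<longleftrightarrow> v \<in> ends H e) \<Longrightarrow> valency G A v = valency H A v"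
  unfolding valency_def by (rule arg_cong[where f = card]) auto

lemma graph_ends:
  assumes "graph G" "e \<in> edges G"
  obtains x y where "ends G e = {x, y}" "x \<noteq> y" "x \<in> verts G" "y \<in> verts G"
  using assms unfolding graph_def card_2_iff by blast

lemma graph_other_end:
  assumes "graph G" "e \<in> edges G" "x \<in> ends G e"
  obtains y where "ends G e = {x, y}" "x \<noteq> y" "x \<in> verts G" "y \<in> verts G"
proof -
  obtain a b where "ends G e = {a, b}" "a \<noteq> b" "a \<in> verts G" "b \<in> verts G"
    using graph_ends[OF assms(1,2)] .
  then show thesis using that[of a] that[of b] assms(3) by (auto simp: insert_commute)
qed

lemma path_edge_constant:
  assumes "successively (adjacent G) p" "p \<noteq> []" "edge_constant G (edges G) P"
  shows "P (hd p) = P (last p)"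
  using assms(1,2)
proof (induction p rule: induct_list012)
  case (3 x y zs)
  from 3(3) obtain e where "e \<in> edges G" "ends G e = {x, y}" by (auto simp: adjacent_def)
  then have "P x = P y" using edge_constantD[OF assms(3)] by blast
  with 3 show ?case by simp
qed auto

text \<open>
  If \<open>w\<close> is already on the path, the initial segment up to \<open>w\<close> is used, so that no vertex is repeated.
\<close>

lemma path_between_extend:
  assumes "path_between G u p v" "adjacent G v w" "w \<in> verts G"
  shows "\<exists>q. path_between G u q w"
proof (cases "w \<in> set p")
  case True
  then obtain p1 p2 where p: "p = p1 @ w # p2" by (meson split_list)
  then have "path_between G u (p1 @ [w]) w"
    using assms(1) by (auto simp: path_between_def successively_append_iff hd_append split: if_splits)
  then show ?thesis by blast
next
  case False
  then have "path_between G u (p @ [w]) w"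
    using assms by (auto simp: path_between_def successively_append_iff)
  then show ?thesis by blast
qed

lemma connected_graph_linked:
  "connected_graph G \<longleftrightarrow> graph G \<and> verts G \<noteq> {} \<and> linked G (edges G)"
proof (intro iffI conjI)
  assume G: "connected_graph G"
  then show "graph G" "verts G \<noteq> {}" by (auto simp: connected_graph_def)
  show "linked G (edges G)"
  proof (rule linkedI)
    fix P x y assume "edge_constant G (edges G) P" "x \<in> verts G" "y \<in> verts G"
    then show "P x = P y"
      using G path_edge_constant unfolding connected_graph_def path_between_def by metis
  qed
next
  assume G: "graph G \<and> verts G \<noteq> {} \<and> linked G (edges G)"
  have "\<exists>p. path_between G u p v" if uv: "u \<in> verts G" "v \<in> verts G" for u v
  proof -
    let ?P = "\<lambda>v. \<exists>p. path_between G u p v"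
    have "edge_constant G (edges G) ?P"
    proof (rule edge_constantI_ends)
      fix e x y assume e: "e \<in> edges G" "ends G e = {x, y}"
      then have "adjacent G x y" "adjacent G y x" "x \<in> verts G" "y \<in> verts G"
        using G by (auto simp: adjacent_def graph_def insert_commute)
      then show "?P x = ?P y" by (meson path_between_extend)
    qed (use G in auto)
    from linkedD[OF _ this] have "?P u = ?P v" using G uv by blast
    moreover have "path_between G u [u] u" using uv by (simp add: path_between_def)
    ultimately show ?thesis by blast
  qed
  then show "connected_graph G" using G by (auto simp: connected_graph_def)
qed

lemma graph_del_edges: "graph G \<Longrightarrow> graph (del_edges G F)"
  by (auto simp: graph_def del_edges_def)

lemma linked_cong:
  "verts G = verts H \<Longrightarrow> (\<And>e. e \<in> A \<Longrightarrow> ends G e = ends H e) \<Longrightarrow> linked G A = linked H A"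
  by (simp add: linked_def edge_constant_def)

lemma connected_del_edges:
  "graph G \<Longrightarrow> verts G \<noteq> {} \<Longrightarrow> connected_graph (del_edges G F) \<longleftrightarrow> linked G (edges G - F)"
  using linked_cong[of "del_edges G F" G "edges G - F"]
  by (simp add: connected_graph_linked graph_del_edges) (simp add: del_edges_def)

section \<open>Counting edges\<close>

text \<open>
  Sum the valencies over the vertices \<open>v\<close> with \<open>P v\<close>. The sum is even. An edge of \<open>F\<close> other than
  \<open>e\<close> has none or both of its ends there, so \<open>e\<close> cannot have exactly one.
\<close>

lemma parity:
  assumes G: "graph G" and F: "two_regular G F" and e: "e \<in> F" "ends G e = {x, y}"
    and P: "edge_constant G (F - {e}) P"
  shows "P x = P y"
proof (rule ccontr)
  assume neq: "P x \<noteq> P y"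
  let ?S = "{v \<in> verts G. P v}"
  have FE: "F \<subseteq> edges G" using F by (simp add: two_regular_def)
  have fin: "finite F" "finite ?S" using G FE finite_subset by (auto simp: graph_def)
  have sw: "(\<Sum>v\<in>?S. valency G F v) = (\<Sum>f\<in>F. card (ends G f \<inter> ?S))"
  proof -
    have "(\<Sum>v\<in>?S. valency G F v) = (\<Sum>v\<in>?S. \<Sum>f\<in>F. if v \<in> ends G f then 1 else 0)"
      using fin by (simp add: valency_def sum.If_cases Int_def)
    also have "\<dots> = (\<Sum>f\<in>F. \<Sum>v\<in>?S. if v \<in> ends G f then 1 else 0)" by (rule sum.swap)
    also have "\<dots> = (\<Sum>f\<in>F. card (ends G f \<inter> ?S))"
      using fin by (simp add: sum.If_cases Int_def conj_commute)
    finally show ?thesis .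
  qed
  have "even (\<Sum>v\<in>?S. valency G F v)"
    using F by (intro dvd_sum) (auto simp: two_regular_def)
  moreover have "even (card (ends G f \<inter> ?S))" if "f \<in> F - {e}" for f
  proof -
    have "f \<in> edges G" using that FE by blast
    then obtain a b where ab: "ends G f = {a, b}" "a \<noteq> b" "a \<in> verts G" "b \<in> verts G"
      by (rule graph_ends[OF G])
    then have "P a = P b" using P that by (auto simp: edge_constant_def)
    then have "ends G f \<inter> ?S = (if P a then {a, b} else {})" using ab by auto
    then show ?thesis using ab by simp
  qed
  then have "even (\<Sum>f\<in>F - {e}. card (ends G f \<inter> ?S))" by (intro dvd_sum) auto
  moreover have "card (ends G e \<inter> ?S) = 1"
  proof -
    have "ends G e \<subseteq> verts G" using G FE e(1) by (auto simp: graph_def)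
    then have "x \<in> verts G" "y \<in> verts G" using e(2) by auto
    then have "ends G e \<inter> ?S = (if P x then {x} else {y})" using e neq by auto
    then show ?thesis by simp
  qed
  ultimately show False using sw fin e by (simp add: sum.remove[of F e])
qed

lemma two_regular_no_bridge:
  assumes G: "graph G" and F: "two_regular G F" "e \<in> F" "F \<subseteq> A" and A: "linked G A"
  shows "linked G (A - {e})"
proof (rule linkedI)
  fix P a b assume P: "edge_constant G (A - {e}) P" and ab: "a \<in> verts G" "b \<in> verts G"
  obtain x y where xy: "ends G e = {x, y}"
    using graph_ends G F by (metis subsetD two_regular_def)
  have "edge_constant G (F - {e}) P" by (rule edge_constant_subset[OF P]) (use F(3) in auto)
  then have "P x = P y" by (rule parity[OF G F(1,2) xy])
  then have "edge_constant G A P" using P xy unfolding edge_constant_def by fastforce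
  from linkedD[OF A this ab] show "P a = P b" .
qed

text \<open>
  Contraction of \<open>y\<close> into \<open>x\<close>. Edges joining \<open>x\<close> and \<open>y\<close> become loops; the counting lemmas below
  are therefore stated for edges with one or two ends.
\<close>

definition merge :: "'v \<Rightarrow> 'v \<Rightarrow> ('v, 'e) mgraph \<Rightarrow> ('v, 'e) mgraph" where
  "merge x y G = G\<lparr>verts := verts G - {y}, ends := \<lambda>e. (\<lambda>z. if z = y then x else z) ` ends G e\<rparr>"

lemma linked_merge:
  assumes "x \<in> verts G" "x \<noteq> y" "y \<in> verts G" "ends G e = {x, y}" "e \<notin> A"
  shows "linked (merge x y G) A \<longleftrightarrow> linked G (insert e A)"
proof
  assume L: "linked (merge x y G) A"
  show "linked G (insert e A)"
  proof (rule linkedI)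
    fix P a b assume P: "edge_constant G (insert e A) P" and ab: "a \<in> verts G" "b \<in> verts G"
    have xy: "P x = P y" using P assms by (auto simp: edge_constant_def)
    have "edge_constant (merge x y G) A P"
      using P xy by (auto simp: edge_constant_def merge_def)
    then have "P c = P d" if "c \<in> verts G - {y}" "d \<in> verts G - {y}" for c d
      by (rule linkedD[OF L]) (use that in \<open>auto simp: merge_def\<close>)
    from this[of a b] this[of a x] this[of x b] show "P a = P b"
      using xy ab assms(1,2) by (cases "a = y"; cases "b = y") auto
  qed
next
  assume L: "linked G (insert e A)"
  show "linked (merge x y G) A"
  proof (rule linkedI)
    fix P a b assume P: "edge_constant (merge x y G) A P"
      and ab: "a \<in> verts (merge x y G)" "b \<in> verts (merge x y G)"
    define r where "r = (\<lambda>z. if z = y then x else z)"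
    let ?Q = "\<lambda>z. P (r z)"
    have r: "r x = x" "r y = x" "\<And>z. z \<noteq> y \<Longrightarrow> r z = z" using assms(2) by (auto simp: r_def)
    have "edge_constant G (insert e A) ?Q"
      using P assms(4) r unfolding edge_constant_def merge_def r_def[symmetric] by simp
    from linkedD[OF L this, of a b] have "?Q a = ?Q b" using ab by (simp add: merge_def)
    then show "P a = P b" using ab r by (simp add: merge_def)
  qed
qed

lemma linked_loop:
  assumes "linked G A" "ends G e = {x}" shows "linked G (A - {e})"
proof (rule linkedI)
  fix P a b assume P: "edge_constant G (A - {e}) P" and ab: "a \<in> verts G" "b \<in> verts G"
  then have "edge_constant G A P" using assms(2) by (auto simp: edge_constant_def)
  from linkedD[OF assms(1) this ab] show "P a = P b" .
qed

text \<open>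
  Induction on the number of edges: a loop is removed, any other edge is contracted. If no edge can
  be spared then there is no loop, every contraction removes exactly one vertex, and equality
  holds.
\<close>

lemma linked_card:
  assumes "finite A" "finite (verts G)" "linked G A" "verts G \<noteq> {}"
    and "\<And>e. e \<in> A \<Longrightarrow> \<exists>x\<in>verts G. \<exists>y\<in>verts G. ends G e = {x, y}"
  shows "card (verts G) \<le> card A + 1 \<and>
     ((\<forall>e\<in>A. \<not> linked G (A - {e})) \<longrightarrow> card (verts G) = card A + 1)"
  using assms
proof (induction "card A" arbitrary: A G)
  case 0
  then have A: "A = {}" by simp
  have "x = y" if "x \<in> verts G" "y \<in> verts G" for x y
    using linkedD[OF 0(4), of "\<lambda>z. z = x" x y] that A by (simp add: edge_constant_def)
  then have "card (verts G) = 1" using 0 by (metis card_1_singleton_iff ex_in_conv is_singletonI' is_singleton_def One_nat_def)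
  then show ?case using A by simp
next
  case (Suc n)
  then obtain e where e: "e \<in> A" by fastforce
  define B where "B = A - {e}"
  have AB: "A = insert e B" "e \<notin> B" "card A = card B + 1" "n = card B" "finite B"
    using e Suc by (auto simp: B_def)
  obtain x y where xy: "x \<in> verts G" "y \<in> verts G" "ends G e = {x, y}" using Suc e by metis
  show ?case
  proof (cases "x = y")
    case True
    then have L: "linked G B" using linked_loop Suc xy unfolding B_def by fastforce
    have "\<exists>x\<in>verts G. \<exists>y\<in>verts G. ends G f = {x, y}" if "f \<in> B" for f
      using Suc(7) that AB(1) by blast
    note IH = Suc(1)[OF AB(4,5) Suc(4) L Suc(6) this]
    then have "card (verts G) \<le> card B + 1" by blast
    moreover have "\<exists>f\<in>A. linked G (A - {f})" using L e unfolding B_def by blast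
    ultimately show ?thesis using AB(3) by simp
  next
    case False
    let ?H = "merge x y G"
    have eq: "linked ?H C \<longleftrightarrow> linked G (insert e C)" if "e \<notin> C" for C
      using linked_merge xy False that by metis
    have "linked ?H B" using eq[OF AB(2)] Suc(5) AB(1) by simp
    moreover have "verts ?H \<noteq> {}" "finite (verts ?H)" "card (verts G) = card (verts ?H) + 1"
      using Suc(4) xy False card.remove[OF Suc(4) xy(2)] by (auto simp: merge_def)
    ultimately have H: "linked ?H B" "verts ?H \<noteq> {}" "finite (verts ?H)"
      "card (verts G) = card (verts ?H) + 1" by blast+
    have ends: "\<exists>a\<in>verts ?H. \<exists>b\<in>verts ?H. ends ?H f = {a, b}" if "f \<in> B" for f
    proof -
      have "f \<in> A" using that AB(1) by blast
      then obtain a b where ab: "a \<in> verts G" "b \<in> verts G" "ends G f = {a, b}"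
        using Suc(7) by meson
      show ?thesis
        by (rule bexI[of _ "if a = y then x else a"], rule bexI[of _ "if b = y then x else b"])
          (use ab xy(1) False in \<open>simp_all add: merge_def\<close>)
    qed
    note IH = Suc(1)[of B ?H, OF AB(4,5) H(3,1,2) ends]
    show ?thesis
    proof (intro conjI impI)
      show "card (verts G) \<le> card A + 1" using IH H AB by simp
      assume br: "\<forall>f\<in>A. \<not> linked G (A - {f})"
      have "\<not> linked ?H (B - {f})" if "f \<in> B" for f
      proof -
        have "insert e (B - {f}) = A - {f}" using AB that by auto
        moreover have "\<not> linked G (A - {f})" using br that AB(1) by blast
        ultimately show ?thesis using eq[of "B - {f}"] AB(2) by simp
      qed
      then show "card (verts G) = card A + 1" using IH H AB by simp
    qed
  qed
qed

lemma graph_linked_card: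
  assumes "graph G" "verts G \<noteq> {}" "A \<subseteq> edges G" "linked G A"
  shows "card (verts G) \<le> card A + 1"
    and "(\<forall>e\<in>A. \<not> linked G (A - {e})) \<Longrightarrow> card (verts G) = card A + 1"
proof -
  have "\<exists>x\<in>verts G. \<exists>y\<in>verts G. ends G e = {x, y}" if "e \<in> A" for e
    using graph_ends assms(1,3) that by (metis subsetD)
  moreover have "finite A" "finite (verts G)"
    using assms finite_subset by (auto simp: graph_def)
  ultimately show "card (verts G) \<le> card A + 1"
    "(\<forall>e\<in>A. \<not> linked G (A - {e})) \<Longrightarrow> card (verts G) = card A + 1"
    using linked_card[of A G] assms by blast+
qed

section \<open>Two-regular edge sets and cycles\<close>

text \<open>
  The edges of a path, of which only the valencies matter. A path with one vertex has no edges, which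
  is why it is excluded when the ends receive valency 1.
\<close>

lemma path_edge_set:
  assumes "graph G" "successively (adjacent G) p" "distinct p" "p \<noteq> []"
  shows "\<exists>A\<subseteq>edges G. \<forall>v. valency G A v =
    (if v \<notin> set p \<or> length p = 1 then 0 else if v = hd p \<or> v = last p then 1 else 2)"
  using assms(2-)
proof (induction p rule: induct_list012)
  case (2 x)
  then show ?case by (intro exI[of _ "{}"]) (auto simp: valency_def)
next
  case (3 x y zs)
  then obtain A where A: "A \<subseteq> edges G" "\<And>v. valency G A v =
    (if v \<notin> set (y # zs) \<or> length (y # zs) = 1 then 0 else if v = y \<or> v = last (y # zs) then 1 else 2)"
    by auto
  from 3 obtain e where e: "e \<in> edges G" "ends G e = {x, y}" by (auto simp: adjacent_def)
  have fin: "finite A" using A assms(1) finite_subset by (auto simp: graph_def)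
  have "valency G A x = 0" using A(2) 3 by auto
  then have "e \<notin> A" using e fin by (auto simp: valency_eq_0)
  then have "valency G (insert e A) v = (if v \<in> {x,y} then 1 else 0) + valency G A v" for v
    using fin e by (simp add: valency_insert)
  moreover have "zs \<noteq> [] \<Longrightarrow> last zs \<noteq> y" using 3(4) by (metis distinct.simps(2) last_in_set)
  ultimately show ?case using A(1,2) e 3(4)
    by (intro exI[of _ "insert e A"]) (auto simp: insert_commute)
qed auto

text \<open>
  A path that joins the ends of \<open>e\<close> and avoids \<open>e\<close> is closed by \<open>e\<close>.
\<close>

lemma no_bridge_two_regular:
  assumes G: "graph G" and e: "e \<in> edges G" and L: "linked G (edges G - {e})"
  shows "\<exists>F. two_regular G F \<and> F \<noteq> {}"
proof -
  obtain x y where xy: "ends G e = {x, y}" "x \<noteq> y" "x \<in> verts G" "y \<in> verts G"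
    using graph_ends G e by metis
  let ?H = "del_edges G {e}"
  have H: "graph ?H" using G by (rule graph_del_edges)
  have "connected_graph ?H" using connected_del_edges G xy L by blast
  then obtain p where p: "path_between ?H x p y"
    using xy unfolding connected_graph_def by (metis del_edges_def mgraph.select_convs(1))
  then obtain A where A: "A \<subseteq> edges ?H" "\<And>v. valency ?H A v =
    (if v \<notin> set p \<or> length p = 1 then 0 else if v = x \<or> v = y then 1 else 2)"
    using path_edge_set[OF H, of p] by (auto simp: path_between_def)
  have len: "x \<in> set p" "y \<in> set p" "length p \<noteq> 1"
    using p xy by (auto simp: path_between_def length_Suc_conv)
  have v: "valency ?H B w = valency G B w" for B w by (simp add: valency_def del_edges_def)
  have "finite A" "e \<notin> A" "A \<subseteq> edges G"
    using A(1) G finite_subset by (auto simp: del_edges_def graph_def)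
  then have "two_regular G (insert e A)"
    using A(2) e xy len by (auto simp: two_regular_def valency_insert v)
  then show ?thesis by blast
qed

text \<open>
  If \<open>F\<close> is not connected, witnessed by a nonconstant colouring \<open>P\<close>, then the edges in one colour
  class form a smaller nonempty two-regular set.
\<close>

lemma two_regular_contains_cycle:
  assumes G: "graph G" and F: "two_regular G F" "F \<noteq> {}"
  shows "\<exists>C. cycle_in C G \<and> edges C \<subseteq> F"
  using F
proof (induction "card F" arbitrary: F rule: less_induct)
  case less
  note F = less(2,3)
  have FE: "F \<subseteq> edges G" "finite F" using F G finite_subset by (auto simp: two_regular_def graph_def)
  let ?C = "\<lparr>verts = \<Union> (ends G ` F), edges = F, ends = ends G\<rparr>"
  have C: "graph ?C" "verts ?C \<noteq> {}" "verts ?C \<subseteq> verts G"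
  proof -
    have ends: "ends G f \<subseteq> verts G" "card (ends G f) = 2" if "f \<in> F" for f
      using FE(1) G that by (auto simp: graph_def)
    show V: "verts ?C \<subseteq> verts G" using ends(1) by auto
    have "finite (verts G)" using G by (simp add: graph_def)
    then have "finite (verts ?C)" using V finite_subset by blast
    then show "graph ?C" using FE(2) ends(2) by (auto simp: graph_def)
    obtain f where f: "f \<in> F" using F(2) by blast
    then have "ends G f \<noteq> {}" using ends(2)[OF f] by auto
    then show "verts ?C \<noteq> {}" using f by auto
  qed
  have C2: "degree ?C v = 2" if "v \<in> verts ?C" for v
  proof -
    have "valency G F v \<noteq> 0" using that FE by (auto simp: valency_eq_0)
    moreover have "v \<in> verts G" using that C(3) by blast
    ultimately have "valency G F v = 2" using F(1) by (auto simp: two_regular_def)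
    then show ?thesis by (simp add: degree_def valency_def)
  qed
  show ?case
  proof (cases "linked ?C F")
    case True
    then have "cycle_in ?C G"
      using C C2 FE by (auto simp: cycle_in_def cycle_def subgraph_def connected_graph_linked)
    then show ?thesis by (metis mgraph.select_convs(2) order_refl)
  next
    case False
    then obtain P x y where P: "edge_constant G F P" and xy: "x \<in> verts ?C" "y \<in> verts ?C" "P x" "\<not> P y"
      unfolding linked_def edge_constant_def by auto
    let ?F = "{f \<in> F. \<forall>v\<in>ends G f. P v}"
    obtain f where f: "f \<in> F" "y \<in> ends G f" using xy by auto
    then have sub: "?F \<subset> F" using xy by blast
    obtain h where h: "h \<in> F" "x \<in> ends G h" using xy by auto
    then have ne: "?F \<noteq> {}" using xy P by (auto simp: edge_constant_def)
    have val: "valency G ?F v = (if P v then valency G F v else 0)" for v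
    proof -
      have "{f \<in> ?F. v \<in> ends G f} = (if P v then {f \<in> F. v \<in> ends G f} else {})"
        using P unfolding edge_constant_def by auto
      then show ?thesis by (simp add: valency_def)
    qed
    have "two_regular G ?F" using F(1) sub unfolding two_regular_def val by auto
    from less(1)[OF psubset_card_mono[OF FE(2) sub] this ne]
    obtain C where "cycle_in C G" "edges C \<subseteq> ?F" by blast
    then show ?thesis by auto
  qed
qed

lemma cycle_two_regular:
  assumes G: "graph G" and C: "cycle_in C G"
  shows "two_regular G (edges C)" "edges C \<noteq> {}"
proof -
  have sub: "graph C" "verts C \<subseteq> verts G" "edges C \<subseteq> edges G" "\<And>e. e \<in> edges C \<Longrightarrow> ends G e = ends C e"
    "verts C \<noteq> {}"
    and two: "\<And>v. v \<in> verts C \<Longrightarrow> degree C v = 2"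
    using C by (auto simp: cycle_in_def cycle_def subgraph_def connected_graph_def)
  have eq: "valency G (edges C) v = degree C v" for v
    using sub(4) unfolding degree_valency by (intro valency_cong) auto
  have "degree C v = 0" if "v \<notin> verts C" for v
    using that sub(1) by (auto simp: degree_def graph_def)
  then show "two_regular G (edges C)" using two sub(3) eq by (auto simp: two_regular_def)
  show "edges C \<noteq> {}" using sub(5) two by (fastforce simp: degree_def)
qed

lemma tree_iff_card:
  assumes "connected_graph T"
  shows "tree T \<longleftrightarrow> card (verts T) = card (edges T) + 1"
proof
  have T: "graph T" "verts T \<noteq> {}" "linked T (edges T)"
    using assms by (auto simp: connected_graph_linked)
  {
    assume "tree T"
    then have "\<not> linked T (edges T - {e})" if "e \<in> edges T" for e
      using no_bridge_two_regular[OF T(1) that] two_regular_contains_cycle[OF T(1)]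
      by (auto simp: tree_def)
    then show "card (verts T) = card (edges T) + 1"
      using graph_linked_card(2)[OF T(1,2) order_refl T(3)] by blast
  next
    assume c: "card (verts T) = card (edges T) + 1"
    have "False" if C: "cycle_in C T" for C
    proof -
      note F = cycle_two_regular[OF T(1) C]
      obtain e where e: "e \<in> edges C" using F by blast
      have sub: "edges C \<subseteq> edges T" using F by (simp add: two_regular_def)
      have "linked T (edges T - {e})" using two_regular_no_bridge[OF T(1) F(1) e sub T(3)] .
      then have "card (verts T) \<le> card (edges T - {e}) + 1"
        using graph_linked_card(1)[OF T(1,2), of "edges T - {e}"] by blast
      moreover have "card (edges T) > 0" "card (edges T - {e}) = card (edges T) - 1"
        using e sub T(1) by (auto simp: graph_def card_gt_0_iff)
      ultimately show False using c by simp
    qed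
    then show "tree T" using assms by (auto simp: tree_def)
  }
qed

lemma splits_iff_decomposable:
  assumes G: "graph G" "verts G \<noteq> {}"
  shows "splits G \<longleftrightarrow> tree_matching_decomposable G"
proof
  have finE: "finite (edges G)" using G by (simp add: graph_def)
  {
    assume "splits G"
    then obtain M where M: "matching G M" "linked G (edges G - M)"
      "card (edges G) + 1 = card (verts G) + card M" by (auto simp: splits_def)
    let ?T = "del_edges G M"
    have ME: "M \<subseteq> edges G" using M by (simp add: matching_def)
    have conn: "connected_graph ?T" using connected_del_edges G M by blast
    have "card (edges ?T) = card (edges G) - card M" "card M \<le> card (edges G)"
      using ME finE finite_subset[OF ME finE] card_Diff_subset[of M "edges G"] card_mono[OF finE ME]
      by (simp_all add: del_edges_def)
    then have "tree ?T" using tree_iff_card[OF conn] M(3) by (simp add: del_edges_def)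
    then have "spanning_tree ?T G"
      using graph_del_edges[OF G(1)] by (auto simp: spanning_tree_def subgraph_def del_edges_def)
    moreover have "edges ?T \<union> M = edges G" "edges ?T \<inter> M = {}" using ME by (auto simp: del_edges_def)
    ultimately show "tree_matching_decomposable G"
      using M(1) unfolding tree_matching_decomposable_def by blast
  next
    assume "tree_matching_decomposable G"
    then obtain T M where T: "tree T" "subgraph T G" "verts T = verts G" and M: "matching G M"
      "edges T \<union> M = edges G" "edges T \<inter> M = {}"
      by (auto simp: tree_matching_decomposable_def spanning_tree_def)
    have eq: "edges G - M = edges T" using M by auto
    have "linked T (edges T)" using T by (auto simp: tree_def connected_graph_linked)
    then have "linked G (edges T)"
      using linked_cong[of T G "edges T"] T by (auto simp: subgraph_def)
    moreover have "card (verts G) = card (edges T) + 1"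
      using tree_iff_card[of T] T by (auto simp: tree_def)
    moreover have "card (edges G) = card (edges T) + card M"
      using M finE by (metis card_Un_disjoint finite_Un)
    ultimately show "splits G" using M(1) eq unfolding splits_def by auto
  }
qed

text \<open>
  A nonseparating two-regular set contains a cycle, and this cycle is nonseparating because
  removing it removes fewer edges.
\<close>

lemma S23_iff_admissible: "G \<in> S23 \<longleftrightarrow> admissible G"
proof -
  have bounds: "(min_degree G \<ge> 2 \<and> max_degree G \<le> 3) \<longleftrightarrow>
      (\<forall>v\<in>verts G. degree G v = 2 \<or> degree G v = 3)" if "finite (verts G)" "verts G \<noteq> {}"
  proof -
    have "(min_degree G \<ge> 2 \<and> max_degree G \<le> 3) \<longleftrightarrow> (\<forall>v\<in>verts G. 2 \<le> degree G v \<and> degree G v \<le> 3)"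
      using that by (auto simp: min_degree_def max_degree_def)
    then show ?thesis by (auto simp: le_Suc_eq numeral_eq_Suc)
  qed
  have cyc: "(\<forall>C. cycle_in C G \<longrightarrow> separating G C) \<longleftrightarrow>
      (\<forall>F. two_regular G F \<longrightarrow> F \<noteq> {} \<longrightarrow> \<not> linked G (edges G - F))"
    if G: "graph G" "verts G \<noteq> {}"
  proof (intro iffI allI impI notI)
    fix F assume "\<forall>C. cycle_in C G \<longrightarrow> separating G C" and F: "two_regular G F" "F \<noteq> {}"
      and L: "linked G (edges G - F)"
    moreover obtain C where C: "cycle_in C G" "edges C \<subseteq> F"
      using two_regular_contains_cycle G F by blast
    moreover have "linked G (edges G - edges C)" using L C linked_mono by (metis Diff_mono order_refl)
    ultimately show False using connected_del_edges[OF G] by (auto simp: separating_def)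
  next
    fix C assume "\<forall>F. two_regular G F \<longrightarrow> F \<noteq> {} \<longrightarrow> \<not> linked G (edges G - F)" "cycle_in C G"
    then show "separating G C"
      using cycle_two_regular[OF G(1)] connected_del_edges[OF G] by (auto simp: separating_def)
  qed
  show ?thesis
    unfolding S23_def admissible_def connected_graph_linked using bounds cyc by (auto simp: graph_def)
qed

section \<open>Independence of the type of vertices and edges\<close>

text \<open>
  The graphs that compete with a minimum counterexample have natural numbers as vertices and edges.
  A graph of any type is brought into this form by renaming.
\<close>

lemma admissible_copy:
  fixes H :: "('v, 'e) mgraph"
  assumes H: "admissible H" and f: "inj_on f (verts H)" and g: "inj_on g (edges H)"
  defines "K \<equiv> \<lparr>verts = f ` verts H, edges = g ` edges H,
     ends = \<lambda>n. f ` ends H (inv_into (edges H) g n)\<rparr>"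
  shows "admissible K" "phi K = phi H" "splits K \<Longrightarrow> splits H"
proof -
  have gr: "graph H" using H by (simp add: admissible_def)
  have ends: "ends K (g e) = f ` ends H e" if "e \<in> edges H" for e
    using that g by (simp add: K_def)
  have endsV: "ends H e \<subseteq> verts H" if "e \<in> edges H" for e using gr that by (simp add: graph_def)
  have mem: "f v \<in> f ` ends H e \<longleftrightarrow> v \<in> ends H e" if "v \<in> verts H" "e \<in> edges H" for v e
    using f endsV that by (meson inj_on_image_mem_iff)
  have val: "valency K (g ` A) (f v) = valency H A v" if "A \<subseteq> edges H" "v \<in> verts H" for A v
  proof -
    have "{e \<in> g ` A. f v \<in> ends K e} = g ` {e \<in> A. v \<in> ends H e}"
      using that ends mem by auto
    then show ?thesis using that g unfolding valency_def
      by (metis (no_types, lifting) card_image inj_on_subset mem_Collect_eq subsetD subsetI)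
  qed
  have link: "linked K (g ` A) \<longleftrightarrow> linked H A" if A: "A \<subseteq> edges H" for A
  proof
    assume L: "linked K (g ` A)"
    show "linked H A"
    proof (rule linkedI)
      fix P x y assume P: "edge_constant H A P" and xy: "x \<in> verts H" "y \<in> verts H"
      let ?Q = "\<lambda>n. P (inv_into (verts H) f n)"
      have "edge_constant K (g ` A) ?Q"
      proof (rule edge_constantI)
        fix n a b assume n: "n \<in> g ` A" "a \<in> ends K n" "b \<in> ends K n"
        then obtain e where e: "e \<in> A" "n = g e" by auto
        then have "e \<in> edges H" using A by auto
        then obtain a' b' where "a = f a'" "b = f b'" "a' \<in> ends H e" "b' \<in> ends H e"
          using n ends e by auto
        moreover then have "a' \<in> verts H" "b' \<in> verts H" using endsV \<open>e \<in> edges H\<close> by auto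
        ultimately show "?Q a = ?Q b" using f e edge_constantD[OF P, of e a' b'] by simp
      qed
      from linkedD[OF L this, of "f x" "f y"] have "?Q (f x) = ?Q (f y)" using xy by (simp add: K_def)
      then show "P x = P y" using f xy by simp
    qed
  next
    assume L: "linked H A"
    show "linked K (g ` A)"
    proof (rule linkedI)
      fix P x y assume P: "edge_constant K (g ` A) P" and xy: "x \<in> verts K" "y \<in> verts K"
      have "edge_constant H A (P \<circ> f)"
        using P A ends unfolding edge_constant_def by fastforce
      from linkedD[OF L this] xy show "P x = P y" by (auto simp: K_def)
    qed
  qed
  have sub: "\<exists>A\<subseteq>edges H. B = g ` A" if "B \<subseteq> edges K" for B
    using that by (simp add: K_def subset_image_iff)
  have diff: "edges K - g ` A = g ` (edges H - A)" if "A \<subseteq> edges H" for A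
    using g that by (auto simp: K_def inj_on_def)
  have cards: "card (verts K) = card (verts H)" "card (edges K) = card (edges H)"
    "\<And>A. A \<subseteq> edges H \<Longrightarrow> card (g ` A) = card A"
    using f g by (auto simp: K_def card_image inj_on_subset)
  show "phi K = phi H" using cards by (simp add: phi_def)
  have "graph K"
  proof -
    have "card (f ` ends H e) = 2" if "e \<in> edges H" for e
      using gr that f by (metis card_image endsV graph_def inj_on_subset)
    moreover have "verts K = f ` verts H" "edges K = g ` edges H" by (simp_all add: K_def)
    ultimately show ?thesis using gr ends endsV unfolding graph_def by (auto; blast)
  qed
  moreover have "linked K (edges K)" using link[of "edges H"] H by (simp add: K_def admissible_def)
  moreover have "degree K w = 2 \<or> degree K w = 3" if w: "w \<in> verts K" for w
  proof -
    obtain v where v: "v \<in> verts H" "w = f v" using w by (auto simp: K_def)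
    then have "degree K w = degree H v" using val[of "edges H" v] by (simp add: degree_valency K_def)
    then show ?thesis using H v by (auto simp: admissible_def)
  qed
  moreover have "\<not> linked K (edges K - B)" if B: "two_regular K B" "B \<noteq> {}" for B
  proof -
    obtain A where A: "A \<subseteq> edges H" "B = g ` A" using sub B by (metis two_regular_def)
    then have "valency H A v = 0 \<or> valency H A v = 2" if "v \<in> verts H" for v
      using B val[OF A(1) that] that unfolding two_regular_def by (auto simp: K_def)
    then have "two_regular H A" "A \<noteq> {}" using A B by (auto simp: two_regular_def)
    then have "\<not> linked H (edges H - A)" using H by (simp add: admissible_def)
    then show ?thesis using link[of "edges H - A"] diff A by auto
  qed
  ultimately show "admissible K" using H by (auto simp: admissible_def K_def)
  assume "splits K"
  then obtain N where N: "matching K N" "linked K (edges K - N)"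
    "card (edges K) + 1 = card (verts K) + card N" by (auto simp: splits_def)
  obtain M where M: "M \<subseteq> edges H" "N = g ` M" using sub N by (metis matching_def)
  have "ends H e \<inter> ends H e' = {}" if "e \<in> M" "e' \<in> M" "e \<noteq> e'" for e e'
  proof -
    have "g e \<noteq> g e'" using that M g by (meson inj_onD subsetD)
    then have "f ` ends H e \<inter> f ` ends H e' = {}" using N(1) that M ends unfolding matching_def
      by (metis imageI subsetD)
    then show ?thesis by auto
  qed
  then have "matching H M" using M by (auto simp: matching_def)
  moreover have "linked H (edges H - M)" using N link[of "edges H - M"] diff M by auto
  moreover have "card (edges H) + 1 = card (verts H) + card M" using N cards M by simp
  ultimately show "splits H" by (auto simp: splits_def)
qed

text \<open>
  Here the competitors have the same types as \<open>G\<close>, so that smaller graphs can be built from the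
  vertices and edges of \<open>G\<close>.
\<close>

locale smallest_counterexample =
  fixes G :: "('v, 'e) mgraph"
  assumes admissible: "admissible G"
    and not_splits: "\<not> splits G"
    and smaller: "\<And>H :: ('v, 'e) mgraph. admissible H \<Longrightarrow> phi H < phi G \<Longrightarrow> splits H"

lemma minimum_counterexampleD:
  assumes "minimum_counterexample G" shows "smallest_counterexample G"
proof
  have "admissible G" using assms by (auto simp: minimum_counterexample_def counterexample_def S23_iff_admissible)
  then show "admissible G" .
  then show "\<not> splits G" using assms splits_iff_decomposable[of G]
    by (auto simp: minimum_counterexample_def counterexample_def admissible_def)
  fix H :: "('v, 'e) mgraph" assume H: "admissible H" "phi H < phi G"
  then have "finite (verts H)" "finite (edges H)" by (auto simp: admissible_def graph_def)
  then obtain f :: "'v \<Rightarrow> nat" and g :: "'e \<Rightarrow> nat" where fg: "inj_on f (verts H)" "inj_on g (edges H)"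
    by (meson finite_imp_inj_to_nat_seg)
  note K = admissible_copy[OF H(1) fg]
  show "splits H"
  proof (rule K(3), rule ccontr)
    let ?K = "\<lparr>verts = f ` verts H, edges = g ` edges H,
       ends = \<lambda>n. f ` ends H (inv_into (edges H) g n)\<rparr>"
    assume "\<not> splits ?K"
    then have "counterexample ?K"
      using K(1) splits_iff_decomposable[of ?K] by (auto simp: counterexample_def S23_iff_admissible admissible_def)
    then have "phi G \<le> phi ?K" using assms unfolding minimum_counterexample_def by blast
    then show False using K(2) H by simp
  qed
qed

section \<open>Local changes of a graph\<close>

lemma matching_common_end:
  "matching G M \<Longrightarrow> e \<in> M \<Longrightarrow> f \<in> M \<Longrightarrow> x \<in> ends G e \<Longrightarrow> x \<in> ends G f \<Longrightarrow> e = f"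
  unfolding matching_def by blast

lemma card_removed:
  assumes "finite A" "B \<subseteq> A" "A - B = D" shows "card A = card B + card D"
  using card_Un_disjoint[of B "A - B"] assms finite_subset[OF assms(2,1)]
  by (auto simp: Un_absorb1)

text \<open>
  If a vertex on \<open>F\<close> had degree 2, then \<open>F\<close> would contain both of its edges, and removing \<open>F\<close> would isolate it.
\<close>

lemma two_regular_linked_degree_3:
  assumes G: "graph G" and F: "two_regular G F" and L: "linked G (edges G - F)"
    and e: "e \<in> F" "v \<in> ends G e" and w: "w \<in> verts G" "w \<noteq> v"
  shows "degree G v \<noteq> 2"
proof
  assume d: "degree G v = 2"
  have FE: "F \<subseteq> edges G" using F by (simp add: two_regular_def)
  have fin: "finite (edges G)" using G by (simp add: graph_def)
  have v: "v \<in> verts G" using G FE e by (auto simp: graph_def)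
  have "valency G F v \<noteq> 0" using e finite_subset[OF FE fin] by (auto simp: valency_eq_0)
  then have "card {f \<in> F. v \<in> ends G f} = 2" using F v by (auto simp: two_regular_def valency_def)
  then have "{f \<in> F. v \<in> ends G f} = {f \<in> edges G. v \<in> ends G f}"
    using FE fin d by (intro card_subset_eq) (auto simp: degree_def)
  then have "edge_constant G (edges G - F) (\<lambda>z. z = v)" by (auto simp: edge_constant_def)
  from linkedD[OF L this v w(1)] show False using w by simp
qed

lemma edge_constant_insert:
  "ends G e = {x, y} \<Longrightarrow> edge_constant G (insert e A) P \<longleftrightarrow> P x = P y \<and> edge_constant G A P"
  by (auto simp: edge_constant_def)

lemma edge_constant_empty: "edge_constant G {} P"
  by (simp add: edge_constant_def)

lemma edge_constant_Un: "edge_constant G (A \<union> B) P \<longleftrightarrow> edge_constant G A P \<and> edge_constant G B P"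
  by (auto simp: edge_constant_def)

lemma edge_constant_ends:
  "edge_constant G A P \<Longrightarrow> e \<in> A \<Longrightarrow> ends G e = {x, y} \<Longrightarrow> P x = P y"
  by (rule edge_constantD[of G A P e]) auto

lemma valency_empty: "valency G {} v = 0"
  by (simp add: valency_def)

lemma valency_Un_disjoint:
  "finite A \<Longrightarrow> finite B \<Longrightarrow> A \<inter> B = {} \<Longrightarrow> valency G (A \<union> B) v = valency G A v + valency G B v"
  unfolding valency_def by (subst card_Un_disjoint[symmetric]) (auto intro: arg_cong[where f = card])

lemma two_regular_4_cycle:
  assumes "ab \<in> edges G" "ends G ab = {a, b}" and "bc \<in> edges G" "ends G bc = {b, c}"
    and "cd \<in> edges G" "ends G cd = {c, d}" and "da \<in> edges G" "ends G da = {d, a}"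
    and neq: "a \<noteq> c" "b \<noteq> d" "a \<noteq> b" "b \<noteq> c" "c \<noteq> d" "d \<noteq> a"
  shows "two_regular G {ab, bc, cd, da}"
proof -
  have "distinct [ab, bc, cd, da]" using assms by (auto simp: doubleton_eq_iff)
  then have "valency G {ab, bc, cd, da} t = (if t = a \<or> t = b then 1 else 0) +
      ((if t = b \<or> t = c then 1 else 0) + ((if t = c \<or> t = d then 1 else 0) +
      (if t = d \<or> t = a then 1 else 0)))" for t
    by (simp add: valency_insert valency_empty assms(2,4,6,8) split del: if_split)
  then have "valency G {ab, bc, cd, da} t = 0 \<or> valency G {ab, bc, cd, da} t = 2" for t
    using neq by simp
  then show ?thesis using assms(1,3,5,7) by (simp add: two_regular_def)
qed

text \<open>
  In a matching \<open>M\<close> of \<open>H\<close>, the edges in \<open>Y\<close> are replaced by the edges in \<open>N\<close>. An end \<open>v\<close> of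
  an edge in \<open>N\<close> may be incident with common edges only if \<open>M\<close> covers \<open>v\<close> by an edge in \<open>Y\<close>;
  then no common edge of \<open>M\<close> is incident with \<open>v\<close>, as \<open>M\<close> is a matching. The last condition
  preserves the equation between the numbers of vertices, edges and matching edges.
\<close>

definition lifts_to :: "('v, 'e) mgraph \<Rightarrow> ('v, 'e) mgraph \<Rightarrow> 'e set \<Rightarrow> 'e set \<Rightarrow> 'e set \<Rightarrow> 'e set \<Rightarrow> 'e set \<Rightarrow> bool" where
  "lifts_to G H E0 X Y M N \<longleftrightarrow> N \<subseteq> X \<and>
     (\<forall>e\<in>N. \<forall>f\<in>N. e \<noteq> f \<longrightarrow> ends G e \<inter> ends G f = {}) \<and>
     (\<forall>e\<in>N. \<forall>v\<in>ends G e. v \<notin> \<Union> (ends G ` E0) \<or> v \<in> \<Union> (ends H ` (M \<inter> Y))) \<and>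
     linked G ((E0 - M) \<union> (X - N)) \<and>
     card X + card (verts H) + card (M \<inter> Y) = card Y + card (verts G) + card N"

text \<open>
  The graph \<open>H\<close> arises from \<open>G\<close> by deleting vertices and replacing the edges in \<open>X\<close> by those in
  \<open>Y\<close>. An edge in \<open>Y\<close> may also be in \<open>X\<close>, with other ends: this is how new edges get a name
  without a change of the type.
\<close>

locale local_change =
  fixes G H :: "('v, 'e) mgraph" and E0 X Y :: "'e set"
  assumes graph_G: "graph G"
    and edges_G: "edges G = E0 \<union> X" "E0 \<inter> X = {}"
    and edges_H: "edges H = E0 \<union> Y" "E0 \<inter> Y = {}" "finite Y"
    and verts_H: "verts H \<subseteq> verts G"
    and ends_common: "e \<in> E0 \<Longrightarrow> ends H e = ends G e"
    and common_ends: "e \<in> E0 \<Longrightarrow> ends G e \<subseteq> verts H"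
    and new_ends: "e \<in> Y \<Longrightarrow> ends H e \<subseteq> verts H \<and> card (ends H e) = 2"
begin

lemma finite_E0: "finite E0" and finite_X: "finite X"
  using graph_G edges_G by (auto simp: graph_def)

lemma graph_H: "graph H"
proof -
  have "ends H e \<subseteq> verts H \<and> card (ends H e) = 2" if "e \<in> E0" for e
    using that graph_G edges_G ends_common common_ends by (simp add: graph_def)
  moreover have "finite (verts H)" using graph_G finite_subset[OF verts_H] by (simp add: graph_def)
  ultimately show ?thesis using new_ends edges_H finite_E0 unfolding graph_def by auto
qed

lemma edge_constant_core:
  assumes "A \<subseteq> E0" "\<And>v. v \<in> \<Union> (ends G ` E0) \<Longrightarrow> Q v = P v"
  shows "edge_constant G A P \<longleftrightarrow> edge_constant H A Q"
proof -
  have "ends H e = ends G e \<and> (\<forall>v\<in>ends G e. Q v = P v)" if "e \<in> A" for e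
    using that assms ends_common by blast
  then show ?thesis by (auto simp: edge_constant_def)
qed

text \<open>
  A colouring \<open>P\<close> of \<open>G\<close> is transferred to \<open>H\<close>. The transferred colouring \<open>Q\<close> may change the
  colours of vertices that are not incident with common edges. This is necessary if such a vertex
  is attached differently in the two graphs.
\<close>

lemma linked_G_recolour:
  assumes L: "linked H (A \<union> B)" and A: "A \<subseteq> E0"
    and ext: "\<And>P. edge_constant G C P \<Longrightarrow> \<exists>Q. (\<forall>v\<in>\<Union> (ends G ` E0). Q v = P v) \<and> edge_constant H B Q \<and>
      (\<forall>c. (\<forall>x\<in>verts H. Q x = c) \<longrightarrow> (\<forall>x\<in>verts G. P x = c))"
  shows "linked G (A \<union> C)"
proof (rule linkedI)
  fix P x y assume P: "edge_constant G (A \<union> C) P" and xy: "x \<in> verts G" "y \<in> verts G"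
  then have PC: "edge_constant G C P" "edge_constant G A P" by (simp_all add: edge_constant_Un)
  obtain Q where Q: "\<forall>v\<in>\<Union> (ends G ` E0). Q v = P v" "edge_constant H B Q"
      "\<forall>c. (\<forall>x\<in>verts H. Q x = c) \<longrightarrow> (\<forall>x\<in>verts G. P x = c)"
    using ext[OF PC(1)] by (elim exE conjE)
  have "edge_constant H (A \<union> B) Q"
    using PC(2) Q(2) edge_constant_core[OF A, of Q P] Q(1)[rule_format] edge_constant_Un by blast
  then have "(\<forall>x\<in>verts H. Q x = True) \<or> (\<forall>x\<in>verts H. Q x = False)"
    using L by (simp add: linked_def)
  then have "(\<forall>x\<in>verts G. P x = True) \<or> (\<forall>x\<in>verts G. P x = False)" using Q(3) by blast
  then show "P x = P y" using xy by auto
qed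

lemma linked_G:
  assumes L: "linked H (A \<union> B)" and A: "A \<subseteq> E0"
    and ext: "\<And>P. edge_constant G C P \<Longrightarrow>
      edge_constant H B P \<and> (\<forall>x\<in>verts G - verts H. \<exists>y\<in>verts H. P x = P y)"
  shows "linked G (A \<union> C)"
proof (rule linked_G_recolour[OF L A])
  fix P assume P: "edge_constant G C P"
  have rep: "\<exists>y\<in>verts H. P x = P y" if "x \<in> verts G" for x
    using ext[OF P] that by (cases "x \<in> verts H") auto
  have *: "\<forall>c. (\<forall>x\<in>verts H. P x = c) \<longrightarrow> (\<forall>x\<in>verts G. P x = c)"
    using rep by metis
  show "\<exists>Q. (\<forall>v\<in>\<Union> (ends G ` E0). Q v = P v) \<and> edge_constant H B Q \<and>
      (\<forall>c. (\<forall>x\<in>verts H. Q x = c) \<longrightarrow> (\<forall>x\<in>verts G. P x = c))"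
    by (rule exI[of _ P], intro conjI ballI refl conjunct1[OF ext[OF P]] *)
qed

lemma linked_H:
  assumes L: "linked G (A \<union> C)" and A: "A \<subseteq> E0"
    and ext: "\<And>P. edge_constant H B P \<Longrightarrow> \<exists>Q. (\<forall>v\<in>verts H. Q v = P v) \<and> edge_constant G C Q"
  shows "linked H (A \<union> B)"
proof (rule linkedI)
  fix P x y assume P: "edge_constant H (A \<union> B) P" and xy: "x \<in> verts H" "y \<in> verts H"
  then have PC: "edge_constant H B P" "edge_constant H A P" by (simp_all add: edge_constant_Un)
  obtain Q where Q: "\<forall>v\<in>verts H. Q v = P v" "edge_constant G C Q"
    using ext[OF PC(1)] by (elim exE conjE)
  have "P v = Q v" if "v \<in> \<Union> (ends G ` E0)" for v using Q(1) that common_ends by blast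
  then have "edge_constant G A Q" using PC(2) edge_constant_core[OF A, of P Q] by blast
  then have "edge_constant G (A \<union> C) Q" using Q(2) by (simp add: edge_constant_Un)
  from linkedD[OF L this, of x y] show "P x = P y" using Q(1) xy verts_H by auto
qed

lemma valency_common: "A \<subseteq> E0 \<Longrightarrow> valency H A v = valency G A v"
  using ends_common by (intro valency_cong) auto

lemma two_regular_G:
  assumes "two_regular H F" "F \<subseteq> E0" shows "two_regular G F"
proof -
  have "valency G F v = 0" if "v \<notin> verts H" for v
    using that assms(2) common_ends finite_subset[OF assms(2) finite_E0] by (auto simp: valency_eq_0)
  then show ?thesis
    using assms valency_common[OF assms(2)] edges_G by (auto simp: two_regular_def)
qed

text \<open>
  A two-regular set of \<open>H\<close> that avoids \<open>Y\<close> is two-regular in \<open>G\<close>, where it separates, and by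
  \<open>ext\<close> it then separates \<open>H\<close> as well. Only the sets that use \<open>Y\<close> remain to be examined. A vertex
  of \<open>H\<close> either keeps its degree or ends up with degree 2.
\<close>

lemma admissible_H:
  assumes admissible: "admissible G"
    and ne: "verts H \<noteq> {}" and linked: "linked H (E0 \<union> Y)"
    and deg: "\<And>v. v \<in> verts H \<Longrightarrow>
      valency H Y v = valency G X v \<or> valency G E0 v + valency H Y v = 2"
    and ext: "\<And>P. edge_constant G X P \<Longrightarrow>
      edge_constant H Y P \<and> (\<forall>x\<in>verts G - verts H. \<exists>y\<in>verts H. P x = P y)"
    and sep: "\<And>F. two_regular H F \<Longrightarrow> F \<inter> Y \<noteq> {} \<Longrightarrow> linked H (edges H - F) \<Longrightarrow> False"
  shows "admissible H"
  unfolding admissible_def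
proof (intro conjI ballI allI impI notI)
  show "graph H" by (rule graph_H)
  show "linked H (edges H)" using linked edges_H by simp
  fix v assume v: "v \<in> verts H"
  have "degree G v = valency G E0 v + valency G X v"
    using edges_G finite_E0 finite_X by (simp add: degree_valency valency_Un_disjoint)
  moreover have "degree H v = valency G E0 v + valency H Y v"
    using edges_H finite_E0 by (simp add: degree_valency valency_Un_disjoint valency_common)
  moreover have "degree G v = 2 \<or> degree G v = 3" using admissible v verts_H by (auto simp: admissible_def)
  ultimately show "degree H v = 2 \<or> degree H v = 3" using deg[OF v] by auto
next
  fix F assume F: "two_regular H F" "F \<noteq> {}" "linked H (edges H - F)"
  have "F \<inter> Y = {}" using sep[OF F(1) _ F(3)] by blast
  then have sub: "F \<subseteq> E0" using F(1) edges_H by (auto simp: two_regular_def)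
  have eq: "edges H - F = (E0 - F) \<union> Y" "edges G - F = (E0 - F) \<union> X"
    using edges_G edges_H sub by auto
  have "linked G (edges G - F)"
    unfolding eq by (rule linked_G[OF F(3)[unfolded eq] _ ext]) auto
  then show False using admissible F(2) two_regular_G[OF F(1) sub] by (auto simp: admissible_def)
qed (use ne in simp)

lemma splits_G:
  assumes M: "matching H M" and c: "card (edges H) + 1 = card (verts H) + card M"
    and lifts: "lifts_to G H E0 X Y M N"
  shows "splits G"
  unfolding splits_def
proof (intro exI conjI)
  have N: "N \<subseteq> X" "\<And>e f. e \<in> N \<Longrightarrow> f \<in> N \<Longrightarrow> e \<noteq> f \<Longrightarrow> ends G e \<inter> ends G f = {}"
    and free: "\<And>e v. e \<in> N \<Longrightarrow> v \<in> ends G e \<Longrightarrow>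
      v \<notin> \<Union> (ends G ` E0) \<or> v \<in> \<Union> (ends H ` (M \<inter> Y))"
    and L: "linked G ((E0 - M) \<union> (X - N))"
    and cards: "card X + card (verts H) + card (M \<inter> Y) = card Y + card (verts G) + card N"
    using lifts by (simp_all add: lifts_to_def)
  let ?N = "(M \<inter> E0) \<union> N"
  have ME: "M = (M \<inter> E0) \<union> (M \<inter> Y)" using M edges_H by (auto simp: matching_def)
  have disj: "ends H e \<inter> ends H f = {}" if "e \<in> M" "f \<in> M" "e \<noteq> f" for e f
    using M that by (simp add: matching_def)
  have cross: "ends G e \<inter> ends G f = {}" if e: "e \<in> M \<inter> E0" and f: "f \<in> N" for e f
  proof (rule ccontr)
    assume "ends G e \<inter> ends G f \<noteq> {}"
    then obtain v where v: "v \<in> ends G e" "v \<in> ends G f" by blast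
    then have "v \<in> \<Union> (ends G ` E0)" using e by blast
    then obtain h where h: "h \<in> M \<inter> Y" "v \<in> ends H h" using free[OF f v(2)] by blast
    moreover have "v \<in> ends H e" "e \<noteq> h" using v e h edges_H ends_common by auto
    ultimately show False using disj[of e h] e by blast
  qed
  have inner: "ends G e \<inter> ends G f = {}" if "e \<in> M \<inter> E0" "f \<in> M \<inter> E0" "e \<noteq> f" for e f
    using that disj[of e f] ends_common by simp
  show "matching G ?N"
    unfolding matching_def using cross inner N edges_G by (auto; blast)
  have "edges G - ?N = (E0 - M) \<union> (X - N)" using edges_G N by auto
  then show "linked G (edges G - ?N)" using L by simp
  have fin: "finite E0" "finite X" "finite Y" "finite N" "finite (M \<inter> Y)" "finite (M \<inter> E0)"
    using finite_E0 finite_X edges_H N finite_subset by auto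
  have "card ?N = card (M \<inter> E0) + card N"
    using fin edges_G N by (intro card_Un_disjoint) auto
  moreover have "card M = card (M \<inter> E0) + card (M \<inter> Y)"
    using fin edges_H by (subst ME, intro card_Un_disjoint) auto
  moreover have "card (edges G) = card E0 + card X" "card (edges H) = card E0 + card Y"
    using edges_G edges_H fin by (simp_all add: card_Un_disjoint)
  ultimately show "card (edges G) + 1 = card (verts G) + card ?N" using c cards by simp
qed

end

context smallest_counterexample
begin

lemma graph: "graph G" and nonempty: "verts G \<noteq> {}" and linked: "linked G (edges G)"
  and finite_verts: "finite (verts G)" and finite_edges: "finite (edges G)"
  using admissible by (auto simp: admissible_def graph_def)

lemma degree_2_or_3: "v \<in> verts G \<Longrightarrow> degree G v = 2 \<or> degree G v = 3"
  using admissible by (simp add: admissible_def)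

lemma not_linked: "two_regular G F \<Longrightarrow> F \<noteq> {} \<Longrightarrow> \<not> linked G (edges G - F)"
  using admissible by (simp add: admissible_def)

lemma other_end:
  assumes "e \<in> edges G" "x \<in> ends G e"
  obtains y where "ends G e = {x, y}" "x \<noteq> y" "x \<in> verts G" "y \<in> verts G"
  using graph_other_end[OF graph assms] by blast

lemma degree_2_edges:
  assumes "x \<in> verts G" "degree G x = 2" "e \<in> edges G" "x \<in> ends G e"
  obtains f z where "f \<in> edges G" "f \<noteq> e" "ends G f = {x, z}" "z \<noteq> x" "z \<in> verts G"
    "\<forall>h\<in>edges G. x \<in> ends G h \<longleftrightarrow> h = e \<or> h = f"
proof -
  obtain a b where ab: "{h \<in> edges G. x \<in> ends G h} = {a, b}" "a \<noteq> b"
    using assms(2) unfolding degree_def card_2_iff by blast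
  define f where "f = (if e = a then b else a)"
  have f: "f \<noteq> e" "\<forall>h\<in>edges G. x \<in> ends G h \<longleftrightarrow> h = e \<or> h = f" "f \<in> edges G" "x \<in> ends G f"
    using ab assms(3,4) unfolding f_def by (auto split: if_splits)
  obtain z where "ends G f = {x, z}" "x \<noteq> z" "z \<in> verts G" using other_end f(3,4) by metis
  then show thesis using that[of f z] f by auto
qed

lemma degree_3_edges:
  assumes "x \<in> verts G" "degree G x = 3" "e \<in> edges G" "x \<in> ends G e" "f \<in> edges G" "x \<in> ends G f" "e \<noteq> f"
  obtains g z where "g \<in> edges G" "g \<noteq> e" "g \<noteq> f" "ends G g = {x, z}" "z \<noteq> x" "z \<in> verts G"
    "\<forall>h\<in>edges G. x \<in> ends G h \<longleftrightarrow> h = e \<or> h = f \<or> h = g"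
proof -
  let ?S = "{h \<in> edges G. x \<in> ends G h}"
  have "card (?S - {e, f}) = 1"
    using assms finite_edges by (subst card_Diff_subset) (auto simp: degree_def)
  then obtain g where g: "?S - {e, f} = {g}" by (auto simp: card_1_singleton_iff)
  then have g2: "g \<in> edges G" "g \<noteq> e" "g \<noteq> f" "x \<in> ends G g"
    "\<forall>h\<in>edges G. x \<in> ends G h \<longleftrightarrow> h = e \<or> h = f \<or> h = g"
    using assms(3-6) by blast+
  obtain z where "ends G g = {x, z}" "x \<noteq> z" "z \<in> verts G" using other_end g2(1,4) by metis
  then show thesis using that[of g z] g2 by auto
qed

section \<open>Contraction and bridges\<close>

text \<open>
  The form in which minimality is used: \<open>H\<close> has a decomposition, and if every decomposition of \<open>H\<close>
  lifts to \<open>G\<close>, then \<open>G\<close> is not a counterexample.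
\<close>

lemma no_local_change:
  assumes LC: "local_change G H E0 X Y"
    and ne: "verts H \<noteq> {}" and linked: "linked H (E0 \<union> Y)"
    and deg: "\<And>v. v \<in> verts H \<Longrightarrow>
      valency H Y v = valency G X v \<or> valency G E0 v + valency H Y v = 2"
    and ext: "\<And>P. edge_constant G X P \<Longrightarrow>
      edge_constant H Y P \<and> (\<forall>x\<in>verts G - verts H. \<exists>y\<in>verts H. P x = P y)"
    and sep: "\<And>F. two_regular H F \<Longrightarrow> F \<inter> Y \<noteq> {} \<Longrightarrow> linked H (edges H - F) \<Longrightarrow> False"
    and less: "card (verts H) + card Y < card (verts G) + card X"
    and lift: "\<And>M. matching H M \<Longrightarrow> linked H ((E0 - M) \<union> (Y - M)) \<Longrightarrow>
      \<exists>N. lifts_to G H E0 X Y M N"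
  shows False
proof -
  interpret local_change G H E0 X Y by fact
  have "admissible H" by (rule admissible_H[OF admissible ne linked deg ext sep])
  moreover have "card (edges G) = card E0 + card X" "card (edges H) = card E0 + card Y"
    using edges_G edges_H finite_E0 finite_X by (simp_all add: card_Un_disjoint)
  then have "phi H < phi G" using less by (simp add: phi_def)
  ultimately obtain M where M: "matching H M" "linked H (edges H - M)"
      "card (edges H) + 1 = card (verts H) + card M"
    using smaller by (auto simp: splits_def)
  have "edges H - M = (E0 - M) \<union> (Y - M)" using edges_H by auto
  then obtain N where "lifts_to G H E0 X Y M N" using lift[OF M(1)] M(2) by auto
  then have "splits G" by (rule splits_G[OF M(1,3)])
  then show False using not_splits by blast
qed

text \<open>
  The edge \<open>e\<close> is contracted, so that \<open>f\<close> joins \<open>y\<close> and \<open>z\<close>. A decomposition lifts by adding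
  \<open>e\<close> to the tree and keeping the matching. The degrees in \<open>H\<close> are passed on to the premise
  because separating sets are mostly found by their vertices of degree 2.
\<close>

lemma contract_degree_2:
  assumes x: "x \<in> verts G" "degree G x = 2"
    and e: "e \<in> edges G" "ends G e = {x, y}" and f: "f \<in> edges G" "ends G f = {x, z}"
    and ef: "e \<noteq> f" and yz: "y \<noteq> z" "x \<noteq> y" "x \<noteq> z"
    and sep: "\<And>F H. H = \<lparr>verts = verts G - {x}, edges = edges G - {e}, ends = (ends G)(f := {y, z})\<rparr> \<Longrightarrow>
       graph H \<Longrightarrow> two_regular H F \<Longrightarrow> f \<in> F \<Longrightarrow> linked H (edges H - F) \<Longrightarrow>
       (\<And>v. v \<in> verts H \<Longrightarrow> degree H v = degree G v) \<Longrightarrow> False"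
  shows False
proof -
  define H where H: "H = \<lparr>verts = verts G - {x}, edges = edges G - {e}, ends = (ends G)(f := {y, z})\<rparr>"
  have yzV: "y \<in> verts G" "z \<in> verts G" using graph e f by (auto simp: graph_def)
  define E0 where "E0 = edges G - {e, f}"
  have finE0: "finite E0" using finite_edges by (simp add: E0_def)
  have E: "edges G = E0 \<union> {e, f}" using e f by (auto simp: E0_def)
  have notE0: "e \<notin> E0" "f \<notin> E0" by (auto simp: E0_def)
  have ff: "ends H f = {y, z}" and vertsH: "verts H = verts G - {x}" by (simp_all add: H)
  have "valency G (edges G) x = 2" using x by (simp add: degree_valency)
  then have "valency G E0 x = 0"
    unfolding E using ef finE0 e(2) f(2) by (simp add: valency_insert E0_def)
  then have xE0: "x \<notin> ends G h" if "h \<in> E0" for h using that finE0 by (simp add: valency_eq_0)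
  interpret local_change G H E0 "{e, f}" "{f}"
  proof
    show "ends G h \<subseteq> verts H" if "h \<in> E0" for h
      using graph that xE0 by (auto simp: graph_def E0_def H)
    show "ends H h \<subseteq> verts H \<and> card (ends H h) = 2" if "h \<in> {f}" for h
      using that yz yzV by (auto simp: H)
  qed (use E notE0 ef in \<open>auto simp: H graph\<close>)
  have valX: "valency G {e, f} v = (if v \<in> {x, y} then 1 else 0) + (if v \<in> {x, z} then 1 else 0)" for v
    using ef e(2) f(2) by (simp add: valency_insert valency_eq_0)
  have valY: "valency H {f} v = (if v \<in> {y, z} then 1 else 0)" for v
    using ff by (simp add: valency_insert valency_eq_0)
  have XY: "edge_constant H {f} P \<longleftrightarrow> P y = P z" for P
    by (simp add: edge_constant_insert[OF ff] edge_constant_empty)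
  have GX: "edge_constant G {e, f} P \<longleftrightarrow> P x = P y \<and> P x = P z" for P
    by (simp add: edge_constant_insert[OF e(2)] edge_constant_insert[OF f(2)] edge_constant_empty)
  have VH: "verts G - verts H = {x}" "y \<in> verts H" "z \<in> verts H"
    "card (verts G) = card (verts H) + 1"
    using x yzV yz card.remove[OF finite_verts x(1)] by (auto simp: H)
  have val: "valency H {f} v = valency G {e, f} v" if "v \<in> verts H" for v
  proof -
    have "v \<noteq> x" using that VH(1) by blast
    then show ?thesis using yz(1) by (auto simp: valX valY)
  qed
  show False
  proof (rule no_local_change[OF local_change_axioms])
    show "verts H \<noteq> {}" using VH by auto
    show "linked H (E0 \<union> {f})"
    proof (rule linked_H[OF linked[unfolded E]])
      fix P assume P: "edge_constant H {f} P"
      show "\<exists>Q. (\<forall>v\<in>verts H. Q v = P v) \<and> edge_constant G {e, f} Q"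
        using P yz by (intro exI[of _ "P(x := P y)"]) (auto simp: XY GX vertsH)
    qed simp
    show "valency H {f} v = valency G {e, f} v \<or> valency G E0 v + valency H {f} v = 2"
      if "v \<in> verts H" for v using val[OF that] by blast
    show "edge_constant H {f} P \<and> (\<forall>v\<in>verts G - verts H. \<exists>u\<in>verts H. P v = P u)"
      if "edge_constant G {e, f} P" for P
      using that VH by (auto simp: XY GX)
    show False if "two_regular H F" "F \<inter> {f} \<noteq> {}" "linked H (edges H - F)" for F
    proof (rule sep[OF H graph_H that(1) _ that(3)])
      fix v assume v: "v \<in> verts H"
      show "degree H v = degree G v"
        using val[OF v] finE0 edges_G edges_H
        by (simp add: degree_valency valency_Un_disjoint valency_common del: Un_insert_right)
    qed (use that in auto)
    show "card (verts H) + card {f} < card (verts G) + card {e, f}" using VH ef by simp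
    fix M assume M: "matching H M" "linked H ((E0 - M) \<union> ({f} - M))"
    \<comment> \<open>The matching is unchanged, and \<open>e\<close> belongs to the tree.\<close>
    let ?N = "M \<inter> {f}"
    have "linked G ((E0 - M) \<union> ({e, f} - ?N))"
    proof (rule linked_G[OF M(2)])
      fix P assume P: "edge_constant G ({e, f} - ?N) P"
      have xy: "P x = P y" by (rule edge_constantD[OF P, of e]) (use ef e in auto)
      have "edge_constant H ({f} - M) P"
      proof (cases "f \<in> M")
        case False
        have "P x = P z" by (rule edge_constantD[OF P, of f]) (use False f in auto)
        then have "edge_constant H {f} P" unfolding XY using xy by simp
        then show ?thesis by (rule edge_constant_subset) blast
      qed (simp add: edge_constant_empty)
      moreover have "\<exists>u\<in>verts H. P v = P u" if "v \<in> verts G - verts H" for v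
        using that xy VH(2) unfolding VH(1) by (intro bexI[of _ y]) simp_all
      ultimately show "edge_constant H ({f} - M) P \<and> (\<forall>v\<in>verts G - verts H. \<exists>u\<in>verts H. P v = P u)"
        by (intro conjI ballI)
    qed auto
    then show "\<exists>N. lifts_to G H E0 {e, f} {f} M N"
      unfolding lifts_to_def using VH(4) ef xE0 f(2) ff by (intro exI[of _ ?N]) auto
  qed
qed

text \<open>
  A bridge with an end of degree 2 is contracted. Otherwise both ends have degree 3, each side of the
  bridge is admissible, and decompositions of the two sides combine to one of \<open>G\<close> with the bridge
  in the tree.
\<close>

lemma bridgeless:
  assumes e: "e \<in> edges G" shows "linked G (edges G - {e})"
proof (rule ccontr)
  assume br: "\<not> linked G (edges G - {e})"
  have no2: False if xy: "ends G e = {x, y}" "degree G x = 2" for x y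
  proof -
    have xV: "x \<in> verts G" using e xy graph by (auto simp: graph_def)
    have neq: "x \<noteq> y" using e xy graph by (auto simp: graph_def)
    obtain f z where f: "f \<in> edges G" "f \<noteq> e" "ends G f = {x, z}" "z \<noteq> x" "z \<in> verts G"
      "\<forall>h\<in>edges G. x \<in> ends G h \<longleftrightarrow> h = e \<or> h = f"
      using degree_2_edges[OF xV xy(2) e] xy(1) by blast
    have yz: "y \<noteq> z"
    proof
      assume "y = z"
      then have par: "ends G f = ends G e" using f xy by simp
      have "linked G (edges G - {e})"
      proof (rule linkedI)
        fix P a b assume P: "edge_constant G (edges G - {e}) P" and ab: "a \<in> verts G" "b \<in> verts G"
        have "(\<forall>u\<in>ends G h. P u) \<or> (\<forall>u\<in>ends G h. \<not> P u)" if "h \<in> edges G" for h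
        proof (cases "h = e")
          case True
          have "f \<in> edges G - {e}" using f(1,2) by simp
          from bspec[OF P[unfolded edge_constant_def] this] show ?thesis unfolding True par .
        next
          case False
          then show ?thesis using P that unfolding edge_constant_def by simp
        qed
        then have "edge_constant G (edges G) P" by (simp add: edge_constant_def)
        from linkedD[OF linked this ab] show "P a = P b" .
      qed
      then show False using br by blast
    qed
    show False
    proof (rule contract_degree_2[OF xV xy(2) e xy(1) f(1,3) _ yz neq])
      show "e \<noteq> f" "x \<noteq> z" using f by auto
      fix F H
      assume H: "H = \<lparr>verts = verts G - {x}, edges = edges G - {e}, ends = (ends G)(f := {y, z})\<rparr>"
        "graph H" and F: "two_regular H F" "f \<in> F"
      have FE: "F \<subseteq> edges G" "e \<notin> F" using F by (auto simp: two_regular_def H)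
      have finF: "finite F" using FE(1) finite_edges finite_subset by blast
      define F0 where "F0 = F - {f}"
      have F0: "F = insert f F0" "f \<notin> F0" "finite F0" "e \<notin> F0" "F0 \<subseteq> edges G"
        using F FE finF by (auto simp: F0_def)
      have v0: "valency H F0 v = valency G F0 v" for v
        using F0 by (intro valency_cong) (auto simp: H)
      have v1: "valency H F v = (if v \<in> {y, z} then 1 else 0) + valency G F0 v" for v
        using F0(2,3) v0[of v] unfolding F0(1) by (simp add: valency_insert H)
      have v2: "valency G (insert e F) v =
          (if v \<in> {x, y} then 1 else 0) + ((if v \<in> {x, z} then 1 else 0) + valency G F0 v)" for v
        using F0(2-4) f(2,3) xy(1) unfolding F0(1) by (simp add: valency_insert)
      \<comment> \<open>If \<open>F\<close> contains \<open>f\<close> in \<open>H\<close>, then \<open>F\<close> together with \<open>e\<close> is two-regular in \<open>G\<close>, but contains a bridge.\<close>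
      have "valency G F0 x = 0" using F0 f(6) by (auto simp: valency_eq_0)
      then have "valency G (insert e F) v = (if v = x then 2 else valency H F v)" for v
        using v1[of v] v2[of v] yz neq f(4) by auto
      then have "two_regular G (insert e F)" using F(1) e FE by (auto simp: two_regular_def H)
      from two_regular_no_bridge[OF graph this, of e "edges G"] show False
        using br linked e FE by auto
    qed
  qed
  obtain P a b where P: "edge_constant G (edges G - {e}) P" "a \<in> verts G" "b \<in> verts G" "P a" "\<not> P b"
    using br unfolding linked_def by blast
  \<comment> \<open>\<open>half P M\<close>: the set \<open>M\<close> decomposes the side of the bridge on which \<open>P\<close> holds.\<close>
  define half where "half P M \<longleftrightarrow> M \<subseteq> edges G - {e} \<and> (\<forall>h\<in>M. ends G h \<subseteq> {v\<in>verts G. P v}) \<and>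
      (\<forall>e\<in>M. \<forall>f\<in>M. e \<noteq> f \<longrightarrow> ends G e \<inter> ends G f = {}) \<and>
      (\<forall>Q. edge_constant G ({h\<in>edges G - {e}. ends G h \<subseteq> {v. P v}} - M) Q \<longrightarrow>
         (\<forall>v\<in>verts G. \<forall>w\<in>verts G. P v \<longrightarrow> P w \<longrightarrow> Q v = Q w)) \<and>
      card {h\<in>edges G - {e}. ends G h \<subseteq> {v. P v}} + 1 = card {v\<in>verts G. P v} + card M" for P M
  have side: "\<exists>M. half P M"
    if P: "edge_constant G (edges G - {e}) P" "a \<in> verts G" "b \<in> verts G" "P a" "\<not> P b" for P a b
  proof -
    obtain x' y' where xy': "ends G e = {x', y'}" "x' \<in> verts G" "y' \<in> verts G"
      using graph_ends[OF graph e] by metis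
    have "P x' \<noteq> P y'"
    proof
      assume "P x' = P y'"
      then have "edge_constant G (edges G) P" using P(1) xy'(1) unfolding edge_constant_def by fastforce
      from linkedD[OF linked this P(2,3)] show False using P by simp
    qed
    then obtain x y where xy: "ends G e = {x, y}" "x \<in> verts G" "y \<in> verts G" "P x" "\<not> P y"
      using xy' by (cases "P x'") (auto simp: insert_commute)
    define E0 where "E0 = {h\<in>edges G - {e}. ends G h \<subseteq> {v. P v}}"
    define X where "X = edges G - E0"
    define H where "H = \<lparr>verts = {v\<in>verts G. P v}, edges = E0, ends = ends G\<rparr>"
    interpret local_change G H E0 X "{}"
    proof
      show "ends G h \<subseteq> verts H" if "h \<in> E0" for h using that graph by (auto simp: E0_def H_def graph_def)
    qed (auto simp: H_def X_def E0_def graph)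
    have Xout: "ends G h \<subseteq> {v. \<not> P v}" if "h \<in> X" "h \<noteq> e" for h
      using that P(1) by (fastforce simp: X_def E0_def edge_constant_def)
    have eX: "e \<in> X" using e by (simp add: X_def E0_def)
    have "splits H"
    proof (rule smaller)
      show "admissible H"
      proof (rule admissible_H[OF admissible])
        show "verts H \<noteq> {}" using xy by (auto simp: H_def)
        have E: "linked G (E0 \<union> X)" using linked edges_G by simp
        show "linked H (E0 \<union> {})"
        proof (rule linked_H[OF E])
          fix Q
          show "\<exists>R. (\<forall>v\<in>verts H. R v = Q v) \<and> edge_constant G X R"
          proof (intro exI conjI)
            show "edge_constant G X (\<lambda>v. if P v then Q v else Q x)"
            proof (rule edge_constantI)
              fix h u v assume h: "h \<in> X" "u \<in> ends G h" "v \<in> ends G h"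
              show "(if P u then Q u else Q x) = (if P v then Q v else Q x)"
              proof (cases "h = e")
                case True then show ?thesis using h xy by auto
              next
                case False then show ?thesis using Xout[OF h(1)] h by auto
              qed
            qed
          qed (simp add: H_def)
        qed simp
        \<comment> \<open>The end \<open>x\<close> of the bridge drops from degree 3 to degree 2, no other vertex changes its degree.\<close>
        show "valency H {} v = valency G X v \<or> valency G E0 v + valency H {} v = 2"
          if v: "v \<in> verts H" for v
        proof (cases "v = x")
          case False
          have "v \<notin> ends G h" if "h \<in> X" for h
            using that v False Xout[OF that] xy by (cases "h = e") (auto simp: H_def)
          then show ?thesis using finite_X by (simp add: valency_eq_0 valency_def)
        next
          case True
          have "{h \<in> X. x \<in> ends G h} = {e}" using eX Xout xy by auto
          then have "valency G X x = 1" by (simp add: valency_def)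
          moreover have "degree G x = 3" using degree_2_or_3[OF xy(2)] no2[OF xy(1)] by blast
          moreover have "degree G x = valency G E0 x + valency G X x"
            using edges_G finite_E0 finite_X by (simp add: degree_valency valency_Un_disjoint)
          ultimately show ?thesis using True by (simp add: valency_def)
        qed
        show "edge_constant H {} Q \<and> (\<forall>u\<in>verts G - verts H. \<exists>v\<in>verts H. Q u = Q v)"
          if Q: "edge_constant G X Q" for Q
        proof (intro conjI ballI bexI)
          fix u assume u: "u \<in> verts G - verts H"
          \<comment> \<open>The other side of the bridge is connected and contains \<open>y\<close>, which has the colour of \<open>x\<close>.\<close>
          let ?R = "\<lambda>v. if P v then Q x else Q v"
          have "edge_constant G (edges G) ?R"
          proof (rule edge_constantI)
            fix h u v assume h: "h \<in> edges G" "u \<in> ends G h" "v \<in> ends G h"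
            show "?R u = ?R v"
            proof (cases "h \<in> E0")
              case True then show ?thesis using h by (auto simp: E0_def)
            next
              case False
              then have hX: "h \<in> X" using h by (simp add: X_def)
              have "Q u = Q v" using edge_constantD[OF Q hX h(2,3)] .
              moreover have "Q x = Q y" using edge_constantD[OF Q eX, of x y] xy by simp
              ultimately show ?thesis using Xout[OF hX] h xy by (cases "h = e") auto
            qed
          qed
          from linkedD[OF linked this, of u x] show "Q u = Q x" using u xy by (simp add: H_def)
          show "x \<in> verts H" using xy by (simp add: H_def)
        qed (simp add: edge_constant_empty)
      qed auto
      have "E0 \<subset> edges G" using e unfolding E0_def by blast
      then have "card E0 < card (edges G)" using finite_edges by (rule psubset_card_mono[rotated])
      moreover have "card (verts H) \<le> card (verts G)"
        using finite_verts verts_H by (rule card_mono)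
      ultimately show "phi H < phi G" by (simp add: phi_def H_def)
    qed
    then obtain M where M: "matching H M" "linked H (edges H - M)"
      "card (edges H) + 1 = card (verts H) + card M" by (auto simp: splits_def)
    have "Q v = Q w" if "edge_constant G (E0 - M) Q" "v \<in> verts G" "w \<in> verts G" "P v" "P w" for Q v w
    proof -
      have "edge_constant H (edges H - M) Q" using that(1) by (simp add: H_def edge_constant_def)
      from linkedD[OF M(2) this, of v w] show ?thesis using that by (simp add: H_def)
    qed
    moreover have "\<forall>h\<in>M. ends G h \<subseteq> {v\<in>verts G. P v}"
      using M(1) common_ends by (auto simp: matching_def H_def)
    ultimately show ?thesis
      using M(1,3) unfolding half_def E0_def[symmetric]
      by (intro exI[of _ M]) (auto simp: matching_def H_def E0_def)
  qed
  have P': "edge_constant G (edges G - {e}) (\<lambda>v. \<not> P v)" using P(1) by (auto simp: edge_constant_def)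
  define A where "A = {h\<in>edges G - {e}. ends G h \<subseteq> {v. P v}}"
  define B where "B = {h\<in>edges G - {e}. ends G h \<subseteq> {v. \<not> P v}}"
  obtain M N where half: "half P M" "half (\<lambda>v. \<not> P v) N"
    using side[OF P] side[OF P' P(3,2)] P(4,5) by blast
  note half' = half[unfolded half_def]
  note M = half'(1)[THEN conjunct1] half'(1)[THEN conjunct2, THEN conjunct1, rule_format]
    half'(1)[THEN conjunct2, THEN conjunct2, THEN conjunct1, rule_format]
    half'(1)[THEN conjunct2, THEN conjunct2, THEN conjunct2, THEN conjunct1, folded A_def, rule_format]
    half'(1)[THEN conjunct2, THEN conjunct2, THEN conjunct2, THEN conjunct2, folded A_def]
  note N = half'(2)[THEN conjunct1] half'(2)[THEN conjunct2, THEN conjunct1, rule_format]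
    half'(2)[THEN conjunct2, THEN conjunct2, THEN conjunct1, rule_format]
    half'(2)[THEN conjunct2, THEN conjunct2, THEN conjunct2, THEN conjunct1, folded B_def, rule_format]
    half'(2)[THEN conjunct2, THEN conjunct2, THEN conjunct2, THEN conjunct2, folded B_def]
  have "splits G"
    unfolding splits_def
  proof (intro exI conjI)
    have cross: "ends G h \<inter> ends G k = {}" if "h \<in> M" "k \<in> N" for h k
      using M(2)[OF that(1)] N(2)[OF that(2)] by auto
    show "matching G (M \<union> N)"
      unfolding matching_def using M(1) N(1) M(3) N(3) cross by (auto; blast)
    have ne: "ends G h \<noteq> {}" if "h \<in> edges G" for h using graph that by (auto simp: graph_def)
    have E: "edges G = insert e (A \<union> B)" "e \<notin> A \<union> B" "A \<inter> B = {}"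
      using e P(1) ne unfolding A_def B_def edge_constant_def by blast+
    have fin: "finite A" "finite B" "finite M" "finite N"
      using finite_edges finite_subset[OF M(1)] finite_subset[OF N(1)] by (auto simp: A_def B_def)
    have "M \<inter> N = {}" using cross ne M(1) by fastforce
    moreover have "card (verts G) = card {v\<in>verts G. P v} + card {v\<in>verts G. \<not> P v}"
      using finite_verts by (subst card_Un_disjoint[symmetric]) (auto intro: arg_cong[where f = card])
    ultimately show "card (edges G) + 1 = card (verts G) + card (M \<union> N)"
      using M(5) N(5) E fin by (simp add: card_Un_disjoint)
    show "linked G (edges G - (M \<union> N))"
    proof (rule linkedI)
      fix Q v w assume Q: "edge_constant G (edges G - (M \<union> N)) Q" and vw: "v \<in> verts G" "w \<in> verts G"
      have AN: "A \<inter> N = {}" "B \<inter> M = {}"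
        using M(2) N(2) ne unfolding A_def B_def by blast+
      have "edge_constant G (A - M) Q" "edge_constant G (B - N) Q"
        by (rule edge_constant_subset[OF Q], use AN E in blast)+
      note c = M(4)[OF this(1)] N(4)[OF this(2)]
      obtain x y where xy: "ends G e = {x, y}" "x \<in> verts G" "y \<in> verts G"
        using graph_ends[OF graph e] by metis
      have exy: "Q x = Q y" using edge_constantD[OF Q, of e x y] e xy M(1) N(1) by auto
      have "P x \<noteq> P y"
      proof
        assume "P x = P y"
        then have "edge_constant G (edges G) P" using P(1) xy(1) unfolding edge_constant_def by fastforce
        from linkedD[OF linked this P(2,3)] show False using P by simp
      qed
      then have "Q u = Q x" if "u \<in> verts G" for u
        using c[OF that xy(2)] c[OF that xy(3)] exy by (cases "P u"; cases "P x") auto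
      then show "Q v = Q w" using vw by simp
    qed
  qed
  then show False using not_splits by blast
qed

section \<open>Parallel edges and adjacent vertices of degree 2\<close>

lemma in_ends: "ends G e = {x, y} \<Longrightarrow> x \<in> ends G e"
  by simp

text \<open>
  Otherwise, recolour \<open>x\<close>. The new colouring is constant on every edge except the third edge \<open>g\<close> at
  \<open>x\<close>. As \<open>g\<close> is not a bridge, the new colouring is constant, so \<open>P\<close> takes different values at the
  ends of \<open>g\<close>, although \<open>g\<close> is not in \<open>F\<close>.
\<close>

lemma same_side:
  assumes F: "two_regular G F" and P: "edge_constant G (edges G - F) P"
    and x: "degree G x = 3" "e \<in> F" "x \<in> ends G e"
  shows "\<exists>w h. h \<in> F \<and> w \<in> ends G h \<and> w \<noteq> x \<and> P w = P x"
proof (rule ccontr)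
  assume "\<not> ?thesis"
  then have other: "P w \<noteq> P x" if "h \<in> F" "w \<in> ends G h" "w \<noteq> x" for w h using that by blast
  have FE: "F \<subseteq> edges G" using F by (simp add: two_regular_def)
  have finF: "finite F" using FE finite_edges by (rule finite_subset)
  have xV: "x \<in> verts G" using FE graph x by (auto simp: graph_def)
  have "valency G F x \<noteq> 0" using x finF by (auto simp: valency_eq_0)
  then have vF: "valency G F x = 2" using F xV by (auto simp: two_regular_def)
  have "valency G (edges G - F) x + valency G F x = 3"
    using x(1) valency_Un_disjoint[of "edges G - F" F G x] finF finite_edges FE
    by (simp add: degree_valency Un_absorb2 Diff_disjoint[THEN trans[OF Int_commute]])
  then have "card {h \<in> edges G - F. x \<in> ends G h} = 1" using vF by (simp add: valency_def)
  then obtain g where g: "{h \<in> edges G - F. x \<in> ends G h} = {g}" by (auto simp: card_1_singleton_iff)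
  then have g2: "g \<in> edges G" "g \<notin> F" "x \<in> ends G g" by blast+
  obtain z where z: "ends G g = {x, z}" "x \<noteq> z" "z \<in> verts G" using other_end[OF g2(1,3)] by metis
  let ?Q = "P(x := \<not> P x)"
  have "edge_constant G (edges G - {g}) ?Q"
  proof (rule edge_constantI)
    fix h u v assume h: "h \<in> edges G - {g}" "u \<in> ends G h" "v \<in> ends G h"
    show "?Q u = ?Q v"
    proof (cases "h \<in> F")
      case True
      have "?Q t = (\<not> P x)" if "t \<in> ends G h" for t using other[OF True that] by auto
      then show ?thesis using h by blast
    next
      case False
      then have "x \<notin> ends G h" using g h(1) by blast
      moreover have "P u = P v" using edge_constantD[OF P] h False by blast
      ultimately show ?thesis using h by auto
    qed
  qed
  from linkedD[OF bridgeless[OF g2(1)] this xV z(3)] have "(\<not> P x) = P z" using z(2) by simp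
  moreover have "P x = P z" using edge_constant_ends[OF P _ z(1)] g2 by blast
  ultimately show False by blast
qed

lemma separating_colouring:
  assumes F: "two_regular G F" "F \<noteq> {}"
  obtains P where "edge_constant G (edges G - F) P" "\<not> edge_constant G F P"
proof -
  obtain P x y where P: "edge_constant G (edges G - F) P" and xy: "x \<in> verts G" "y \<in> verts G" "P x" "\<not> P y"
    using not_linked[OF F] unfolding linked_def by blast
  have "\<not> edge_constant G F P"
  proof
    assume "edge_constant G F P"
    then have "edge_constant G ((edges G - F) \<union> F) P" using P edge_constant_Un by blast
    then have "edge_constant G (edges G) P" by (rule edge_constant_subset) blast
    from linkedD[OF linked this xy(1,2)] show False using xy by simp
  qed
  then show thesis using that P by blast
qed

text \<open>
  The two edges form a separating cycle. An end of degree 3 would be on the same side as the other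
  end, which is impossible. Hence both ends have degree 2, and \<open>G\<close> consists of the two edges, one of
  which is a spanning tree.
\<close>

lemma no_parallel_edges:
  assumes e: "e \<in> edges G" and f: "f \<in> edges G" and par: "ends G e = ends G f"
  shows "e = f"
proof (rule ccontr)
  assume ef: "e \<noteq> f"
  obtain x y where xy: "ends G e = {x, y}" "x \<noteq> y" "x \<in> verts G" "y \<in> verts G"
    using graph_ends[OF graph e] by metis
  have val: "valency G {e, f} v = (if v \<in> {x, y} then 2 else 0)" for v
    using ef par xy by (simp add: valency_insert valency_empty)
  have F: "two_regular G {e, f}" using e f by (simp add: two_regular_def val)
  obtain P where P: "edge_constant G (edges G - {e, f}) P" "\<not> edge_constant G {e, f} P"
    using separating_colouring[OF F] by blast
  have fxy: "ends G f = {x, y}" using par xy(1) by simp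
  have neq: "P x \<noteq> P y"
    using P(2) unfolding edge_constant_insert[OF xy(1)] edge_constant_insert[OF fxy]
    by (simp add: edge_constant_empty)
  have deg: "degree G v = 2" if v: "v \<in> {x, y}" for v
  proof (rule ccontr)
    assume "degree G v \<noteq> 2"
    then have "degree G v = 3" using v degree_2_or_3 xy by blast
    from same_side[OF F P(1) this, of e] obtain w h where
      "h \<in> {e, f}" "w \<in> ends G h" "w \<noteq> v" "P w = P v" using v xy by auto
    then show False using v xy par neq by auto
  qed
  have only: "h \<in> {e, f}" if "h \<in> edges G" "v \<in> ends G h" "v \<in> {x, y}" for h v
  proof -
    have "card {h \<in> edges G. v \<in> ends G h} = 2" using deg[OF that(3)] by (simp add: degree_def)
    moreover have "{e, f} \<subseteq> {h \<in> edges G. v \<in> ends G h}" using e f xy par that(3) by auto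
    ultimately have "{e, f} = {h \<in> edges G. v \<in> ends G h}"
      using ef finite_edges by (intro card_subset_eq) auto
    then show ?thesis using that by blast
  qed
  have "edge_constant G (edges G) (\<lambda>v. v \<in> {x, y})"
  proof (rule edge_constantI)
    fix h u v assume h: "h \<in> edges G" "u \<in> ends G h" "v \<in> ends G h"
    have "ends G h = {x, y}" if "u \<in> {x, y} \<or> v \<in> {x, y}" using only[OF h(1)] h that xy par by blast
    then show "(u \<in> {x, y}) = (v \<in> {x, y})" using h by blast
  qed
  from linkedD[OF linked this xy(3)] have V: "verts G = {x, y}" using xy by auto
  have E: "edges G = {e, f}"
  proof (intro equalityI subsetI)
    fix h assume h: "h \<in> edges G"
    then obtain v where "v \<in> ends G h" "v \<in> verts G" using graph_ends[OF graph h] by blast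
    then show "h \<in> {e, f}" using only[OF h] V by blast
  qed (use e f in auto)
  have "card (edges G) + 1 = card (verts G) + card {e}" unfolding E V using ef xy(2) by simp
  moreover have "matching G {e}" using e by (simp add: matching_def)
  ultimately have "splits G" using bridgeless[OF e] unfolding splits_def by blast
  then show False using not_splits by blast
qed

text \<open>
  After contracting the edge, a cycle through the new edge contains \<open>v\<close>, which still has degree 2.
\<close>

lemma degree_2_not_adjacent:
  assumes e: "e \<in> edges G" "ends G e = {u, v}" and d: "degree G u = 2" "degree G v = 2"
  shows False
proof -
  have uv: "u \<in> verts G" "v \<in> verts G" "u \<noteq> v" using graph e by (auto simp: graph_def)
  obtain f z where f: "f \<in> edges G" "f \<noteq> e" "ends G f = {u, z}" "z \<noteq> u" "z \<in> verts G"
    "\<forall>h\<in>edges G. u \<in> ends G h \<longleftrightarrow> h = e \<or> h = f"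
    using degree_2_edges[OF uv(1) d(1) e(1) in_ends[OF e(2)]] .
  have vz: "v \<noteq> z" using no_parallel_edges[OF f(1) e(1)] f e by auto
  show False
  proof (rule contract_degree_2[OF uv(1) d(1) e f(1,3) f(2)[symmetric] vz uv(3) f(4)[symmetric]])
    fix F H assume H: "H = \<lparr>verts = verts G - {u}, edges = edges G - {e}, ends = (ends G)(f := {v, z})\<rparr>"
      and F: "graph H" "two_regular H F" "f \<in> F" "linked H (edges H - F)"
      and deg: "\<And>v. v \<in> verts H \<Longrightarrow> degree H v = degree G v"
    have VH: "v \<in> verts H" "z \<in> verts H" using uv f by (auto simp: H)
    have "degree H v \<noteq> 2"
      by (rule two_regular_linked_degree_3[OF F(1,2,4,3) _ VH(2)]) (use vz in \<open>simp_all add: H\<close>)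
    then show False using deg[OF VH(1)] d(2) by simp
  qed
qed

lemma degree_3_neighbour:
  assumes e: "e \<in> edges G" "ends G e = {u, v}" and d: "degree G u = 2"
  shows "degree G v = 3"
proof -
  have "v \<in> verts G" using graph e by (auto simp: graph_def)
  then show ?thesis using degree_2_not_adjacent[OF e d] degree_2_or_3 by blast
qed

text \<open>
  If \<open>z\<close> had degree 2, contract it into \<open>w\<close>. A cycle through the new edge at \<open>w\<close> leaves \<open>w\<close>
  through \<open>u\<close> or \<open>v\<close>, which have degree 2.
\<close>

lemma not_three_degree_2_neighbours:
  assumes e: "eu \<in> edges G" "ends G eu = {u, w}" "ev \<in> edges G" "ends G ev = {v, w}"
      "e \<in> edges G" "ends G e = {z, w}"
    and ne: "eu \<noteq> ev" "eu \<noteq> e" "ev \<noteq> e"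
    and d: "degree G u = 2" "degree G v = 2"
  shows "degree G z = 3"
proof (rule ccontr)
  assume "degree G z \<noteq> 3"
  have V: "u \<in> verts G" "v \<in> verts G" "w \<in> verts G" "z \<in> verts G" "z \<noteq> w" "u \<noteq> w" "v \<noteq> w"
    using graph e by (auto simp: graph_def)
  then have dz: "degree G z = 2" using \<open>degree G z \<noteq> 3\<close> degree_2_or_3 by blast
  have uvz: "u \<noteq> z" "v \<noteq> z"
    using no_parallel_edges[OF e(1,5)] no_parallel_edges[OF e(3,5)] e ne by auto
  have dw: "degree G w = 3" using degree_3_neighbour e(1,2) d by blast
  obtain f c where f: "f \<in> edges G" "f \<noteq> e" "ends G f = {z, c}" "c \<noteq> z" "c \<in> verts G"
    "\<forall>h\<in>edges G. z \<in> ends G h \<longleftrightarrow> h = e \<or> h = f"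
    using degree_2_edges[OF V(4) dz e(5) in_ends[OF e(6)]] .
  have wc: "w \<noteq> c" using no_parallel_edges[OF f(1) e(5)] f e by auto
  have at_w: "h = eu \<or> h = ev \<or> h = e" if h: "h \<in> edges G" "w \<in> ends G h" for h
  proof -
    have w: "w \<in> ends G eu" "w \<in> ends G ev" "w \<in> ends G e" using e by auto
    obtain g z' where g: "g \<in> edges G" "g \<noteq> eu" "g \<noteq> ev" "ends G g = {w, z'}" "z' \<noteq> w" "z' \<in> verts G"
        "\<forall>h\<in>edges G. w \<in> ends G h \<longleftrightarrow> h = eu \<or> h = ev \<or> h = g"
      by (rule degree_3_edges[OF V(3) dw e(1) w(1) e(3) w(2) ne(1)])
    show ?thesis using bspec[OF g(7) e(5)] bspec[OF g(7) h(1)] w(3) h(2) ne by auto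
  qed
  show False
  proof (rule contract_degree_2[OF V(4) dz e(5,6) f(1,3) f(2)[symmetric] wc V(5) f(4)[symmetric]])
    fix F H assume H: "H = \<lparr>verts = verts G - {z}, edges = edges G - {e}, ends = (ends G)(f := {w, c})\<rparr>"
      and F: "graph H" "two_regular H F" "f \<in> F" "linked H (edges H - F)"
      and deg: "\<And>v. v \<in> verts H \<Longrightarrow> degree H v = degree G v"
    have VH: "w \<in> verts H" "u \<in> verts H" "v \<in> verts H" using V uvz by (auto simp: H)
    have FE: "F \<subseteq> edges G - {e}" using F(2) by (auto simp: two_regular_def H)
    have finF: "finite F" using FE finite_edges finite_subset by blast
    have wf: "w \<in> ends H f" by (simp add: H)
    then have "valency H F w \<noteq> 0" using F(3) finF by (auto simp: valency_eq_0)
    then have "card {h \<in> F. w \<in> ends H h} = 2" using F(2) VH by (auto simp: two_regular_def valency_def)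
    then have "{h \<in> F. w \<in> ends H h} \<noteq> {f}" by auto
    then obtain h where h: "h \<in> F" "h \<noteq> f" "w \<in> ends H h" using wf F(3) by blast
    then have "h \<in> edges G" "h \<noteq> e" "w \<in> ends G h" "ends H h = ends G h" using FE by (auto simp: H)
    then have huv: "ends H h = {u, w} \<or> ends H h = {v, w}" using at_w e(2,4) by metis
    then obtain t where t: "t \<in> {u, v}" "t \<in> ends H h" by blast
    have "degree H t \<noteq> 2"
      by (rule two_regular_linked_degree_3[OF F(1,2,4) h(1) t(2) VH(1)]) (use t V in auto)
    then show False using deg[of t] VH t d by auto
  qed
qed

section \<open>Vertices of degree 2 at distance 2\<close>

text \<open>
  Let \<open>a\<close> and \<open>b\<close> be the other neighbours of \<open>u\<close> and \<open>v\<close>, and \<open>z\<close> the third neighbour of \<open>w\<close>. In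
  \<open>H\<close> the edge \<open>w z\<close> and the vertices \<open>u\<close>, \<open>v\<close> are gone and \<open>w\<close> is adjacent to \<open>a\<close> and \<open>b\<close>. The
  matching of \<open>H\<close> contains at most one of the edges at \<open>w\<close>. If it contains the one to \<open>a\<close>, then
  \<open>u a\<close> and \<open>v w\<close> are matching edges of \<open>G\<close>; likewise for \<open>b\<close>. If it contains neither, then all
  edges at \<open>u\<close>, \<open>v\<close>, \<open>w\<close> but one go into the tree, and the exception is \<open>v w\<close> or \<open>u w\<close>,
  according to the side of \<open>w\<close> on which \<open>z\<close> lies in the tree of \<open>H\<close>. Deleting \<open>w z\<close> without the
  contraction would not suffice, because a matching edge \<open>u w\<close> of that graph need not lift.
\<close>

lemma degree_2_no_common_neighbour:
  assumes eu: "eu \<in> edges G" "ends G eu = {u, w}" and ev: "ev \<in> edges G" "ends G ev = {v, w}"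
    and uv: "u \<noteq> v" and d: "degree G u = 2" "degree G v = 2"
  shows False
proof -
  have V: "u \<in> verts G" "v \<in> verts G" "w \<in> verts G" "u \<noteq> w" "v \<noteq> w"
    using graph eu ev by (auto simp: graph_def)
  have in_w: "w \<in> ends G eu" "w \<in> ends G ev" using eu ev by auto
  have euv: "eu \<noteq> ev" using eu ev uv V by auto
  have dw: "degree G w = 3" using degree_3_neighbour eu d by blast
  obtain g z where g: "g \<in> edges G" "g \<noteq> eu" "g \<noteq> ev" "ends G g = {w, z}" "z \<noteq> w" "z \<in> verts G"
      "\<forall>h\<in>edges G. w \<in> ends G h \<longleftrightarrow> h = eu \<or> h = ev \<or> h = g"
    using degree_3_edges[OF V(3) dw eu(1) in_w(1) ev(1) in_w(2) euv] .
  have dz: "degree G z = 3"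
    by (rule not_three_degree_2_neighbours[OF eu ev g(1) _ euv _ _ d]) (use g in auto)
  obtain fu a where fu: "fu \<in> edges G" "fu \<noteq> eu" "ends G fu = {u, a}" "a \<noteq> u" "a \<in> verts G"
      "\<forall>h\<in>edges G. u \<in> ends G h \<longleftrightarrow> h = eu \<or> h = fu"
    using degree_2_edges[OF V(1) d(1) eu(1) in_ends[OF eu(2)]] .
  obtain fv b where fv: "fv \<in> edges G" "fv \<noteq> ev" "ends G fv = {v, b}" "b \<noteq> v" "b \<in> verts G"
      "\<forall>h\<in>edges G. v \<in> ends G h \<longleftrightarrow> h = ev \<or> h = fv"
    using degree_2_edges[OF V(2) d(2) ev(1) in_ends[OF ev(2)]] .
  have zuv: "z \<noteq> u" "z \<noteq> v"
    using no_parallel_edges[OF g(1) eu(1)] no_parallel_edges[OF g(1) ev(1)] g eu ev by auto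
  have abw: "a \<noteq> w" "b \<noteq> w"
    using no_parallel_edges[OF fu(1) eu(1)] no_parallel_edges[OF fv(1) ev(1)] fu fv eu ev by auto
  have abuv: "a \<noteq> v" "b \<noteq> u"
    using degree_2_not_adjacent[OF fu(1,3) d(1)] degree_2_not_adjacent[OF fv(1,3) d(2)] d by auto
  have dist: "distinct [eu, ev, g, fu, fv]"
    using g fu fv eu ev V uv zuv abw abuv by auto
  define X where "X = {eu, ev, g, fu, fv}"
  define Y where "Y = {fu, fv}"
  define E0 where "E0 = edges G - X"
  define H where "H = \<lparr>verts = verts G - {u, v}, edges = E0 \<union> Y, ends = (ends G)(fu := {w, a}, fv := {w, b})\<rparr>"
  have XE: "X \<subseteq> edges G" using eu ev g fu fv by (auto simp: X_def)
  have E: "edges G = E0 \<union> X" "E0 \<inter> X = {}" using XE by (auto simp: E0_def)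
  have YX: "Y \<subseteq> X" by (auto simp: X_def Y_def)
  have avoid: "u \<notin> ends G h" "v \<notin> ends G h" "w \<notin> ends G h" if "h \<in> E0" for h
    using that g(7) fu(6) fv(6) by (auto simp: E0_def X_def)
  have eH: "ends H fu = {w, a}" "ends H fv = {w, b}" using dist by (auto simp: H_def)
  have vH: "verts H = verts G - {u, v}" by (simp add: H_def)
  interpret local_change G H E0 X Y
  proof
    show "ends G h \<subseteq> verts H" if "h \<in> E0" for h
      using graph that avoid[OF that] by (auto simp: graph_def E0_def vH)
    show "ends H h \<subseteq> verts H \<and> card (ends H h) = 2" if "h \<in> Y" for h
      using that V abw abuv fu fv by (auto simp: Y_def eH vH)
    show "ends H h = ends G h" if "h \<in> E0" for h using that by (auto simp: H_def E0_def X_def)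
    show "E0 \<inter> Y = {}" using E YX by blast
  qed (use E in \<open>auto simp: H_def graph Y_def\<close>)
  have VH: "w \<in> verts H" "z \<in> verts H" "a \<in> verts H" "b \<in> verts H"
    using V g fu fv zuv abuv by (auto simp: vH)
  have VD: "verts G - verts H = {u, v}" using V by (auto simp: vH)
  have cV: "card (verts G) = card (verts H) + 2"
    using card_removed[OF finite_verts verts_H VD] uv by simp
  have cXY: "card X = 5" "card Y = 2" using dist by (auto simp: X_def Y_def)
  have valX: "valency G X t = (if t = u \<or> t = w then 1 else 0) + ((if t = v \<or> t = w then 1 else 0) +
      ((if t = w \<or> t = z then 1 else 0) + ((if t = u \<or> t = a then 1 else 0) +
      (if t = v \<or> t = b then 1 else 0))))" for t
    unfolding X_def using dist
    by (simp add: valency_insert valency_empty eu(2) ev(2) g(4) fu(3) fv(3) split del: if_split)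
  have valY: "valency H Y t = (if t = w \<or> t = a then 1 else 0) + (if t = w \<or> t = b then 1 else 0)" for t
    unfolding Y_def using dist by (simp add: valency_insert valency_empty eH split del: if_split)
  have GX: "edge_constant G X P \<longleftrightarrow> P u = P w \<and> P v = P w \<and> P w = P z \<and> P u = P a \<and> P v = P b" for P
    unfolding X_def by (simp add: edge_constant_insert[OF eu(2)] edge_constant_insert[OF ev(2)]
      edge_constant_insert[OF g(4)] edge_constant_insert[OF fu(3)] edge_constant_insert[OF fv(3)] edge_constant_empty)
  have HY: "edge_constant H Y P \<longleftrightarrow> P w = P a \<and> P w = P b" for P
    unfolding Y_def by (simp add: edge_constant_insert[OF eH(1)] edge_constant_insert[OF eH(2)] edge_constant_empty)
  have deg_sum: "degree G t = valency G E0 t + valency G X t" for t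
    using E finite_E0 finite_X by (simp add: degree_valency valency_Un_disjoint)
  have E0w: "valency G E0 w = 0" using avoid finite_E0 by (simp add: valency_eq_0)
  show False
  proof (rule no_local_change[OF local_change_axioms])
    show "verts H \<noteq> {}" using VH by blast
    have EG: "edges G - {g} = E0 \<union> {eu, ev, fu, fv}" using XE dist by (auto simp: E0_def X_def)
    show "linked H (E0 \<union> Y)"
    proof (rule linked_H[OF bridgeless[OF g(1), unfolded EG]])
      fix P assume P: "edge_constant H Y P"
      have Pab: "P a = P w" "P b = P w" using P unfolding HY by argo+
      let ?Q = "P(u := P w, v := P w)"
      have "edge_constant G {eu, ev, fu, fv} ?Q"
        using Pab V uv abuv fu(4) fv(4)
        unfolding edge_constant_insert[OF eu(2)] edge_constant_insert[OF ev(2)]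
          edge_constant_insert[OF fu(3)] edge_constant_insert[OF fv(3)]
        by (simp add: edge_constant_empty)
      then show "\<exists>Q. (\<forall>v\<in>verts H. Q v = P v) \<and> edge_constant G {eu, ev, fu, fv} Q"
        by (intro exI[of _ ?Q]) (simp add: vH)
    qed simp
    show "valency H Y t = valency G X t \<or> valency G E0 t + valency H Y t = 2" if t: "t \<in> verts H" for t
    proof -
      have tuv: "t \<noteq> u" "t \<noteq> v" using t by (auto simp: vH)
      consider "t = w" | "t = z" | "t \<noteq> w" "t \<noteq> z" by blast
      then show ?thesis
      proof cases
        case 1 then show ?thesis using E0w by (simp add: valY)
      next
        case 2
        then show ?thesis using deg_sum[of z] dz tuv g(5) abw by (simp add: valY valX)
      next
        case 3 then show ?thesis using tuv by (simp add: valY valX)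
      qed
    qed
    show "edge_constant H Y P \<and> (\<forall>x\<in>verts G - verts H. \<exists>y\<in>verts H. P x = P y)"
      if "edge_constant G X P" for P
    proof (intro conjI ballI bexI)
      show "edge_constant H Y P" using that unfolding GX HY by argo
      show "P x = P w" if "x \<in> verts G - verts H" for x
        using that \<open>edge_constant G X P\<close> unfolding GX VD by auto
    qed (rule VH)
    show False if F: "two_regular H F" "F \<inter> Y \<noteq> {}" "linked H (edges H - F)" for F
    proof -
      obtain h where h: "h \<in> F" "w \<in> ends H h" using F(2) by (auto simp: Y_def eH)
      have "degree H w \<noteq> 2"
        by (rule two_regular_linked_degree_3[OF graph_H F(1,3) h VH(2) g(5)])
      moreover have "degree H w = 2"
        using edges_H finite_E0 E0w by (simp add: degree_valency valency_Un_disjoint valency_common valY)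
      ultimately show False by blast
    qed
    show "card (verts H) + card Y < card (verts G) + card X" using cV cXY by simp
    fix M assume M: "matching H M" "linked H ((E0 - M) \<union> (Y - M))"
    have not_both: "\<not> (fu \<in> M \<and> fv \<in> M)" using matching_common_end[OF M(1), of fu fv w] dist by (auto simp: eH)
    have wR: "w \<notin> \<Union> (ends G ` E0)" "u \<notin> \<Union> (ends G ` E0)" "v \<notin> \<Union> (ends G ` E0)" using avoid by blast+
    \<comment> \<open>The matching of \<open>H\<close> contains the edge \<open>f1\<close> at \<open>w\<close>; the cases of \<open>fu\<close> and \<open>fv\<close> are symmetric.\<close>
    have one: "\<exists>N. lifts_to G H E0 X Y M N"
      if M1: "M \<inter> Y = {f1}" "Y - M = {f2}"
        and N: "{f1, e2} \<subseteq> X" "X - {f1, e2} = {e1, g, f2}" "card {f1, e2} = 2"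
        and ends: "ends G e1 = {x1, w}" "ends G f1 = {x1, a1}" "ends G e2 = {x2, w}" "ends G f2 = {x2, a2}"
          "ends H f1 = {w, a1}" "ends H f2 = {w, a2}"
        and x: "{x1, x2} = {u, v}" "x1 \<noteq> x2" "a1 \<noteq> x2" "a1 \<noteq> w" "a2 \<noteq> w" "a2 \<in> verts H"
      for e1 f1 x1 a1 e2 f2 x2 a2
    proof -
      have L: "linked G ((E0 - M) \<union> (X - {f1, e2}))"
      proof (rule linked_G_recolour[OF M(2)[unfolded M1]])
        fix P assume "edge_constant G (X - {f1, e2}) P"
        then have P: "P x1 = P w" "P w = P z" "P x2 = P a2"
          unfolding N(2) edge_constant_insert[OF ends(1)] edge_constant_insert[OF g(4)]
            edge_constant_insert[OF ends(4)] by blast+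
        \<comment> \<open>In the tree of \<open>H\<close> the vertex \<open>w\<close> hangs on \<open>a2\<close>, in that of \<open>G\<close> it hangs on \<open>z\<close>.\<close>
        let ?Q = "P(w := P a2)"
        have const: "edge_constant H {f2} ?Q"
          unfolding edge_constant_insert[OF ends(6)] using x(5) by (simp add: edge_constant_empty)
        have all: "\<forall>t\<in>verts G. P t = c" if c: "\<forall>t\<in>verts H. ?Q t = c" for c
        proof
          fix t assume t: "t \<in> verts G"
          have "P z = c" "P a2 = c" using bspec[OF c VH(2)] bspec[OF c x(6)] g(5) x(5) by auto
          then have xw: "P x1 = c" "P x2 = c" "P w = c" using P by argo+
          show "P t = c"
          proof (cases "t \<in> {x1, x2, w}")
            case True then show ?thesis using xw by blast
          next
            case False
            then have "t \<in> verts H" using t x(1) unfolding vH by blast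
            then show ?thesis using bspec[OF c, of t] False by simp
          qed
        qed
        have same: "\<forall>t\<in>\<Union> (ends G ` E0). ?Q t = P t"
        proof
          fix t assume "t \<in> \<Union> (ends G ` E0)"
          then have "t \<noteq> w" using wR(1) by blast
          then show "?Q t = P t" by simp
        qed
        show "\<exists>Q. (\<forall>t\<in>\<Union> (ends G ` E0). Q t = P t) \<and> edge_constant H {f2} Q \<and>
            (\<forall>c. (\<forall>t\<in>verts H. Q t = c) \<longrightarrow> (\<forall>t\<in>verts G. P t = c))"
          by (rule exI[of _ ?Q], rule conjI[OF same conjI[OF const]], intro allI impI, rule all)
      qed blast
      have "x1 \<in> {u, v}" "x2 \<in> {u, v}" using x(1) by blast+
      then have "x1 \<noteq> w" "x2 \<noteq> w" "x1 \<notin> \<Union> (ends G ` E0)" "x2 \<notin> \<Union> (ends G ` E0)"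
        using V(4,5) wR by blast+
      then have "lifts_to G H E0 X Y M {f1, e2}"
        using L N(1,3) wR(1) ends(2,3) x(2-4) unfolding lifts_to_def M1 cV cXY by (simp add: ends(5))
      then show ?thesis by blast
    qed
    consider "fu \<in> M" "fv \<notin> M" | "fu \<notin> M" "fv \<in> M" | "fu \<notin> M" "fv \<notin> M" using not_both by blast
    then show "\<exists>N. lifts_to G H E0 X Y M N"
    proof cases
      case 1
      have MY: "M \<inter> Y = {fu}" "Y - M = {fv}" using 1 by (auto simp: Y_def)
      have "{fu, ev} \<subseteq> X" "X - {fu, ev} = {eu, g, fv}" "card {fu, ev} = 2" using dist by (auto simp: X_def)
      from one[OF MY this eu(2) fu(3) ev(2) fv(3) eH refl uv abuv(1) abw VH(4)] show ?thesis .
    next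
      case 2
      have MY: "M \<inter> Y = {fv}" "Y - M = {fu}" using 2 by (auto simp: Y_def)
      have "{fv, eu} \<subseteq> X" "X - {fv, eu} = {ev, g, fu}" "card {fv, eu} = 2" using dist by (auto simp: X_def)
      from one[OF MY this ev(2) fv(3) eu(2) fu(3) eH(2,1) insert_commute uv[symmetric] abuv(2) abw(2,1) VH(3)]
      show ?thesis .
    next
      case 3
      have MY: "M \<inter> Y = {}" "Y - M = Y" using 3 by (auto simp: Y_def)
      \<comment> \<open>If \<open>e2\<close> cannot be the exception, then the tree of \<open>H\<close> without \<open>w\<close> separates \<open>a2\<close> from \<open>a1\<close> and \<open>z\<close>.\<close>
      have far: "P a1 = P z \<and> P a2 \<noteq> P z"
        if P: "edge_constant G ((E0 - M) \<union> (X - {e2})) P" and st: "s \<in> verts G" "t \<in> verts G" "P s \<noteq> P t"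
          and N: "X - {e2} = {e1, g, f1, f2}" and Y12: "Y = {f1, f2}" and x: "{x1, x2} = {u, v}"
          and ends: "ends G e1 = {x1, w}" "ends G f1 = {x1, a1}" "ends G f2 = {x2, a2}"
            "ends H f1 = {w, a1}" "ends H f2 = {w, a2}"
        for P s t e1 f1 x1 a1 e2 f2 x2 a2
      proof -
        have "edge_constant G (E0 - M) P" "edge_constant G {e1, g, f1, f2} P"
          using P edge_constant_Un unfolding N by metis+
        then have P0: "edge_constant H (E0 - M) P"
          and P1: "P x1 = P w" "P w = P z" "P x1 = P a1" "P x2 = P a2"
          unfolding edge_constant_insert[OF ends(1)] edge_constant_insert[OF g(4)]
            edge_constant_insert[OF ends(2)] edge_constant_insert[OF ends(3)]
          using edge_constant_core[of "E0 - M" P P] by blast+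
        have "P a2 \<noteq> P z"
        proof
          assume a2z: "P a2 = P z"
          have "P w = P a1" "P w = P a2" using P1 a2z by argo+
          then have "edge_constant H Y P"
            unfolding Y12 edge_constant_insert[OF ends(4)] edge_constant_insert[OF ends(5)]
            using edge_constant_empty by blast
          then have HP: "edge_constant H ((E0 - M) \<union> (Y - M)) P" using P0 MY by (simp add: edge_constant_Un)
          have x12: "P x1 = P z" "P x2 = P z" using P1 a2z by argo+
          have "P r = P z" if r: "r \<in> verts G" for r
          proof (cases "r \<in> verts H")
            case True show ?thesis by (rule linkedD[OF M(2) HP True VH(2)])
          next
            case False
            then have "r = x1 \<or> r = x2" using r x unfolding vH by blast
            then show ?thesis using x12 by (elim disjE) simp_all
          qed
          then show False using st by simp
        qed
        then show ?thesis using P1 by argo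
      qed
      have "linked G ((E0 - M) \<union> (X - {ev})) \<or> linked G ((E0 - M) \<union> (X - {eu}))"
      proof (rule ccontr)
        assume "\<not> ?thesis"
        then obtain P1 x1 y1 P2 x2 y2 where
          P1: "edge_constant G ((E0 - M) \<union> (X - {ev})) P1" "x1 \<in> verts G" "y1 \<in> verts G" "P1 x1 \<noteq> P1 y1" and
          P2: "edge_constant G ((E0 - M) \<union> (X - {eu})) P2" "x2 \<in> verts G" "y2 \<in> verts G" "P2 x2 \<noteq> P2 y2"
          unfolding linked_def by blast
        have "X - {ev} = {eu, g, fu, fv}" "X - {eu} = {ev, g, fv, fu}" "Y = {fv, fu}" "{v, u} = {u, v}"
          using dist by (auto simp: X_def Y_def)
        note f = far[OF P1 this(1) Y_def refl eu(2) fu(3) fv(3) eH]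
          far[OF P2 this(2-4) ev(2) fv(3) fu(3) eH(2,1)]
        \<comment> \<open>If both exceptions fail, \<open>z\<close> is separated from both \<open>a\<close> and \<open>b\<close>, so it is not even linked to \<open>w\<close> in \<open>H\<close>.\<close>
        let ?Q = "\<lambda>t. t \<noteq> w \<and> P1 t = P1 z \<and> P2 t = P2 z"
        have "edge_constant H ((E0 - M) \<union> (Y - M)) ?Q"
          unfolding edge_constant_Un
        proof
          show "edge_constant H (Y - M) ?Q" unfolding MY HY using f by simp
          show "edge_constant H (E0 - M) ?Q"
          proof (rule edge_constantI)
            fix h s t assume h: "h \<in> E0 - M" "s \<in> ends H h" "t \<in> ends H h"
            then have st: "s \<in> ends G h" "t \<in> ends G h" "s \<noteq> w" "t \<noteq> w" using ends_common avoid by auto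
            have "P1 s = P1 t" "P2 s = P2 t"
              using edge_constantD[OF P1(1) _ st(1,2)] edge_constantD[OF P2(1) _ st(1,2)] h(1) by blast+
            then show "?Q s = ?Q t" using st by simp
          qed
        qed
        from linkedD[OF M(2) this VH(2,1)] show False using g(5) by simp
      qed
      then show ?thesis
      proof
        assume "linked G ((E0 - M) \<union> (X - {ev}))"
        moreover have "{ev} \<subseteq> X" by (simp add: X_def)
        ultimately have "lifts_to G H E0 X Y M {ev}"
          using wR ev(2) unfolding lifts_to_def MY cV cXY by simp
        then show ?thesis by blast
      next
        assume "linked G ((E0 - M) \<union> (X - {eu}))"
        moreover have "{eu} \<subseteq> X" by (simp add: X_def)
        ultimately have "lifts_to G H E0 X Y M {eu}"
          using wR eu(2) unfolding lifts_to_def MY cV cXY by simp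
        then show ?thesis by blast
      qed
    qed
  qed
qed

section \<open>Triangles\<close>

text \<open>
  The triangle is contracted to the vertex \<open>a\<close>, which keeps degree 2. If the matching of \<open>H\<close>
  contains the edge to \<open>b'\<close>, then \<open>b b'\<close> and the opposite triangle edge \<open>a c\<close> are matching edges of
  \<open>G\<close>; likewise for \<open>c'\<close>. If it contains neither, the triangle edge \<open>b c\<close> becomes a matching edge.
\<close>

lemma degree_2_not_in_triangle:
  assumes ab: "ab \<in> edges G" "ends G ab = {a, b}" and ac: "ac \<in> edges G" "ends G ac = {a, c}"
    and bc: "bc \<in> edges G" "ends G bc = {b, c}" and neq: "b \<noteq> c" and da: "degree G a = 2"
  shows False
proof -
  have V: "a \<in> verts G" "b \<in> verts G" "c \<in> verts G" "a \<noteq> b" "a \<noteq> c"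
    using graph ab ac bc by (auto simp: graph_def)
  have inb: "b \<in> ends G ab" "b \<in> ends G bc" and inc: "c \<in> ends G ac" "c \<in> ends G bc"
    using ab ac bc by auto
  have d3: "degree G b = 3" "degree G c = 3"
    using degree_3_neighbour[OF ab da] degree_3_neighbour[OF ac da] by blast+
  have tri: "ab \<noteq> ac" "ab \<noteq> bc" "ac \<noteq> bc" using ab ac bc neq V by auto
  obtain fb b' where fb: "fb \<in> edges G" "fb \<noteq> ab" "fb \<noteq> bc" "ends G fb = {b, b'}" "b' \<noteq> b" "b' \<in> verts G"
      "\<forall>h\<in>edges G. b \<in> ends G h \<longleftrightarrow> h = ab \<or> h = bc \<or> h = fb"
    using degree_3_edges[OF V(2) d3(1) ab(1) inb(1) bc(1) inb(2) tri(2)] .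
  obtain fc c' where fc: "fc \<in> edges G" "fc \<noteq> ac" "fc \<noteq> bc" "ends G fc = {c, c'}" "c' \<noteq> c" "c' \<in> verts G"
      "\<forall>h\<in>edges G. c \<in> ends G h \<longleftrightarrow> h = ac \<or> h = bc \<or> h = fc"
    using degree_3_edges[OF V(3) d3(2) ac(1) inc(1) bc(1) inc(2) tri(3)] .
  obtain ac0 a0 where a0: "ac0 \<in> edges G" "ac0 \<noteq> ab" "ends G ac0 = {a, a0}" "a0 \<noteq> a" "a0 \<in> verts G"
      "\<forall>h\<in>edges G. a \<in> ends G h \<longleftrightarrow> h = ab \<or> h = ac0"
    using degree_2_edges[OF V(1) da ab(1) in_ends[OF ab(2)]] .
  have "ac = ac0" using bspec[OF a0(6) ac(1)] ac tri by auto
  note at_a = a0(6)[folded \<open>ac = ac0\<close>]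
  have out: "b' \<noteq> a" "b' \<noteq> c" "c' \<noteq> a" "c' \<noteq> b"
    using no_parallel_edges[OF fb(1) ab(1)] no_parallel_edges[OF fb(1) bc(1)]
      no_parallel_edges[OF fc(1) ac(1)] no_parallel_edges[OF fc(1) bc(1)] fb fc ab ac bc
    by (auto simp: insert_commute)
  have dist: "distinct [ab, ac, bc, fb, fc]"
    using tri fb fc ab ac V out neq by auto
  define X where "X = {ab, ac, bc, fb, fc}"
  define Y where "Y = {fb, fc}"
  define E0 where "E0 = edges G - X"
  define H where "H = \<lparr>verts = verts G - {b, c}, edges = E0 \<union> Y, ends = (ends G)(fb := {a, b'}, fc := {a, c'})\<rparr>"
  have XE: "X \<subseteq> edges G" using ab ac bc fb fc by (auto simp: X_def)
  have E: "edges G = E0 \<union> X" "E0 \<inter> X = {}" using XE by (auto simp: E0_def)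
  have YX: "Y \<subseteq> X" by (auto simp: X_def Y_def)
  have avoid: "a \<notin> ends G h" "b \<notin> ends G h" "c \<notin> ends G h" if "h \<in> E0" for h
    using that at_a fb(7) fc(7) by (auto simp: E0_def X_def)
  have eH: "ends H fb = {a, b'}" "ends H fc = {a, c'}" using dist by (auto simp: H_def)
  have vH: "verts H = verts G - {b, c}" by (simp add: H_def)
  interpret local_change G H E0 X Y
  proof
    show "ends G h \<subseteq> verts H" if "h \<in> E0" for h
      using graph that avoid[OF that] by (auto simp: graph_def E0_def vH)
    show "ends H h \<subseteq> verts H \<and> card (ends H h) = 2" if "h \<in> Y" for h
      using that V out fb fc by (auto simp: Y_def eH vH)
    show "ends H h = ends G h" if "h \<in> E0" for h using that by (auto simp: H_def E0_def X_def)
    show "E0 \<inter> Y = {}" using E YX by blast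
  qed (use E in \<open>auto simp: H_def graph Y_def\<close>)
  have VH: "a \<in> verts H" "b' \<in> verts H" "c' \<in> verts H" using V fb fc out by (auto simp: vH)
  have VD: "verts G - verts H = {b, c}" using V by (auto simp: vH)
  have cV: "card (verts G) = card (verts H) + 2"
    using card_removed[OF finite_verts verts_H VD] neq by simp
  have cXY: "card X = 5" "card Y = 2" using dist by (auto simp: X_def Y_def)
  have valX: "valency G X t = (if t = a \<or> t = b then 1 else 0) + ((if t = a \<or> t = c then 1 else 0) +
      ((if t = b \<or> t = c then 1 else 0) + ((if t = b \<or> t = b' then 1 else 0) +
      (if t = c \<or> t = c' then 1 else 0))))" for t
    unfolding X_def using dist
    by (simp add: valency_insert valency_empty ab(2) ac(2) bc(2) fb(4) fc(4) split del: if_split)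
  have valY: "valency H Y t = (if t = a \<or> t = b' then 1 else 0) + (if t = a \<or> t = c' then 1 else 0)" for t
    unfolding Y_def using dist by (simp add: valency_insert valency_empty eH split del: if_split)
  note G_edge = edge_constant_insert[OF ab(2)] edge_constant_insert[OF ac(2)] edge_constant_insert[OF bc(2)]
    edge_constant_insert[OF fb(4)] edge_constant_insert[OF fc(4)]
  note H_edge = edge_constant_insert[OF eH(1)] edge_constant_insert[OF eH(2)]
  have rep: "\<exists>y\<in>verts H. P x = P y" if "x \<in> verts G - verts H" "P b = P a" "P c = P a" for P x
    using that VH(1) unfolding VD by blast
  show False
  proof (rule no_local_change[OF local_change_axioms])
    show "verts H \<noteq> {}" using VH by blast
    show "linked H (E0 \<union> Y)"
    proof (rule linked_H[OF linked[unfolded E]])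
      fix P assume "edge_constant H Y P"
      then have P: "P b' = P a" "P c' = P a" unfolding Y_def H_edge by argo+
      let ?Q = "P(b := P a, c := P a)"
      have "edge_constant G X ?Q"
        using P V neq out fb(5) fc(5) unfolding X_def G_edge by (simp add: edge_constant_empty)
      then show "\<exists>Q. (\<forall>v\<in>verts H. Q v = P v) \<and> edge_constant G X Q"
        by (intro exI[of _ ?Q]) (simp add: vH)
    qed simp
    show "valency H Y t = valency G X t \<or> valency G E0 t + valency H Y t = 2" if t: "t \<in> verts H" for t
      using t out by (simp add: valY valX vH)
    show "edge_constant H Y P \<and> (\<forall>x\<in>verts G - verts H. \<exists>y\<in>verts H. P x = P y)"
      if P: "edge_constant G X P" for P
    proof (intro conjI ballI)
      have eqs: "P b = P a" "P c = P a" "P a = P b'" "P a = P c'"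
        using P unfolding X_def G_edge by argo+
      show "edge_constant H Y P" unfolding Y_def H_edge using eqs by (simp add: edge_constant_empty)
      show "\<exists>y\<in>verts H. P x = P y" if "x \<in> verts G - verts H" for x using rep[OF that eqs(1,2)] .
    qed
    show False if F: "two_regular H F" "F \<inter> Y \<noteq> {}" "linked H (edges H - F)" for F
    proof -
      obtain h where h: "h \<in> F" "a \<in> ends H h" using F(2) by (auto simp: Y_def eH)
      have "degree H a \<noteq> 2"
        by (rule two_regular_linked_degree_3[OF graph_H F(1,3) h VH(2) out(1)])
      moreover have "valency G E0 a = 0" using avoid finite_E0 by (simp add: valency_eq_0)
      then have "degree H a = 2"
        using edges_H finite_E0 by (simp add: degree_valency valency_Un_disjoint valency_common valY)
      ultimately show False by blast
    qed
    show "card (verts H) + card Y < card (verts G) + card X" using cV cXY by simp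
    fix M assume M: "matching H M" "linked H ((E0 - M) \<union> (Y - M))"
    have not_both: "\<not> (fb \<in> M \<and> fc \<in> M)"
      using matching_common_end[OF M(1), of fb fc a] dist by (auto simp: eH)
    have R: "a \<notin> \<Union> (ends G ` E0)" "b \<notin> \<Union> (ends G ` E0)" "c \<notin> \<Union> (ends G ` E0)" using avoid by blast+
    consider "fb \<in> M" "fc \<notin> M" | "fb \<notin> M" "fc \<in> M" | "fb \<notin> M" "fc \<notin> M" using not_both by blast
    then show "\<exists>N. lifts_to G H E0 X Y M N"
    proof cases
      case 1
      have MY: "M \<inter> Y = {fb}" "Y - M = {fc}" using 1 by (auto simp: Y_def)
      have XN: "X - {fb, ac} = {ab, bc, fc}" using dist by (auto simp: X_def)
      have "linked G ((E0 - M) \<union> (X - {fb, ac}))"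
      proof (rule linked_G[OF M(2)[unfolded MY] Diff_subset], intro conjI ballI)
        fix P assume "edge_constant G (X - {fb, ac}) P"
        then have P: "P b = P a" "P c = P a" "P a = P c'" unfolding XN G_edge by argo+
        show "edge_constant H {fc} P" unfolding H_edge using P by (simp add: edge_constant_empty)
        show "\<exists>y\<in>verts H. P x = P y" if "x \<in> verts G - verts H" for x using rep[OF that P(1,2)] .
      qed
      moreover have "card {fb, ac} = 2" using dist by auto
      moreover have "{fb, ac} \<subseteq> X" by (simp add: X_def)
      ultimately have "lifts_to G H E0 X Y M {fb, ac}"
        using R fb(4) ac(2) V neq out unfolding lifts_to_def MY cV cXY by (auto simp: eH)
      then show ?thesis by blast
    next
      case 2
      have MY: "M \<inter> Y = {fc}" "Y - M = {fb}" using 2 by (auto simp: Y_def)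
      have XN: "X - {fc, ab} = {ac, bc, fb}" using dist by (auto simp: X_def)
      have "linked G ((E0 - M) \<union> (X - {fc, ab}))"
      proof (rule linked_G[OF M(2)[unfolded MY] Diff_subset], intro conjI ballI)
        fix P assume "edge_constant G (X - {fc, ab}) P"
        then have P: "P b = P a" "P c = P a" "P a = P b'" unfolding XN G_edge by argo+
        show "edge_constant H {fb} P" unfolding H_edge using P by (simp add: edge_constant_empty)
        show "\<exists>y\<in>verts H. P x = P y" if "x \<in> verts G - verts H" for x using rep[OF that P(1,2)] .
      qed
      moreover have "card {fc, ab} = 2" using dist by auto
      moreover have "{fc, ab} \<subseteq> X" by (simp add: X_def)
      ultimately have "lifts_to G H E0 X Y M {fc, ab}"
        using R fc(4) ab(2) V neq out unfolding lifts_to_def MY cV cXY by (auto simp: eH)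
      then show ?thesis by blast
    next
      case 3
      have MY: "M \<inter> Y = {}" "Y - M = Y" using 3 by (auto simp: Y_def)
      have XN: "X - {bc} = {ab, ac, fb, fc}" using dist by (auto simp: X_def)
      have "linked G ((E0 - M) \<union> (X - {bc}))"
      proof (rule linked_G[OF M(2)[unfolded MY] Diff_subset], intro conjI ballI)
        fix P assume "edge_constant G (X - {bc}) P"
        then have P: "P b = P a" "P c = P a" "P a = P b'" "P a = P c'" unfolding XN G_edge by argo+
        show "edge_constant H Y P" unfolding Y_def H_edge using P by (simp add: edge_constant_empty)
        show "\<exists>y\<in>verts H. P x = P y" if "x \<in> verts G - verts H" for x using rep[OF that P(1,2)] .
      qed
      moreover have "{bc} \<subseteq> X" by (simp add: X_def)
      ultimately have "lifts_to G H E0 X Y M {bc}"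
        using R bc(2) unfolding lifts_to_def MY cV cXY by simp
      then show ?thesis by blast
    qed
  qed
qed

text \<open>
  If all degrees are 3, then by \<open>same_side\<close> none of the three vertices is alone on its side, so the
  triangle does not separate.
\<close>

lemma no_triangle:
  assumes ab: "ab \<in> edges G" "ends G ab = {a, b}" and ac: "ac \<in> edges G" "ends G ac = {a, c}"
    and bc: "bc \<in> edges G" "ends G bc = {b, c}" and neq: "b \<noteq> c"
  shows False
proof -
  have V: "a \<in> verts G" "b \<in> verts G" "c \<in> verts G" "a \<noteq> b" "a \<noteq> c"
    using graph ab ac bc by (auto simp: graph_def)
  have ends: "ends G ab = {b, a}" "ends G ac = {c, a}" "ends G bc = {c, b}" using ab ac bc by auto
  have d: "degree G a = 3" "degree G b = 3" "degree G c = 3"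
    using degree_2_not_in_triangle[OF ab ac bc neq]
      degree_2_not_in_triangle[OF ab(1) ends(1) bc ac V(5)]
      degree_2_not_in_triangle[OF ac(1) ends(2) bc(1) ends(3) ab V(4)] degree_2_or_3 V by blast+
  have tri: "ab \<noteq> ac" "ab \<noteq> bc" "ac \<noteq> bc" using ab ac bc neq V by auto
  define F where "F = {ab, ac, bc}"
  have val: "valency G F t = (if t = a \<or> t = b then 1 else 0) + ((if t = a \<or> t = c then 1 else 0) +
      (if t = b \<or> t = c then 1 else 0))" for t
    unfolding F_def using tri
    by (simp add: valency_insert valency_empty ab(2) ac(2) bc(2) split del: if_split)
  have F: "two_regular G F" "F \<noteq> {}"
  proof -
    have "valency G F t = 0 \<or> valency G F t = 2" for t unfolding val using V(4,5) neq by auto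
    then show "two_regular G F" using ab(1) ac(1) bc(1) by (simp add: two_regular_def F_def)
  qed (simp add: F_def)
  obtain P where P: "edge_constant G (edges G - F) P" "\<not> edge_constant G F P"
    using separating_colouring[OF F] .
  note side = same_side[OF F(1) P(1)]
  have "P b = P a \<or> P c = P a" using side[OF d(1), of ab] ab(2) ac(2) bc(2) by (auto simp: F_def)
  moreover have "P a = P b \<or> P c = P b" using side[OF d(2), of ab] ab(2) ac(2) bc(2) by (auto simp: F_def)
  moreover have "P a = P c \<or> P b = P c" using side[OF d(3), of ac] ab(2) ac(2) bc(2) by (auto simp: F_def)
  ultimately have "P a = P b" "P a = P c" "P b = P c" by argo+
  then have "edge_constant G F P"
    unfolding F_def edge_constant_insert[OF ab(2)] edge_constant_insert[OF ac(2)] edge_constant_insert[OF bc(2)]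
    using edge_constant_empty by blast
  then show False using P(2) by blast
qed

section \<open>Cycles of length 4\<close>

text \<open>
  In \<open>H\<close> the 4-cycle is deleted and the outer neighbours \<open>b'\<close>, \<open>c'\<close> of \<open>b\<close>, \<open>c\<close> are joined by the
  edge \<open>fb\<close>. If \<open>fb\<close> is a matching edge of \<open>H\<close>, then \<open>b'\<close> and \<open>c'\<close> are not covered by other
  matching edges and the three edges \<open>b b'\<close>, \<open>c c'\<close>, \<open>d a\<close> are put into the matching of \<open>G\<close>.
  Otherwise the tree of \<open>H\<close> contains \<open>fb\<close>, the path \<open>b' b c c'\<close> replaces it, and the matching
  receives \<open>a b\<close> and \<open>c d\<close>. A nonseparating cycle of \<open>H\<close> through \<open>fb\<close> would become one of \<open>G\<close>
  through this path, because the edges \<open>a b\<close>, \<open>c d\<close>, \<open>d a\<close> and \<open>d d'\<close> still connect the 4-cycle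
  to the rest of \<open>G\<close>.
\<close>

lemma degree_2_not_in_4_cycle:
  assumes ab: "ab \<in> edges G" "ends G ab = {a, b}" and bc: "bc \<in> edges G" "ends G bc = {b, c}"
    and cd: "cd \<in> edges G" "ends G cd = {c, d}" and da: "da \<in> edges G" "ends G da = {d, a}"
    and neq: "a \<noteq> c" "b \<noteq> d" and deg_a: "degree G a = 2"
  shows False
proof -
  have V: "a \<in> verts G" "b \<in> verts G" "c \<in> verts G" "d \<in> verts G" "a \<noteq> b" "b \<noteq> c" "c \<noteq> d" "d \<noteq> a"
    using graph ab bc cd da by (auto simp: graph_def)
  have rev: "ends G ab = {b, a}" "ends G bc = {c, b}" "ends G cd = {d, c}" "ends G da = {a, d}"
    using ab bc cd da by auto
  have cyc: "ab \<noteq> bc" "bc \<noteq> cd" "cd \<noteq> da" "da \<noteq> ab" "ab \<noteq> cd" "bc \<noteq> da"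
    using ab bc cd da V neq by (auto simp: doubleton_eq_iff)
  have db: "degree G b = 3" and dd: "degree G d = 3"
    using degree_3_neighbour[OF ab deg_a] degree_3_neighbour[OF da(1) rev(4) deg_a] by blast+
  have dc: "degree G c = 3"
    using degree_2_no_common_neighbour[OF ab bc(1) rev(2) neq(1) deg_a] degree_2_or_3[OF V(3)] by blast
  obtain fb b' where fb: "fb \<in> edges G" "fb \<noteq> ab" "fb \<noteq> bc" "ends G fb = {b, b'}" "b' \<noteq> b" "b' \<in> verts G"
      "\<forall>h\<in>edges G. b \<in> ends G h \<longleftrightarrow> h = ab \<or> h = bc \<or> h = fb"
    using degree_3_edges[OF V(2) db ab(1) in_ends[OF rev(1)] bc(1) in_ends[OF bc(2)] cyc(1)] .
  obtain fc c' where fc: "fc \<in> edges G" "fc \<noteq> bc" "fc \<noteq> cd" "ends G fc = {c, c'}" "c' \<noteq> c" "c' \<in> verts G"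
      "\<forall>h\<in>edges G. c \<in> ends G h \<longleftrightarrow> h = bc \<or> h = cd \<or> h = fc"
    using degree_3_edges[OF V(3) dc bc(1) in_ends[OF rev(2)] cd(1) in_ends[OF cd(2)] cyc(2)] .
  obtain fd d' where fd: "fd \<in> edges G" "fd \<noteq> cd" "fd \<noteq> da" "ends G fd = {d, d'}" "d' \<noteq> d" "d' \<in> verts G"
      "\<forall>h\<in>edges G. d \<in> ends G h \<longleftrightarrow> h = cd \<or> h = da \<or> h = fd"
    using degree_3_edges[OF V(4) dd cd(1) in_ends[OF rev(3)] da(1) in_ends[OF da(2)] cyc(3)] .
  obtain h0 a0 where a0: "h0 \<in> edges G" "h0 \<noteq> ab" "ends G h0 = {a, a0}" "a0 \<noteq> a" "a0 \<in> verts G"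
      "\<forall>h\<in>edges G. a \<in> ends G h \<longleftrightarrow> h = ab \<or> h = h0"
    using degree_2_edges[OF V(1) deg_a ab(1) in_ends[OF ab(2)]] .
  have "da = h0" using bspec[OF a0(6) da(1)] da cyc by auto
  note at_a = a0(6)[folded \<open>da = h0\<close>]
  have bd: "b \<noteq> d'" "d \<noteq> b'"
    using no_triangle[OF ab da(1) rev(4) _ _ neq(2), of fd] no_triangle[OF ab da(1) rev(4) _ _ neq(2), of fb]
      fd(1,4) fb(1,4) by (auto simp: insert_commute)
  have ca: "c' \<noteq> a" "b' \<noteq> a" "d' \<noteq> a"
    using bspec[OF at_a fc(1)] bspec[OF at_a fb(1)] bspec[OF at_a fd(1)] fb fc fd ab da V neq
    by (auto simp: doubleton_eq_iff)
  have out: "b' \<noteq> c" "c' \<noteq> b" "c' \<noteq> d" "d' \<noteq> c"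
    using no_parallel_edges[OF fb(1) bc(1)] no_parallel_edges[OF fc(1) bc(1)]
      no_parallel_edges[OF fc(1) cd(1)] no_parallel_edges[OF fd(1) cd(1)] fb fc fd bc cd
    by (auto simp: insert_commute)
  have b'c': "b' \<noteq> c'"
    using no_triangle[OF fb(1) _ fc(1) _ bc(1,2) V(6), of b'] fb(4) fc(4) by (auto simp: insert_commute)
  have c'd': "c' \<noteq> d'"
    using no_triangle[OF fc(1) _ fd(1) _ cd(1,2) V(7), of c'] fc(4) fd(4) by (auto simp: insert_commute)
  have dist: "distinct [ab, bc, cd, da, fb, fc, fd]"
  proof -
    have "b \<notin> ends G h" if "h \<in> {cd, da, fc, fd}" for h
      using that cd(2) da(2) fc(4) fd(4) V(5-8) neq(2) bd(1) out(2) by auto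
    then have "fb \<notin> {cd, da, fc, fd}" using in_ends[OF fb(4)] by blast
    moreover have "c \<notin> ends G h" if "h \<in> {ab, da, fd}" for h
      using that ab(2) da(2) fd(4) V(5-8) neq(1) out(4) by auto
    then have "fc \<notin> {ab, da, fd}" using in_ends[OF fc(4)] by blast
    moreover have "d \<notin> ends G h" if "h \<in> {ab, bc}" for h
      using that ab(2) bc(2) V(5-8) neq(2) by auto
    then have "fd \<notin> {ab, bc}" using in_ends[OF fd(4)] by blast
    ultimately show ?thesis using cyc fb(2,3) fc(2,3) fd(2,3) by auto
  qed
  define X where "X = {ab, bc, cd, da, fb, fc, fd}"
  define Y where "Y = {fb}"
  define E0 where "E0 = edges G - X"
  define H where "H = \<lparr>verts = verts G - {a, b, c, d}, edges = E0 \<union> Y, ends = (ends G)(fb := {b', c'})\<rparr>"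
  have XE: "X \<subseteq> edges G" using ab bc cd da fb fc fd by (auto simp: X_def)
  have E: "edges G = E0 \<union> X" "E0 \<inter> X = {}" using XE by (auto simp: E0_def)
  have YX: "Y \<subseteq> X" by (auto simp: X_def Y_def)
  have avoid: "a \<notin> ends G h" "b \<notin> ends G h" "c \<notin> ends G h" "d \<notin> ends G h" if "h \<in> E0" for h
    using that at_a fb(7) fc(7) fd(7) by (auto simp: E0_def X_def)
  have eH: "ends H fb = {b', c'}" by (simp add: H_def)
  have vH: "verts H = verts G - {a, b, c, d}" by (simp add: H_def)
  have VH: "b' \<in> verts H" "c' \<in> verts H" "d' \<in> verts H" using fb fc fd bd ca out by (auto simp: vH)
  interpret local_change G H E0 X Y
  proof
    show "ends G h \<subseteq> verts H" if "h \<in> E0" for h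
      using graph that avoid[OF that] by (auto simp: graph_def E0_def vH)
    show "ends H h \<subseteq> verts H \<and> card (ends H h) = 2" if "h \<in> Y" for h
      using that VH b'c' by (auto simp: Y_def eH)
    show "ends H h = ends G h" if "h \<in> E0" for h using that by (auto simp: H_def E0_def X_def)
    show "E0 \<inter> Y = {}" using E YX by blast
  qed (use E in \<open>auto simp: H_def graph Y_def\<close>)
  have VD: "verts G - verts H = {a, b, c, d}" using V by (auto simp: vH)
  have cV: "card (verts G) = card (verts H) + 4"
    using card_removed[OF finite_verts verts_H VD] neq V by simp
  have cXY: "card X = 7" "card Y = 1" using dist by (auto simp: X_def Y_def)
  have valX: "valency G X t = (if t = a \<or> t = b then 1 else 0) + ((if t = b \<or> t = c then 1 else 0) +
      ((if t = c \<or> t = d then 1 else 0) + ((if t = d \<or> t = a then 1 else 0) +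
      ((if t = b \<or> t = b' then 1 else 0) + ((if t = c \<or> t = c' then 1 else 0) +
      (if t = d \<or> t = d' then 1 else 0))))))" for t
    unfolding X_def using dist
    by (simp add: valency_insert valency_empty ab(2) bc(2) cd(2) da(2) fb(4) fc(4) fd(4) split del: if_split)
  have valY: "valency H Y t = (if t = b' \<or> t = c' then 1 else 0)" for t
    unfolding Y_def by (simp add: valency_insert valency_empty eH split del: if_split)
  note G_edge = edge_constant_insert[OF ab(2)] edge_constant_insert[OF bc(2)] edge_constant_insert[OF cd(2)]
    edge_constant_insert[OF da(2)] edge_constant_insert[OF fb(4)] edge_constant_insert[OF fc(4)]
    edge_constant_insert[OF fd(4)]
  note H_edge = edge_constant_insert[OF eH]
  have rep: "\<exists>y\<in>verts H. P x = P y"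
    if x: "x \<in> verts G - verts H" and z: "z \<in> verts H" and P: "P a = P z" "P b = P z" "P c = P z" "P d = P z"
    for P x z
  proof (rule bexI[OF _ z])
    show "P x = P z" using x P unfolding VD by (elim insertE) simp_all
  qed
  have deg_sum: "degree G t = valency G E0 t + valency G X t" for t
    using E finite_E0 finite_X by (simp add: degree_valency valency_Un_disjoint)
  have dd': "degree G d' = 3"
    using degree_2_no_common_neighbour[OF ab(1,2)] degree_2_no_common_neighbour[OF da(1) rev(4) fd(1) _ ca(3)[symmetric] deg_a]
      fd(4) degree_2_or_3[OF fd(6)] by (auto simp: insert_commute)
  show False
  proof (rule no_local_change[OF local_change_axioms])
    show "verts H \<noteq> {}" using VH by blast
    \<comment> \<open>The edge \<open>fd\<close> is lost without replacement, so connectedness of \<open>H\<close> needs that it is not a bridge.\<close>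
    have EG: "edges G - {fd} = E0 \<union> {ab, bc, cd, da, fb, fc}" using XE dist by (auto simp: E0_def X_def)
    show "linked H (E0 \<union> Y)"
    proof (rule linked_H[OF bridgeless[OF fd(1), unfolded EG]])
      fix P assume "edge_constant H Y P"
      then have P: "P c' = P b'" unfolding Y_def H_edge by argo
      let ?Q = "P(a := P b', b := P b', c := P b', d := P b')"
      have "edge_constant G {ab, bc, cd, da, fb, fc} ?Q"
        using P V(5-8) neq out bd ca fb(5) fc(5) unfolding G_edge by (simp add: edge_constant_empty)
      then show "\<exists>Q. (\<forall>v\<in>verts H. Q v = P v) \<and> edge_constant G {ab, bc, cd, da, fb, fc} Q"
        by (intro exI[of _ ?Q]) (simp add: vH)
    qed simp
    show "valency H Y t = valency G X t \<or> valency G E0 t + valency H Y t = 2" if t: "t \<in> verts H" for t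
    proof (cases "t = d'")
      case False
      then show ?thesis using t b'c' by (simp add: valY valX vH)
    next
      case True
      then show ?thesis using t deg_sum[of d'] dd' c'd' b'c' by (simp add: valY valX vH)
    qed
    show "edge_constant H Y P \<and> (\<forall>x\<in>verts G - verts H. \<exists>y\<in>verts H. P x = P y)"
      if P: "edge_constant G X P" for P
    proof (intro conjI ballI)
      have eqs: "P a = P b'" "P b = P b'" "P c = P b'" "P d = P b'" "P b' = P c'"
        using P unfolding X_def G_edge by argo+
      show "edge_constant H Y P" unfolding Y_def H_edge using eqs edge_constant_empty by blast
      show "\<exists>y\<in>verts H. P x = P y" if "x \<in> verts G - verts H" for x using rep[OF that VH(1) eqs(1-4)] .
    qed
    show False if F: "two_regular H F" "F \<inter> Y \<noteq> {}" "linked H (edges H - F)" for F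
    proof -
      have fbF: "fb \<in> F" using F(2) by (simp add: Y_def)
      define F0 where "F0 = F - {fb}"
      have F0: "F = insert fb F0" "fb \<notin> F0" "F0 \<subseteq> E0"
        using F(1) fbF edges_H by (auto simp: F0_def two_regular_def Y_def)
      have finF0: "finite F0" using F0(3) finite_E0 by (rule finite_subset)
      \<comment> \<open>The corresponding two-regular set of \<open>G\<close>; here \<open>fb\<close> has the ends \<open>b\<close> and \<open>b'\<close>.\<close>
      let ?F = "insert fb (insert bc (insert fc F0))"
      have notF0: "bc \<notin> F0" "fc \<notin> F0" using F0(3) by (auto simp: E0_def X_def)
      have valF: "valency H F t = (if t = b' \<or> t = c' then 1 else 0) + valency G F0 t" for t
        unfolding F0(1) using F0(2) finF0
        by (simp add: valency_insert eH valency_common[OF F0(3)] split del: if_split)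
      have valF': "valency G ?F t = (if t = b \<or> t = b' then 1 else 0) + ((if t = b \<or> t = c then 1 else 0) +
          ((if t = c \<or> t = c' then 1 else 0) + valency G F0 t))" for t
        using F0(2) finF0 notF0 dist fb(3)
        by (simp add: valency_insert fb(4) bc(2) fc(4) split del: if_split)
      have zero: "valency G F0 t = 0" if "t \<in> {a, b, c, d}" for t
        using that avoid F0(3) finF0 by (auto simp: valency_eq_0)
      have "two_regular G ?F"
        unfolding two_regular_def
      proof (intro conjI ballI)
        show "?F \<subseteq> edges G" using fb bc fc F0(3) E by auto
        fix t assume t: "t \<in> verts G"
        show "valency G ?F t = 0 \<or> valency G ?F t = 2"
        proof (cases "t \<in> verts H")
          case True
          then have "valency G ?F t = valency H F t" using b'c' unfolding valF valF' by (simp add: vH)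
          then show ?thesis using F(1) True by (simp add: two_regular_def)
        next
          case False
          then have "t \<in> {a, b, c, d}" using t by (simp add: vH)
          then show ?thesis using zero[of t] V(5-8) neq bd ca out fb(5) fc(5) unfolding valF' by auto
        qed
      qed
      moreover have "linked G (edges G - ?F)"
      proof -
        have eqH: "edges H - F = (E0 - F0) \<union> {}" using edges_H F0 by (auto simp: Y_def)
        have eqG: "edges G - ?F = (E0 - F0) \<union> {ab, cd, da, fd}"
          using E F0(3) dist by (auto simp: X_def)
        show ?thesis
          unfolding eqG
        proof (rule linked_G[OF F(3)[unfolded eqH] Diff_subset], intro conjI ballI)
          fix P assume "edge_constant G {ab, cd, da, fd} P"
          then have P: "P a = P d'" "P b = P d'" "P c = P d'" "P d = P d'" unfolding G_edge by argo+
          show "\<exists>y\<in>verts H. P x = P y" if "x \<in> verts G - verts H" for x using rep[OF that VH(3) P] .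
        qed (rule edge_constant_empty)
      qed
      ultimately show False using not_linked by blast
    qed
    show "card (verts H) + card Y < card (verts G) + card X" using cV cXY by simp
    fix M assume M: "matching H M" "linked H ((E0 - M) \<union> (Y - M))"
    have R: "a \<notin> \<Union> (ends G ` E0)" "b \<notin> \<Union> (ends G ` E0)" "c \<notin> \<Union> (ends G ` E0)" "d \<notin> \<Union> (ends G ` E0)"
      using avoid by blast+
    show "\<exists>N. lifts_to G H E0 X Y M N"
    proof (cases "fb \<in> M")
      case True
      have MY: "M \<inter> Y = {fb}" "Y - M = {}" using True by (auto simp: Y_def)
      have XN: "X - {fb, fc, da} = {ab, bc, cd, fd}" using dist by (auto simp: X_def)
      have "linked G ((E0 - M) \<union> (X - {fb, fc, da}))"
      proof (rule linked_G[OF M(2)[unfolded MY] Diff_subset], intro conjI ballI)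
        fix P assume "edge_constant G (X - {fb, fc, da}) P"
        then have P: "P a = P d'" "P b = P d'" "P c = P d'" "P d = P d'" unfolding XN G_edge by argo+
        show "\<exists>y\<in>verts H. P x = P y" if "x \<in> verts G - verts H" for x using rep[OF that VH(3) P] .
      qed (rule edge_constant_empty)
      moreover have "card {fb, fc, da} = 3" using dist by auto
      moreover have "{fb, fc, da} \<subseteq> X" by (simp add: X_def)
      ultimately have "lifts_to G H E0 X Y M {fb, fc, da}"
        using R fb(4) fc(4) da(2) V(5-8) neq out bd ca b'c' unfolding lifts_to_def MY cV cXY by (auto simp: eH)
      then show ?thesis by blast
    next
      case False
      have MY: "M \<inter> Y = {}" "Y - M = {fb}" using False by (auto simp: Y_def)
      have XN: "X - {ab, cd} = {bc, da, fb, fc, fd}" using dist by (auto simp: X_def)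
      have "linked G ((E0 - M) \<union> (X - {ab, cd}))"
      proof (rule linked_G[OF M(2)[unfolded MY] Diff_subset], intro conjI ballI)
        fix P assume "edge_constant G (X - {ab, cd}) P"
        then have P: "P b = P b'" "P c = P b'" "P b' = P c'" "P a = P d'" "P d = P d'"
          unfolding XN G_edge by argo+
        show "edge_constant H {fb} P" unfolding H_edge using P edge_constant_empty by blast
        show "\<exists>y\<in>verts H. P x = P y" if x: "x \<in> verts G - verts H" for x
        proof (cases "x = b \<or> x = c")
          case True then show ?thesis using P(1,2) VH(1) by blast
        next
          case False
          then have "x = a \<or> x = d" using x unfolding VD by blast
          then show ?thesis using P(4,5) VH(3) by blast
        qed
      qed
      moreover have "card {ab, cd} = 2" using dist by auto
      moreover have "{ab, cd} \<subseteq> X" by (simp add: X_def)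
      ultimately have "lifts_to G H E0 X Y M {ab, cd}"
        using R ab(2) cd(2) V(5-8) neq unfolding lifts_to_def MY cV cXY by auto
      then show ?thesis by blast
    qed
  qed
qed

text \<open>
  The colouring \<open>S\<close> shows that the 4-cycle separates \<open>p\<close> from \<open>q\<close> and \<open>r\<close> from \<open>s\<close>. In \<open>H\<close> the
  4-cycle is deleted, and the edges \<open>p' q'\<close> and \<open>r' s'\<close> are the only ones between the two colour
  classes of \<open>S\<close>. Hence a two-regular set contains none or both of them, and in the latter case it
  separates. The matching of \<open>H\<close> contains at most one of them. If it contains \<open>p' q'\<close>, then \<open>p p'\<close>,
  \<open>q q'\<close> and \<open>r s\<close> become matching edges, and the path \<open>r' r q p s s'\<close> replaces \<open>r' s'\<close> in the tree;
  likewise for \<open>r' s'\<close>. If it contains neither, then \<open>q r\<close> and \<open>s p\<close> become matching edges, and the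
  paths \<open>p' p q q'\<close> and \<open>r' r s s'\<close> replace the two edges.
\<close>

lemma no_4_cycle_crossing:
  assumes pq: "pq \<in> edges G" "ends G pq = {p, q}" and qr: "qr \<in> edges G" "ends G qr = {q, r}"
    and rs: "rs \<in> edges G" "ends G rs = {r, s}" and sp: "sp \<in> edges G" "ends G sp = {s, p}"
    and neq: "p \<noteq> r" "q \<noteq> s"
    and deg: "degree G p = 3" "degree G q = 3" "degree G r = 3" "degree G s = 3"
    and S: "edge_constant G (edges G - {pq, qr, rs, sp}) S" "S p \<noteq> S q" "S r \<noteq> S s"
  shows False
proof -
  have V: "p \<in> verts G" "q \<in> verts G" "r \<in> verts G" "s \<in> verts G" "p \<noteq> q" "q \<noteq> r" "r \<noteq> s" "s \<noteq> p"
    using graph pq qr rs sp by (auto simp: graph_def)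
  have rev: "ends G pq = {q, p}" "ends G qr = {r, q}" "ends G rs = {s, r}" "ends G sp = {p, s}"
    using pq qr rs sp by auto
  have cyc: "pq \<noteq> qr" "qr \<noteq> rs" "rs \<noteq> sp" "sp \<noteq> pq" "pq \<noteq> rs" "qr \<noteq> sp"
    using pq qr rs sp V neq by (auto simp: doubleton_eq_iff)
  obtain fp p' where fp: "fp \<in> edges G" "fp \<noteq> sp" "fp \<noteq> pq" "ends G fp = {p, p'}" "p' \<noteq> p" "p' \<in> verts G"
      "\<forall>h\<in>edges G. p \<in> ends G h \<longleftrightarrow> h = sp \<or> h = pq \<or> h = fp"
    using degree_3_edges[OF V(1) deg(1) sp(1) in_ends[OF rev(4)] pq(1) in_ends[OF pq(2)] cyc(4)] .
  obtain fq q' where fq: "fq \<in> edges G" "fq \<noteq> pq" "fq \<noteq> qr" "ends G fq = {q, q'}" "q' \<noteq> q" "q' \<in> verts G"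
      "\<forall>h\<in>edges G. q \<in> ends G h \<longleftrightarrow> h = pq \<or> h = qr \<or> h = fq"
    using degree_3_edges[OF V(2) deg(2) pq(1) in_ends[OF rev(1)] qr(1) in_ends[OF qr(2)] cyc(1)] .
  obtain fr r' where fr: "fr \<in> edges G" "fr \<noteq> qr" "fr \<noteq> rs" "ends G fr = {r, r'}" "r' \<noteq> r" "r' \<in> verts G"
      "\<forall>h\<in>edges G. r \<in> ends G h \<longleftrightarrow> h = qr \<or> h = rs \<or> h = fr"
    using degree_3_edges[OF V(3) deg(3) qr(1) in_ends[OF rev(2)] rs(1) in_ends[OF rs(2)] cyc(2)] .
  obtain fs s' where fs: "fs \<in> edges G" "fs \<noteq> rs" "fs \<noteq> sp" "ends G fs = {s, s'}" "s' \<noteq> s" "s' \<in> verts G"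
      "\<forall>h\<in>edges G. s \<in> ends G h \<longleftrightarrow> h = rs \<or> h = sp \<or> h = fs"
    using degree_3_edges[OF V(4) deg(4) rs(1) in_ends[OF rev(3)] sp(1) in_ends[OF sp(2)] cyc(3)] .
  have out: "p' \<noteq> q" "p' \<noteq> s" "q' \<noteq> p" "q' \<noteq> r" "r' \<noteq> q" "r' \<noteq> s" "s' \<noteq> r" "s' \<noteq> p"
    using no_parallel_edges[OF fp(1) pq(1)] no_parallel_edges[OF fp(1) sp(1)]
      no_parallel_edges[OF fq(1) pq(1)] no_parallel_edges[OF fq(1) qr(1)]
      no_parallel_edges[OF fr(1) qr(1)] no_parallel_edges[OF fr(1) rs(1)]
      no_parallel_edges[OF fs(1) rs(1)] no_parallel_edges[OF fs(1) sp(1)] fp(2-4) fq(2-4) fr(2-4) fs(2-4) pq qr rs sp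
    by (auto simp: insert_commute)
  have opp: "p' \<noteq> r" "r' \<noteq> p" "q' \<noteq> s" "s' \<noteq> q"
  proof -
    show "p' \<noteq> r" using no_triangle[OF fp(1) _ pq(1) _ qr(1) rev(2) V(6)[symmetric]] fp(4) pq(2) by auto
    show "r' \<noteq> p" using no_triangle[OF fr(1) _ qr(1) rev(2) pq(1,2) V(5)] fr(4) by auto
    show "q' \<noteq> s" using no_triangle[OF fq(1) _ qr(1,2) rs(1) rev(3) V(7)[symmetric]] fq(4) by auto
    show "s' \<noteq> q" using no_triangle[OF fs(1) _ rs(1) rev(3) qr(1,2) V(6)] fs(4) by auto
  qed
  note apart = V(5-8) V(5-8)[symmetric] neq neq[symmetric] out out[symmetric] opp opp[symmetric]
  note ends = pq(2) qr(2) rs(2) sp(2) fp(4) fq(4) fr(4) fs(4)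
  have at: "p \<notin> ends G h" if "h \<in> {qr, rs, fq, fr, fs}" for h
    using that by (elim insertE emptyE) (simp_all add: ends apart)
  have at': "q \<notin> ends G h" if "h \<in> {rs, sp, fr, fs}" for h
    using that by (elim insertE emptyE) (simp_all add: ends apart)
  have at'': "r \<notin> ends G h" if "h \<in> {pq, sp, fs}" for h
    using that by (elim insertE emptyE) (simp_all add: ends apart)
  have at''': "s \<notin> ends G h" if "h \<in> {pq, qr}" for h
    using that by (elim insertE emptyE) (simp_all add: ends apart)
  have dist: "distinct [pq, qr, rs, sp, fp, fq, fr, fs]"
  proof -
    have "fp \<notin> {qr, rs, fq, fr, fs}" using at in_ends[OF fp(4)] by blast
    moreover have "fq \<notin> {rs, sp, fr, fs}" using at' in_ends[OF fq(4)] by blast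
    moreover have "fr \<notin> {pq, sp, fs}" using at'' in_ends[OF fr(4)] by blast
    moreover have "fs \<notin> {pq, qr}" using at''' in_ends[OF fs(4)] by blast
    ultimately show ?thesis using cyc fp(2,3) fq(2,3) fr(2,3) fs(2,3) by auto
  qed
  define X where "X = {pq, qr, rs, sp, fp, fq, fr, fs}"
  define Y where "Y = {fp, fr}"
  define E0 where "E0 = edges G - X"
  define H where "H = \<lparr>verts = verts G - {p, q, r, s}, edges = E0 \<union> Y,
    ends = (ends G)(fp := {p', q'}, fr := {r', s'})\<rparr>"
  have XE: "X \<subseteq> edges G" using pq qr rs sp fp fq fr fs by (auto simp: X_def)
  have E: "edges G = E0 \<union> X" "E0 \<inter> X = {}" using XE by (auto simp: E0_def)
  have YX: "Y \<subseteq> X" by (auto simp: X_def Y_def)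
  have avoid: "p \<notin> ends G h" "q \<notin> ends G h" "r \<notin> ends G h" "s \<notin> ends G h" if "h \<in> E0" for h
    using that fp(7) fq(7) fr(7) fs(7) by (auto simp: E0_def X_def)
  have eH: "ends H fp = {p', q'}" "ends H fr = {r', s'}" using dist by (auto simp: H_def)
  have vH: "verts H = verts G - {p, q, r, s}" by (simp add: H_def)
  have VH: "p' \<in> verts H" "q' \<in> verts H" "r' \<in> verts H" "s' \<in> verts H"
    using fp(5,6) fq(5,6) fr(5,6) fs(5,6) out opp by (auto simp: vH)
  have outer: "fp \<in> edges G - {pq, qr, rs, sp}" "fq \<in> edges G - {pq, qr, rs, sp}"
      "fr \<in> edges G - {pq, qr, rs, sp}" "fs \<in> edges G - {pq, qr, rs, sp}"
    using fp(1) fq(1) fr(1) fs(1) dist by auto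
  have S': "S p = S p'" "S q = S q'" "S r = S r'" "S s = S s'"
    using edge_constant_ends[OF S(1) outer(1) fp(4)] edge_constant_ends[OF S(1) outer(2) fq(4)]
      edge_constant_ends[OF S(1) outer(3) fr(4)] edge_constant_ends[OF S(1) outer(4) fs(4)] by blast+
  have split: "S p' \<noteq> S q'" "S r' \<noteq> S s'" using S S' by argo+
  have pq': "p' \<noteq> q'" "r' \<noteq> s'" using split by auto
  interpret local_change G H E0 X Y
  proof
    show "ends G h \<subseteq> verts H" if "h \<in> E0" for h
      using graph that avoid[OF that] by (auto simp: graph_def E0_def vH)
    show "ends H h \<subseteq> verts H \<and> card (ends H h) = 2" if "h \<in> Y" for h
      using that VH pq' by (auto simp: Y_def eH)
    show "ends H h = ends G h" if "h \<in> E0" for h using that by (auto simp: H_def E0_def X_def)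
    show "E0 \<inter> Y = {}" using E YX by blast
  qed (use E in \<open>auto simp: H_def graph Y_def\<close>)
  have VD: "verts G - verts H = {p, q, r, s}" using V by (auto simp: vH)
  have cV: "card (verts G) = card (verts H) + 4"
    using card_removed[OF finite_verts verts_H VD] neq V by simp
  have cXY: "card X = 8" "card Y = 2" using dist by (auto simp: X_def Y_def)
  have valX: "valency G X t = (if t = p \<or> t = q then 1 else 0) + ((if t = q \<or> t = r then 1 else 0) +
      ((if t = r \<or> t = s then 1 else 0) + ((if t = s \<or> t = p then 1 else 0) +
      ((if t = p \<or> t = p' then 1 else 0) + ((if t = q \<or> t = q' then 1 else 0) +
      ((if t = r \<or> t = r' then 1 else 0) + (if t = s \<or> t = s' then 1 else 0)))))))" for t
    unfolding X_def using dist
    by (simp add: valency_insert valency_empty pq(2) qr(2) rs(2) sp(2) fp(4) fq(4) fr(4) fs(4) split del: if_split)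
  have valY: "valency H Y t = (if t = p' \<or> t = q' then 1 else 0) + (if t = r' \<or> t = s' then 1 else 0)" for t
    unfolding Y_def using dist by (simp add: valency_insert valency_empty eH split del: if_split)
  note G_edge = edge_constant_insert[OF pq(2)] edge_constant_insert[OF qr(2)] edge_constant_insert[OF rs(2)]
    edge_constant_insert[OF sp(2)] edge_constant_insert[OF fp(4)] edge_constant_insert[OF fq(4)]
    edge_constant_insert[OF fr(4)] edge_constant_insert[OF fs(4)]
  note H_edge = edge_constant_insert[OF eH(1)] edge_constant_insert[OF eH(2)]
  have rep: "\<exists>y\<in>verts H. P x = P y"
    if x: "x \<in> verts G - verts H" and P: "P p = P p'" "P q = P p'" "P r = P r'" "P s = P r'"
    for P x
  proof (cases "x = p \<or> x = q")
    case True then show ?thesis using P(1,2) VH(1) by blast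
  next
    case False
    then have "x = r \<or> x = s" using x unfolding VD by blast
    then show ?thesis using P(3,4) VH(3) by blast
  qed
  have S_E0: "edge_constant H A S" if "A \<subseteq> E0" for A
  proof -
    have "edge_constant G A S" by (rule edge_constant_subset[OF S(1)]) (use that E0_def X_def in blast)
    then show ?thesis using edge_constant_core[OF that, of S S] by blast
  qed
  have not_linked_E0: "\<not> linked H A" if "A \<subseteq> E0" for A
  proof
    assume "linked H A"
    from linkedD[OF this S_E0[OF that] VH(1,2)] show False using split by blast
  qed
  have cycle: "two_regular G {pq, qr, rs, sp}" by (rule two_regular_4_cycle[OF pq qr rs sp neq V(5-8)])
  show False
  proof (rule no_local_change[OF local_change_axioms])
    show "verts H \<noteq> {}" using VH by blast
    show "linked H (E0 \<union> Y)"
    proof (rule linkedI)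
      fix P x y assume P: "edge_constant H (E0 \<union> Y) P" and xy: "x \<in> verts H" "y \<in> verts H"
      have PE: "edge_constant H E0 P" "edge_constant H Y P" using P edge_constant_Un by blast+
      have PY: "P p' = P q'" "P r' = P s'" using PE(2) unfolding Y_def H_edge by argo+
      let ?P = "P(p := P p', q := P q', r := P r', s := P s')"
      have same: "?P t = P t" if "t \<in> verts H" for t using that by (simp add: vH)
      have P_E0: "edge_constant G E0 ?P"
        using PE(1) edge_constant_core[of E0 P ?P] same common_ends by blast
      have P_outer: "edge_constant G {fp, fq, fr, fs} ?P"
        unfolding G_edge using V(5-8) neq fp(5) fq(5) fr(5) fs(5) out opp by (simp add: edge_constant_empty)
      \<comment> \<open>By \<open>same_side\<close> for this refinement of \<open>S\<close>, the vertex among \<open>r\<close>, \<open>s\<close> on the side of \<open>p\<close> also has the colour of \<open>p\<close> under \<open>P\<close>.\<close>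
      let ?R = "\<lambda>t. S t = S p \<and> ?P t = ?P p"
      have "edges G - {pq, qr, rs, sp} = E0 \<union> {fp, fq, fr, fs}"
        using XE dist by (auto simp: E0_def X_def)
      then have "edge_constant G (edges G - {pq, qr, rs, sp}) ?P" using P_E0 P_outer edge_constant_Un by metis
      then have "edge_constant G (edges G - {pq, qr, rs, sp}) ?R"
        using S(1) unfolding edge_constant_def by metis
      from same_side[OF cycle this deg(1), of pq] obtain w h where
        w: "h \<in> {pq, qr, rs, sp}" "w \<in> ends G h" "w \<noteq> p" "?R w" using pq(2) by auto
      then have "w \<in> {q, r, s}" using pq(2) qr(2) rs(2) sp(2) by auto
      then have "w = r \<or> w = s" using w(4) S(2) by auto
      then have pr: "P r' = P p'" using w(4) PY(2) V(5-8) neq by auto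
      have "edge_constant G {pq, qr, rs, sp} ?P"
        unfolding G_edge using V(5-8) neq pr PY by (simp add: edge_constant_empty)
      moreover have "edges G = (E0 \<union> {fp, fq, fr, fs}) \<union> {pq, qr, rs, sp}" using E by (auto simp: X_def)
      ultimately have "edge_constant G (edges G) ?P" using P_E0 P_outer edge_constant_Un by metis
      from linkedD[OF linked this, of x y] have "?P x = ?P y" using xy verts_H by blast
      then show "P x = P y" using same xy by simp
    qed
    show "valency H Y t = valency G X t \<or> valency G E0 t + valency H Y t = 2" if t: "t \<in> verts H" for t
    proof -
      have "t \<noteq> p" "t \<noteq> q" "t \<noteq> r" "t \<noteq> s" using t by (auto simp: vH)
      then have "valency H Y t = valency G X t" using pq' by (simp add: valY valX)
      then show ?thesis by blast
    qed
    show "edge_constant H Y P \<and> (\<forall>x\<in>verts G - verts H. \<exists>y\<in>verts H. P x = P y)"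
      if P: "edge_constant G X P" for P
    proof (intro conjI ballI)
      have eqs: "P p = P p'" "P q = P p'" "P r = P r'" "P s = P r'" "P p' = P q'" "P r' = P s'"
        using P unfolding X_def G_edge by argo+
      show "edge_constant H Y P" unfolding Y_def H_edge using eqs(5,6) edge_constant_empty by blast
      show "\<exists>y\<in>verts H. P x = P y" if "x \<in> verts G - verts H" for x using rep[OF that eqs(1-4)] .
    qed
    show False if F: "two_regular H F" "F \<inter> Y \<noteq> {}" "linked H (edges H - F)" for F
    proof -
      have FE: "F \<subseteq> E0 \<union> Y" using F(1) edges_H by (simp add: two_regular_def)
      consider "fp \<in> F" "fr \<in> F" | "fp \<in> F" "fr \<notin> F" | "fp \<notin> F" "fr \<in> F" using F(2) by (auto simp: Y_def)
      then show False
      proof cases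
        case 1
        then have "edges H - F \<subseteq> E0" using edges_H by (auto simp: Y_def)
        then show False using not_linked_E0 F(3) by blast
      next
        case 2
        then have "F - {fp} \<subseteq> E0" using FE by (auto simp: Y_def)
        from parity[OF graph_H F(1) 2(1) eH(1) S_E0[OF this]] show False using split by blast
      next
        case 3
        then have "F - {fr} \<subseteq> E0" using FE by (auto simp: Y_def)
        from parity[OF graph_H F(1) 3(2) eH(2) S_E0[OF this]] show False using split by blast
      qed
    qed
    show "card (verts H) + card Y < card (verts G) + card X" using cV cXY by simp
    fix M assume M: "matching H M" "linked H ((E0 - M) \<union> (Y - M))"
    have R: "p \<notin> \<Union> (ends G ` E0)" "q \<notin> \<Union> (ends G ` E0)" "r \<notin> \<Union> (ends G ` E0)" "s \<notin> \<Union> (ends G ` E0)"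
      using avoid by blast+
    have not_both: "\<not> (fp \<in> M \<and> fr \<in> M)"
    proof
      assume "fp \<in> M \<and> fr \<in> M"
      then have "(E0 - M) \<union> (Y - M) \<subseteq> E0" by (auto simp: Y_def)
      then show False using not_linked_E0 M(2) by blast
    qed
    then consider "fp \<in> M" "fr \<notin> M" | "fp \<notin> M" "fr \<in> M" | "fp \<notin> M" "fr \<notin> M" by blast
    then show "\<exists>N. lifts_to G H E0 X Y M N"
    proof cases
      case 1
      have MY: "M \<inter> Y = {fp}" "Y - M = {fr}" using 1 by (auto simp: Y_def)
      have XN: "X - {fp, fq, rs} = {pq, qr, sp, fr, fs}" using dist by (auto simp: X_def)
      have "linked G ((E0 - M) \<union> (X - {fp, fq, rs}))"
      proof (rule linked_G[OF M(2)[unfolded MY] Diff_subset], intro conjI ballI)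
        fix P assume "edge_constant G (X - {fp, fq, rs}) P"
        then have P: "P p = P r'" "P q = P r'" "P r = P r'" "P s = P r'" "P r' = P s'"
          unfolding XN G_edge by argo+
        show "edge_constant H {fr} P" unfolding H_edge using P(5) edge_constant_empty by blast
        show "\<exists>y\<in>verts H. P x = P y" if "x \<in> verts G - verts H" for x
        proof (rule bexI[OF _ VH(3)])
          show "P x = P r'" using that P unfolding VD by blast
        qed
      qed
      moreover have "card {fp, fq, rs} = 3" using dist by auto
      moreover have "{fp, fq, rs} \<subseteq> X" by (simp add: X_def)
      ultimately have "lifts_to G H E0 X Y M {fp, fq, rs}"
        using R fp(4,5) fq(4,5) rs(2) V(5-8) neq out opp pq' unfolding lifts_to_def MY cV cXY by (auto simp: eH)
      then show ?thesis by blast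
    next
      case 2
      have MY: "M \<inter> Y = {fr}" "Y - M = {fp}" using 2 by (auto simp: Y_def)
      have XN: "X - {fr, fs, pq} = {qr, rs, sp, fp, fq}" using dist by (auto simp: X_def)
      have "linked G ((E0 - M) \<union> (X - {fr, fs, pq}))"
      proof (rule linked_G[OF M(2)[unfolded MY] Diff_subset], intro conjI ballI)
        fix P assume "edge_constant G (X - {fr, fs, pq}) P"
        then have P: "P p = P p'" "P q = P p'" "P r = P p'" "P s = P p'" "P p' = P q'"
          unfolding XN G_edge by argo+
        show "edge_constant H {fp} P" unfolding H_edge using P(5) edge_constant_empty by blast
        show "\<exists>y\<in>verts H. P x = P y" if "x \<in> verts G - verts H" for x
        proof (rule bexI[OF _ VH(1)])
          show "P x = P p'" using that P unfolding VD by blast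
        qed
      qed
      moreover have "card {fr, fs, pq} = 3" using dist by auto
      moreover have "{fr, fs, pq} \<subseteq> X" by (simp add: X_def)
      ultimately have "lifts_to G H E0 X Y M {fr, fs, pq}"
        using R fr(4,5) fs(4,5) pq(2) V(5-8) neq out opp pq' unfolding lifts_to_def MY cV cXY by (auto simp: eH)
      then show ?thesis by blast
    next
      case 3
      have MY: "M \<inter> Y = {}" "Y - M = Y" using 3 by (auto simp: Y_def)
      have XN: "X - {qr, sp} = {pq, rs, fp, fq, fr, fs}" using dist by (auto simp: X_def)
      have "linked G ((E0 - M) \<union> (X - {qr, sp}))"
      proof (rule linked_G[OF M(2)[unfolded MY] Diff_subset], intro conjI ballI)
        fix P assume "edge_constant G (X - {qr, sp}) P"
        then have P: "P p = P p'" "P q = P p'" "P r = P r'" "P s = P r'" "P p' = P q'" "P r' = P s'"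
          unfolding XN G_edge by argo+
        show "edge_constant H Y P" unfolding Y_def H_edge using P(5,6) edge_constant_empty by blast
        show "\<exists>y\<in>verts H. P x = P y" if "x \<in> verts G - verts H" for x using rep[OF that P(1-4)] .
      qed
      moreover have "card {qr, sp} = 2" using dist by auto
      moreover have "{qr, sp} \<subseteq> X" by (simp add: X_def)
      ultimately have "lifts_to G H E0 X Y M {qr, sp}"
        using R qr(2) sp(2) V(5-8) neq unfolding lifts_to_def MY cV cXY by auto
      then show ?thesis by blast
    qed
  qed
qed

text \<open>
  If all degrees are 3, then by \<open>same_side\<close> the four vertices are split two against two, so one of
  the two perfect matchings of the 4-cycle consists of edges whose ends lie on different sides.
\<close>

lemma no_4_cycle:
  assumes ab: "ab \<in> edges G" "ends G ab = {a, b}" and bc: "bc \<in> edges G" "ends G bc = {b, c}"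
    and cd: "cd \<in> edges G" "ends G cd = {c, d}" and da: "da \<in> edges G" "ends G da = {d, a}"
    and neq: "a \<noteq> c" "b \<noteq> d"
  shows False
proof -
  have V: "a \<in> verts G" "b \<in> verts G" "c \<in> verts G" "d \<in> verts G" "a \<noteq> b" "b \<noteq> c" "c \<noteq> d" "d \<noteq> a"
    using graph ab bc cd da by (auto simp: graph_def)
  have "degree G a \<noteq> 2" using degree_2_not_in_4_cycle[OF ab bc cd da neq] by blast
  moreover have "degree G b \<noteq> 2" using degree_2_not_in_4_cycle[OF bc cd da ab neq(2) neq(1)[symmetric]] by blast
  moreover have "degree G c \<noteq> 2" using degree_2_not_in_4_cycle[OF cd da ab bc neq(1)[symmetric] neq(2)[symmetric]] by blast
  moreover have "degree G d \<noteq> 2" using degree_2_not_in_4_cycle[OF da ab bc cd neq(2)[symmetric] neq(1)] by blast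
  ultimately have deg: "degree G a = 3" "degree G b = 3" "degree G c = 3" "degree G d = 3"
    using degree_2_or_3 V(1-4) by blast+
  define F where "F = {ab, bc, cd, da}"
  have F: "two_regular G F" "F \<noteq> {}"
    unfolding F_def using two_regular_4_cycle[OF ab bc cd da neq V(5-8)] by simp_all
  obtain P where P: "edge_constant G (edges G - F) P" "\<not> edge_constant G F P"
    using separating_colouring[OF F] .
  note side = same_side[OF F(1) P(1)]
  note ends = ab(2) bc(2) cd(2) da(2)
  have "P b = P a \<or> P c = P a \<or> P d = P a" using side[OF deg(1), of ab] ends by (auto simp: F_def)
  moreover have "P a = P b \<or> P c = P b \<or> P d = P b" using side[OF deg(2), of bc] ends by (auto simp: F_def)
  moreover have "P a = P c \<or> P b = P c \<or> P d = P c" using side[OF deg(3), of cd] ends by (auto simp: F_def)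
  moreover have "P a = P d \<or> P b = P d \<or> P c = P d" using side[OF deg(4), of da] ends by (auto simp: F_def)
  moreover have "\<not> (P a = P b \<and> P b = P c \<and> P c = P d)"
  proof
    assume "P a = P b \<and> P b = P c \<and> P c = P d"
    then have "P a = P b" "P b = P c" "P c = P d" "P d = P a" by argo+
    then have "edge_constant G F P"
      unfolding F_def edge_constant_insert[OF ab(2)] edge_constant_insert[OF bc(2)]
        edge_constant_insert[OF cd(2)] edge_constant_insert[OF da(2)]
      using edge_constant_empty by blast
    then show False using P(2) by blast
  qed
  ultimately have "(P a \<noteq> P b \<and> P c \<noteq> P d) \<or> (P b \<noteq> P c \<and> P d \<noteq> P a)" by argo
  then show False
  proof
    assume "P a \<noteq> P b \<and> P c \<noteq> P d"
    then show False
      using no_4_cycle_crossing[OF ab bc cd da neq deg P(1)[unfolded F_def]] by blast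
  next
    assume "P b \<noteq> P c \<and> P d \<noteq> P a"
    moreover have "F = {bc, cd, da, ab}" by (auto simp: F_def)
    note P(1)[unfolded this]
    ultimately show False
      using no_4_cycle_crossing[OF bc cd da ab neq(2) neq(1)[symmetric] deg(2-4) deg(1)] by blast
  qed
qed

section \<open>Girth and distances\<close>

lemma incident_edge:
  assumes "v \<in> verts G" obtains e y where "e \<in> edges G" "ends G e = {v, y}" "v \<noteq> y" "y \<in> verts G"
proof -
  have "degree G v \<noteq> 0" using degree_2_or_3[OF assms] by auto
  then have "{e \<in> edges G. v \<in> ends G e} \<noteq> {}" unfolding degree_def by (metis card.empty)
  then obtain e where e: "e \<in> edges G" "v \<in> ends G e" by blast
  then show thesis using other_end[OF e] that by metis
qed

lemma two_edge_connected: "edge_connected 2 G"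
  unfolding edge_connected_def
proof (intro conjI allI impI)
  show "graph G" by (rule graph)
  obtain v where "v \<in> verts G" using nonempty by blast
  moreover from incident_edge[OF this] obtain y where "v \<noteq> y" "y \<in> verts G" by metis
  ultimately have "{v, y} \<subseteq> verts G" "card {v, y} = 2" by auto
  then have "2 \<le> card (verts G)" using card_mono[OF finite_verts] by metis
  then show "card (verts G) > 1" by simp
  fix F assume F: "F \<subseteq> edges G" "card F < 2"
  have "finite F" using F(1) finite_edges by (rule finite_subset)
  moreover have "card F = 0 \<or> card F = 1" using F(2) by auto
  ultimately consider "F = {}" | e where "F = {e}" by (auto simp: card_1_singleton_iff)
  then have "linked G (edges G - F)" using linked bridgeless F(1) by cases auto
  then show "connected_graph (del_edges G F)" using connected_del_edges graph nonempty by blast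
qed

lemma next_edge:
  assumes F: "two_regular G F" and e: "e \<in> F" "ends G e = {x, y}"
  obtains f z where "f \<in> F" "f \<noteq> e" "ends G f = {y, z}" "z \<noteq> y" "z \<noteq> x"
proof -
  have FE: "F \<subseteq> edges G" using F by (simp add: two_regular_def)
  have finF: "finite F" using FE finite_edges by (rule finite_subset)
  have y: "y \<in> verts G" using graph FE e by (auto simp: graph_def)
  have "valency G F y \<noteq> 0" using e finF by (auto simp: valency_eq_0)
  then have "card {h \<in> F. y \<in> ends G h} = 2" using F y by (auto simp: two_regular_def valency_def)
  then have "{h \<in> F. y \<in> ends G h} \<noteq> {e}" by auto
  then obtain f where f: "f \<in> F" "y \<in> ends G f" "f \<noteq> e" using e by blast
  then have fE: "f \<in> edges G" using FE by blast
  obtain z where z: "ends G f = {y, z}" "y \<noteq> z" using other_end[OF fE f(2)] by metis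
  have "z \<noteq> x"
  proof
    assume "z = x"
    then have "ends G f = ends G e" using z e by auto
    then show False using no_parallel_edges fE FE e(1) f(3) by blast
  qed
  then show thesis using that[of f z] f z by auto
qed

text \<open>
  Starting from an edge \<open>e1\<close>, continue at both ends by two steps. In the absence of parallel edges,
  triangles and 4-cycles the five edges found are distinct.
\<close>

lemma cycle_length:
  assumes F: "two_regular G F" "F \<noteq> {}"
  shows "card F \<ge> 5"
proof -
  have FE: "F \<subseteq> edges G" using F by (simp add: two_regular_def)
  have finF: "finite F" using FE finite_edges by (rule finite_subset)
  obtain e1 where e1: "e1 \<in> F" using F by blast
  then obtain x0 x1 where x1: "ends G e1 = {x0, x1}" "x0 \<noteq> x1" using graph_ends[OF graph] FE by (metis subsetD)
  have x1': "ends G e1 = {x1, x0}" using x1 by auto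
  obtain e2 x2 where e2: "e2 \<in> F" "e2 \<noteq> e1" "ends G e2 = {x1, x2}" "x2 \<noteq> x1" "x2 \<noteq> x0"
    using next_edge[OF F(1) e1 x1(1)] .
  obtain e3 x3 where e3: "e3 \<in> F" "e3 \<noteq> e1" "ends G e3 = {x0, x3}" "x3 \<noteq> x0" "x3 \<noteq> x1"
    using next_edge[OF F(1) e1 x1'] .
  obtain e4 x4 where e4: "e4 \<in> F" "e4 \<noteq> e2" "ends G e4 = {x2, x4}" "x4 \<noteq> x2" "x4 \<noteq> x1"
    using next_edge[OF F(1) e2(1,3)] .
  obtain e5 x5 where e5: "e5 \<in> F" "e5 \<noteq> e3" "ends G e5 = {x3, x5}" "x5 \<noteq> x3" "x5 \<noteq> x0"
    using next_edge[OF F(1) e3(1,3)] .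
  have E: "e1 \<in> edges G" "e2 \<in> edges G" "e3 \<in> edges G" "e4 \<in> edges G" using FE e1 e2 e3 e4 by auto
  have 23: "x2 \<noteq> x3"
    using no_triangle[OF E(1) x1' E(2) e2(3) E(3) _ e2(5)[symmetric]] e3(3) by blast
  have 34: "x3 \<noteq> x4"
  proof
    assume "x3 = x4"
    then have "ends G e4 = {x2, x3}" "ends G e3 = {x3, x0}" using e4(3) e3(3) by auto
    from no_4_cycle[OF E(1) x1(1) E(2) e2(3) E(4) this(1) E(3) this(2)] show False
      using e2(5) e3(5) by blast
  qed
  have "x3 \<notin> ends G h" if "h \<in> {e1, e2, e4}" for h
    using that x1(1) e2(3) e4(3) 23 34 e3(4,5) by auto
  then have "e5 \<notin> {e1, e2, e4}" using in_ends[OF e5(3)] by blast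
  moreover have "x2 \<notin> ends G h" if "h \<in> {e1, e3}" for h
    using that x1(1) e3(3) 23 e2(4,5) by auto
  then have "e4 \<notin> {e1, e3}" using in_ends[OF e4(3)] by blast
  moreover have "x1 \<notin> ends G e3" using e3(3,5) x1(2) by auto
  then have "e2 \<noteq> e3" using in_ends[OF e2(3)] by blast
  ultimately have "card {e1, e2, e3, e4, e5} = 5" using e2(2) e3(2) e4(2) e5(2) by auto
  moreover have "{e1, e2, e3, e4, e5} \<subseteq> F" using e1 e2 e3 e4 e5 by blast
  ultimately show ?thesis using card_mono[OF finF] by metis
qed

lemma girth_at_least_5: "girth G \<ge> 5"
  unfolding girth_def
proof (rule INF_greatest)
  fix C assume "C \<in> {C. cycle_in C G}"
  then have "two_regular G (edges C)" "edges C \<noteq> {}" using cycle_two_regular[OF graph] by auto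
  then have "5 \<le> card (edges C)" by (rule cycle_length)
  then show "5 \<le> enat (card (edges C))" by (simp add: numeral_eq_enat)
qed

lemma degree_2_far_apart:
  assumes uv: "u \<noteq> v" and d: "degree G u = 2" "degree G v = 2"
  shows "distance G u v \<ge> 3"
  unfolding distance_def
proof (rule INF_greatest)
  fix p assume "p \<in> {p. path_between G u p v}"
  then have p: "p \<noteq> []" "hd p = u" "last p = v" "successively (adjacent G) p" by (auto simp: path_between_def)
  have "3 \<le> length p - 1"
  proof (rule ccontr)
    assume "\<not> 3 \<le> length p - 1"
    moreover have "length p > 0" using p(1) by simp
    ultimately have "length p = 1 \<or> length p = 2 \<or> length p = 3" by arith
    then consider x where "p = [x]" | x y where "p = [x, y]" | x w y where "p = [x, w, y]"
      by (auto simp: length_Suc_conv numeral_eq_Suc)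
    then show False
    proof cases
      case 1 then show False using p uv by simp
    next
      case 2
      then obtain e where "e \<in> edges G" "ends G e = {u, v}" using p by (auto simp: adjacent_def)
      then show False using degree_2_not_adjacent d by blast
    next
      case (3 x w y)
      then obtain e f where ef: "e \<in> edges G" "ends G e = {u, w}" "f \<in> edges G" "ends G f = {w, v}"
        using p by (auto simp: adjacent_def)
      then have "ends G f = {v, w}" by auto
      then show False using degree_2_no_common_neighbour[OF ef(1-3) _ uv d] by blast
    qed
  qed
  then show "3 \<le> enat (length p - 1)" by (simp add: numeral_eq_enat)
qed

section \<open>The subgraph of the vertices of degree 3\<close>

abbreviation (input) "cubic_part \<equiv> del_verts G (verts_of_degree 2 G)"

lemma verts_cubic_part: "verts cubic_part = verts_of_degree 3 G"
  using degree_2_or_3 by (auto simp: del_verts_def verts_of_degree_def)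

lemma cubic_edge:
  "e \<in> edges cubic_part \<longleftrightarrow> e \<in> edges G \<and> (\<forall>v\<in>ends G e. degree G v = 3)"
proof -
  have "ends G e \<subseteq> verts G" if "e \<in> edges G" using graph that by (auto simp: graph_def)
  then show ?thesis using degree_2_or_3 unfolding del_verts_def verts_of_degree_def by fastforce
qed

lemma graph_cubic_part: "graph cubic_part"
  using graph unfolding graph_def del_verts_def by auto

text \<open>
  If \<open>y\<close> and \<open>z\<close> had different colours, contract \<open>e\<close>. A two-regular set through the new edge cannot
  stay among the vertices of degree 3, because it would cross between the colours exactly once.
  So it contains another vertex of degree 2 and separates.
\<close>

lemma neighbours_same_colour:
  assumes P: "edge_constant G (edges cubic_part) P" and v: "degree G v = 2"
    and e: "e \<in> edges G" "ends G e = {v, y}" and f: "f \<in> edges G" "ends G f = {v, z}"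
  shows "P y = P z"
proof (rule ccontr)
  assume neq: "P y \<noteq> P z"
  have V: "v \<in> verts G" "y \<in> verts G" "z \<in> verts G" "v \<noteq> y" "v \<noteq> z"
    using graph e f by (auto simp: graph_def)
  have ef: "e \<noteq> f" and yz: "y \<noteq> z" using neq e f by (auto simp: doubleton_eq_iff)
  show False
  proof (rule contract_degree_2[OF V(1) v e f ef yz V(4,5)])
    fix F H assume H: "H = \<lparr>verts = verts G - {v}, edges = edges G - {e}, ends = (ends G)(f := {y, z})\<rparr>"
      and F: "graph H" "two_regular H F" "f \<in> F" "linked H (edges H - F)"
      and deg: "\<And>v. v \<in> verts H \<Longrightarrow> degree H v = degree G v"
    have VH: "y \<in> verts H" "z \<in> verts H" using V by (auto simp: H)
    have eHf: "ends H f = {y, z}" by (simp add: H)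
    have "edge_constant H (F - {f}) P"
    proof (rule edge_constantI)
      fix h s t assume h: "h \<in> F - {f}" and st: "s \<in> ends H h" "t \<in> ends H h"
      have hE: "h \<in> edges G" "h \<in> edges H" "ends H h = ends G h"
        using F(2) h by (auto simp: two_regular_def H)
      have "degree G x = 3" if x: "x \<in> ends G h" for x
      proof -
        have xH: "x \<in> verts H" using F(1) hE x by (auto simp: graph_def)
        obtain w where w: "w \<in> verts H" "w \<noteq> x" using VH yz by metis
        have "degree H x \<noteq> 2"
          by (rule two_regular_linked_degree_3[OF F(1,2,4) _ _ w]) (use h x hE in auto)
        then show ?thesis using deg[OF xH] degree_2_or_3[of x] xH by (auto simp: H)
      qed
      then have "h \<in> edges cubic_part" using hE(1) cubic_edge by blast
      then show "P s = P t" by (rule edge_constantD[OF P]) (use st hE(3) in simp_all)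
    qed
    from parity[OF F(1,2,3) eHf this] show False using neq by blast
  qed
qed

text \<open>
  By \<open>neighbours_same_colour\<close>, a colouring of the vertices of degree 3 extends to the vertices of
  degree 2.
\<close>

lemma connected_cubic_part: "connected_graph cubic_part"
  unfolding connected_graph_linked
proof (intro conjI)
  show "graph cubic_part" by (rule graph_cubic_part)
  obtain v where v: "v \<in> verts G" using nonempty by blast
  obtain e y where e: "e \<in> edges G" "ends G e = {v, y}" "v \<noteq> y" "y \<in> verts G" using incident_edge[OF v] .
  have "degree G v = 3 \<or> degree G y = 3" using degree_3_neighbour[OF e(1,2)] degree_2_or_3[OF v] by blast
  then show "verts cubic_part \<noteq> {}" unfolding verts_cubic_part using v e by (auto simp: verts_of_degree_def)
  show "linked cubic_part (edges cubic_part)"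
  proof (rule linkedI)
    fix P a b assume P: "edge_constant cubic_part (edges cubic_part) P"
      and ab: "a \<in> verts cubic_part" "b \<in> verts cubic_part"
    have P': "edge_constant G (edges cubic_part) P"
      using P by (simp add: edge_constant_def del_verts_def)
    \<comment> \<open>A vertex of degree 2 takes the common colour of its neighbours, which have degree 3.\<close>
    let ?Q = "\<lambda>v. if degree G v = 2 then \<exists>e\<in>edges G. \<exists>y. ends G e = {v, y} \<and> P y else P v"
    have mixed: "?Q s = ?Q t" if e: "e \<in> edges G" "ends G e = {s, t}" and d: "degree G s = 2" for e s t
    proof -
      have dt: "degree G t = 3" using degree_3_neighbour[OF e d] .
      have same: "P y = P t" if "h \<in> edges G" "ends G h = {s, y}" for h y
        using neighbours_same_colour[OF P' d that e] .
      have "(\<exists>e\<in>edges G. \<exists>y. ends G e = {s, y} \<and> P y) = P t"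
      proof
        assume "\<exists>e\<in>edges G. \<exists>y. ends G e = {s, y} \<and> P y"
        then obtain h y where h: "h \<in> edges G" "ends G h = {s, y}" "P y" by blast
        show "P t" using h(3) unfolding same[OF h(1,2)] .
      qed (use e in blast)
      then show ?thesis using d dt by simp
    qed
    have "edge_constant G (edges G) ?Q"
    proof (rule edge_constantI_ends[OF graph order_refl])
      fix e s t assume e: "e \<in> edges G" "ends G e = {s, t}"
      have e': "ends G e = {t, s}" using e by auto
      have V: "s \<in> verts G" "t \<in> verts G" using graph e by (auto simp: graph_def)
      consider "degree G s = 2" | "degree G t = 2" | "degree G s = 3" "degree G t = 3"
        using degree_2_or_3 V by blast
      then show "?Q s = ?Q t"
      proof cases
        case 1 then show ?thesis by (rule mixed[OF e])
      next
        case 2 then show ?thesis by (rule mixed[OF e(1) e', symmetric])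
      next
        case 3
        then have "e \<in> edges cubic_part" using e cubic_edge by auto
        from edge_constant_ends[OF P' this e(2)] show ?thesis using 3 by simp
      qed
    qed
    from linkedD[OF linked this, of a b] show "P a = P b"
      using ab unfolding verts_cubic_part by (simp add: verts_of_degree_def)
  qed
qed

text \<open>
  Otherwise the vertices of degree 3 induce a tree. For each vertex \<open>v\<close> of degree 2 an edge \<open>m v\<close> at
  \<open>v\<close> is chosen for the matching; the other edge at \<open>v\<close> hangs \<open>v\<close> on the tree.
\<close>

lemma cycle_in_cubic_part: "\<exists>C. cycle_in C G \<and> verts C \<subseteq> verts_of_degree 3 G"
proof (rule ccontr)
  assume none: "\<not> ?thesis"
  have "cycle_in C G \<and> verts C \<subseteq> verts_of_degree 3 G" if C: "cycle_in C cubic_part" for C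
  proof
    show "verts C \<subseteq> verts_of_degree 3 G"
      using C unfolding verts_cubic_part[symmetric] by (simp add: cycle_in_def subgraph_def)
    show "cycle_in C G" using C by (auto simp: cycle_in_def subgraph_def del_verts_def)
  qed
  then have "tree cubic_part" using none connected_cubic_part unfolding tree_def by blast
  then have count3: "card (verts_of_degree 3 G) = card (edges cubic_part) + 1"
    using tree_iff_card[OF connected_cubic_part] verts_cubic_part by simp
  define D where "D = verts_of_degree 2 G"
  have D: "v \<in> D \<longleftrightarrow> v \<in> verts G \<and> degree G v = 2" for v by (simp add: D_def verts_of_degree_def)
  have finD: "finite D" using finite_verts by (simp add: D_def verts_of_degree_def)
  have "\<exists>e. e \<in> edges G \<and> v \<in> ends G e" if "v \<in> D" for v using incident_edge[of v] that D by blast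
  then obtain m where m: "\<And>v. v \<in> D \<Longrightarrow> m v \<in> edges G" "\<And>v. v \<in> D \<Longrightarrow> v \<in> ends G (m v)" by metis
  \<comment> \<open>Edges at different vertices of degree 2 are disjoint, since these vertices have neither an edge nor a neighbour in common.\<close>
  have apart: "v = w" if vw: "v \<in> D" "w \<in> D" and x: "h \<in> edges G" "k \<in> edges G"
      "v \<in> ends G h" "w \<in> ends G k" "x \<in> ends G h" "x \<in> ends G k" for v w h k x
  proof (rule ccontr)
    assume neq: "v \<noteq> w"
    have d: "degree G v = 2" "degree G w = 2" using vw D by auto
    obtain a where a: "ends G h = {v, a}" "v \<noteq> a" using other_end[OF x(1,3)] by metis
    obtain b where b: "ends G k = {w, b}" "w \<noteq> b" using other_end[OF x(2,4)] by metis
    have "degree G a = 3" "degree G b = 3"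
      using degree_3_neighbour[OF x(1) a(1) d(1)] degree_3_neighbour[OF x(2) b(1) d(2)] by blast+
    then have "a \<noteq> w" "b \<noteq> v" using d by auto
    then have "x = a" "x = b" using x(5,6) a(1) b(1) neq by auto
    then have "ends G h = {v, x}" "ends G k = {w, x}" using a(1) b(1) by blast+
    then show False using degree_2_no_common_neighbour[OF x(1) _ x(2) _ neq d] by blast
  qed
  have inj: "inj_on m D"
  proof (rule inj_onI)
    fix v w assume vw: "v \<in> D" "w \<in> D" "m v = m w"
    then show "v = w" using apart[OF vw(1,2) m(1)[OF vw(1)] m(1)[OF vw(2)], of v] m(2) by metis
  qed
  let ?M = "m ` D"
  have "splits G"
    unfolding splits_def
  proof (intro exI conjI)
    show "matching G ?M"
      unfolding matching_def
    proof (intro conjI ballI impI)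
      show "?M \<subseteq> edges G" using m(1) by blast
      fix h k assume hk: "h \<in> ?M" "k \<in> ?M" "h \<noteq> k"
      then obtain v w where vw: "v \<in> D" "w \<in> D" "h = m v" "k = m w" by blast
      show "ends G h \<inter> ends G k = {}"
      proof (rule ccontr)
        assume "ends G h \<inter> ends G k \<noteq> {}"
        then obtain x where "x \<in> ends G h" "x \<in> ends G k" by blast
        then have "v = w" using apart[OF vw(1,2), of h k x] vw m by blast
        then show False using vw hk by blast
      qed
    qed
    show "linked G (edges G - ?M)"
    proof (rule linkedI)
      fix P a b assume P: "edge_constant G (edges G - ?M) P" and ab: "a \<in> verts G" "b \<in> verts G"
      have "edges cubic_part \<subseteq> edges G - ?M" using cubic_edge m(2) D by fastforce
      from edge_constant_subset[OF P this] have "edge_constant cubic_part (edges cubic_part) P"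
        by (simp add: edge_constant_def del_verts_def)
      then have three: "P s = P t" if "s \<in> verts G" "t \<in> verts G" "degree G s = 3" "degree G t = 3" for s t
        using connected_cubic_part that unfolding connected_graph_linked verts_cubic_part
        by (intro linkedD[of cubic_part "edges cubic_part" P])
          (simp_all only: verts_cubic_part, simp_all add: verts_of_degree_def)
      have rep: "\<exists>t\<in>verts G. degree G t = 3 \<and> P s = P t" if s: "s \<in> verts G" for s
      proof (cases "degree G s = 3")
        case True then show ?thesis using s by blast
      next
        case False
        then have d: "degree G s = 2" using degree_2_or_3[OF s] by blast
        then have sD: "s \<in> D" using s D by blast
        obtain f z where f: "f \<in> edges G" "f \<noteq> m s" "ends G f = {s, z}" "z \<noteq> s" "z \<in> verts G"
            "\<forall>h\<in>edges G. s \<in> ends G h \<longleftrightarrow> h = m s \<or> h = f"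
          using degree_2_edges[OF s d m(1)[OF sD] m(2)[OF sD]] .
        have dz: "degree G z = 3" by (rule degree_3_neighbour[OF f(1,3) d])
        have "f \<notin> ?M"
        proof
          assume "f \<in> ?M"
          then obtain w where w: "w \<in> D" "f = m w" by blast
          then have "w = s \<or> w = z" using m(2)[OF w(1)] f(3) by simp
          then show False using w f(2) dz D by auto
        qed
        then have "P s = P z" using edge_constant_ends[OF P _ f(3)] f(1) by blast
        then show ?thesis using dz f(5) by blast
      qed
      obtain s where s: "s \<in> verts G" "degree G s = 3" "P a = P s" using rep[OF ab(1)] by (elim bexE conjE)
      obtain t where t: "t \<in> verts G" "degree G t = 3" "P b = P t" using rep[OF ab(2)] by (elim bexE conjE)
      show "P a = P b" unfolding s(3) t(3) by (rule three[OF s(1) t(1) s(2) t(2)])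
    qed
    let ?star = "\<lambda>v. {e \<in> edges G. v \<in> ends G e}"
    define B where "B = (\<Union>v\<in>D. ?star v)"
    have E: "edges G = edges cubic_part \<union> B" "edges cubic_part \<inter> B = {}"
      by (auto simp: del_verts_def D_def B_def)
    have fin: "finite (edges cubic_part)" "finite B"
      using finite_edges finD by (auto simp: del_verts_def B_def)
    have "card (edges G) = card (edges cubic_part \<union> B)" using E(1) by (rule arg_cong)
    also have "\<dots> = card (edges cubic_part) + card B" using fin E(2) by (rule card_Un_disjoint)
    finally have "card (edges G) = card (edges cubic_part) + card B" .
    moreover have "card B = (\<Sum>v\<in>D. card (?star v))"
      unfolding B_def
    proof (rule card_UN_disjoint[OF finD])
      show "\<forall>v\<in>D. finite (?star v)" using finite_edges by simp
      show "\<forall>v\<in>D. \<forall>w\<in>D. v \<noteq> w \<longrightarrow> ?star v \<inter> ?star w = {}"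
      proof (intro ballI impI)
        fix v w assume vw: "v \<in> D" "w \<in> D" "v \<noteq> w"
        have "False" if "h \<in> ?star v" "h \<in> ?star w" for h
          using apart[OF vw(1,2), of h h v] that vw(3) by blast
        then show "?star v \<inter> ?star w = {}" by blast
      qed
    qed
    moreover have "(\<Sum>v\<in>D. card (?star v)) = (\<Sum>v\<in>D. 2)"
      using D by (intro sum.cong) (simp_all add: degree_def)
    moreover have "card (verts G) = card (verts_of_degree 3 G) + card D"
    proof (rule card_removed[OF finite_verts])
      show "verts_of_degree 3 G \<subseteq> verts G" by (auto simp: verts_of_degree_def)
      show "verts G - verts_of_degree 3 G = D" using degree_2_or_3 unfolding verts_of_degree_def D_def by fastforce
    qed
    ultimately show "card (edges G) + 1 = card (verts G) + card ?M"
      using count3 card_image[OF inj] by simp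
  qed
  then show False using not_splits by blast
qed

end

theorem theorem1p5:
  fixes G :: "('v, 'e) mgraph"
  assumes "minimum_counterexample G"
  shows "(simple G \<and> edge_connected 2 G)
    \<and> girth G \<ge> 5
    \<and> (\<forall>u \<in> verts_of_degree 2 G. \<forall>v \<in> verts_of_degree 2 G. u \<noteq> v \<longrightarrow> distance G u v \<ge> 3)
    \<and> connected_graph (del_verts G (verts_of_degree 2 G))
    \<and> (\<exists>C. cycle_in C G \<and> verts C \<subseteq> verts_of_degree 3 G)"
proof -
  interpret smallest_counterexample G by (rule minimum_counterexampleD[OF assms])
  have "simple G" unfolding simple_def inj_on_def using graph no_parallel_edges by blast
  then show ?thesis
    using two_edge_connected girth_at_least_5 degree_2_far_apart connected_cubic_part cycle_in_cubic_part
    by (simp add: verts_of_degree_def)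
qed

end
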